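(* Let $\beta\in(0,\beta_c)$, where $\tanh\beta_c=\sqrt2-1$, and let $\beta^*$ be defined by $e^{-2\beta^*}=\tanh\beta$. Fix $u,v\in\mathbb Z^2$ with $u\ne v$, and choose $u^*,v^*,\gamma$ and the weights $x'_\gamma$ as in the context. Then the series $\sum_r f^{uu^*}_r(x'_\gamma)$ converges absolutely and \[ \lim_{G\to\mathbb Z^2}\langle\sigma_u\sigma_v\rangle^{\mathrm f}_{G,\beta}=\Big(\sum_{r=1}^\infty f^{uu^*}_r(x'_\gamma)\Big)\,\langle\sigma_{u^*}\sigma_{v^*}\rangle^+_{\mathbb Z^{2*},\beta^*}. \] This limit is denoted $\langle\sigma_u\sigma_v\rangle^{\mathrm f}_{\mathbb Z^2,\beta}$.
   Context: Finite rectangles $G=(V,E)$ in $\mathbb Z^2$: lattice points of $[a,b]\times[c,d]$ with nearest-neighbour edges. Free-boundary Ising: $P^{\mathrm f}_{G,\beta}(\sigma)\propto\prod_{xy\in E}e^{\beta\sigma_x\sigma_y}$ on $\{-1,1\}^V$, expectation $\langle\cdot\rangle^{\mathrm f}_{G,\beta}$. $G\to\mathbb Z^2$ means along rectangles eventually containing every finite set. $\mathbb Z^{2*}=\mathbb Z^2+(\frac12,\frac12)$ with nearest-neighbour edges; $\langle\sigma_{u^*}\sigma_{v^*}\rangle^+_{\mathbb Z^{2*},\beta^*}$ is the limit, along rectangles of $\mathbb Z^{2*}$ growing to $\mathbb Z^{2*}$, of the two-point function of the Ising model on those rectangles at inverse temperature $\beta^*$ with plus boundary conditions (spins equal to $+1$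 at vertices having a neighbour outside the rectangle); this limit exists since $\beta^*>\beta_c$ (it equals $1$ if $u^*=v^*$). Choose $u^*,v^*\in\mathbb Z^{2*}$ with $\|u-u^*\|_1=\|v-v^*\|_1=1$ and a self-avoiding path $\gamma$ in $\mathbb Z^{2*}$ from $u^*$ to $v^*$. Let $E_\gamma$ be the set of edges traversed by $\gamma$ together with the straight segments $uu^*$ and $vv^*$, and let $\mathbb Z^2_\gamma$ be the graph obtained from $\mathbb Z^2$ by adding the vertices of $\gamma$ and the edges $E_\gamma$ (embedded as straight segments; edges may cross). Edges in $E_\gamma$ are "additional", edges of $\mathbb Z^2$ "representative". Edge weights $x'_\gamma$: $1$ on $E_\gamma$, $-\tanh\beta$ on edges of $\mathbb Z^2$ that cross an edge of $\gamma$, $\tanh\beta$ on all other edges of $\mathbb Z^2$. Loops in $\mathbb Z^2_\gamma$: a path $(v_0,\dots,v_{n-1})$ has consecutive vertices adjacent and $v_{i+2}\neq v_i$; closed if all rotations are paths; a loop is a closed path lexicographically smallest among rotations of itself and its reversal; $m(\ell)$ = steps / smallest period; winding angle = sum over $i$ mod $n$ of turning angles in $(-\pi,\pi)$ from $v_{i+1}-v_i$ to $v_{i+2}-v_{i+1}$; $\operatorname{sgn}(\ell)=-e^{i\alpha(\ell)/2}$; $w(\ell;x)=\frac{\operatorname{sgn}(\ell)}{m(\ell)}\prod_i x_{v_iv_{i+1}}$. $\mathcal L^{uu^*}_r(\mathbb Z^2_\gamma)$ is the (finite) set of loops in $\mathbb Z^2_\gamma$ that traverse the edge $uu^*$ exactly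 once and take exactly $r$ steps along edges of $\mathbb Z^2$ (steps along $E_\gamma$ not counted), and $f^{uu^*}_r(x'_\gamma)=\sum_{\ell\in\mathcal L^{uu^*}_r(\mathbb Z^2_\gamma)}w(\ell;x'_\gamma)$. *)

theory Defs
  imports Complex_Main
begin

definition rect :: "int \<times> int \<times> int \<times> int \<Rightarrow> (int \<times> int) set" where
  "rect R = (case R of (a,b,c,d) \<Rightarrow> {(i,j). a \<le> i \<and> i \<le> b \<and> c \<le> j \<and> j \<le> d})"

text \<open>Filter "G tends to Z^2": rectangles eventually contain every finite set,
  i.e. eventually contain every box [-N,N]^2.\<close>
definition rect_filter :: "(int \<times> int \<times> int \<times> int) filter" where
  "rect_filter = (INF N::nat. principal {(a,b,c,d). a \<le> - int N \<and> int N \<le> b \<and> c \<le> - int N \<and> int N \<le> d})"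

definition nn :: "int \<times> int \<Rightarrow> int \<times> int \<Rightarrow> bool" where
  "nn x y \<longleftrightarrow> \<bar>fst x - fst y\<bar> + \<bar>snd x - snd y\<bar> = 1"

text \<open>Each nearest-neighbour edge of V counted once (oriented to the right / upwards).\<close>
definition nn_edges :: "(int \<times> int) set \<Rightarrow> ((int \<times> int) \<times> (int \<times> int)) set" where
  "nn_edges V = {(x,y). x \<in> V \<and> y \<in> V \<and> (y = (fst x + 1, snd x) \<or> y = (fst x, snd x + 1))}"

text \<open>Spin configurations on V whose spins on the set F are fixed to +1
  (spins outside V are set to +1 as a dummy convention; they never interact).\<close>
definition configs :: "(int \<times> int) set \<Rightarrow> (int \<times> int) set \<Rightarrow> ((int \<times> int) \<Rightarrow> real) set" where
  "configs V F = {\<sigma>. \<forall>x. (x \<in> V - F \<longrightarrow> \<sigma> x \<in> {-1, 1}) \<and> (x \<notin> V - F \<longrightarrow> \<sigma> x = 1)}"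

definition ising_weight :: "real \<Rightarrow> (int \<times> int) set \<Rightarrow> ((int \<times> int) \<Rightarrow> real) \<Rightarrow> real" where
  "ising_weight \<beta> V \<sigma> = exp (\<beta> * (\<Sum>(x,y)\<in>nn_edges V. \<sigma> x * \<sigma> y))"

definition ising_corr :: "real \<Rightarrow> (int \<times> int) set \<Rightarrow> (int \<times> int) set \<Rightarrow> int \<times> int \<Rightarrow> int \<times> int \<Rightarrow> real" where
  "ising_corr \<beta> V F x y =
     (\<Sum>\<sigma>\<in>configs V F. \<sigma> x * \<sigma> y * ising_weight \<beta> V \<sigma>) / (\<Sum>\<sigma>\<in>configs V F. ising_weight \<beta> V \<sigma>)"

definition free_corr :: "real \<Rightarrow> int \<times> int \<times> int \<times> int \<Rightarrow> int \<times> int \<Rightarrow> int \<times> int \<Rightarrow> real" where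
  "free_corr \<beta> R x y = ising_corr \<beta> (rect R) {} x y"

definition bdry :: "(int \<times> int) set \<Rightarrow> (int \<times> int) set" where
  "bdry V = {x \<in> V. \<exists>y. nn x y \<and> y \<notin> V}"

definition plus_corr :: "real \<Rightarrow> int \<times> int \<times> int \<times> int \<Rightarrow> int \<times> int \<Rightarrow> int \<times> int \<Rightarrow> real" where
  "plus_corr \<beta> R x y = ising_corr \<beta> (rect R) (bdry (rect R)) x y"

text \<open>We work in doubled coordinates: the point p of R^2 is represented by 2p.
  Primal vertices of Z^2 are then the points with both coordinates even, and
  dual vertices of Z^2* = Z^2 + (1/2,1/2) the points with both coordinates odd.\<close>

definition emb :: "int \<times> int \<Rightarrow> int \<times> int" where
  "emb u = (2 * fst u, 2 * snd u)"

definition primal :: "int \<times> int \<Rightarrow> bool" where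
  "primal p \<longleftrightarrow> even (fst p) \<and> even (snd p)"

definition dual :: "int \<times> int \<Rightarrow> bool" where
  "dual p \<longleftrightarrow> odd (fst p) \<and> odd (snd p)"

definition nn2 :: "int \<times> int \<Rightarrow> int \<times> int \<Rightarrow> bool" where
  "nn2 p q \<longleftrightarrow> \<bar>fst p - fst q\<bar> + \<bar>snd p - snd q\<bar> = 2 \<and> (fst p = fst q \<or> snd p = snd q)"

text \<open>Identification of the dual vertex (doubled coords, odd) (2i+1,2j+1),
  i.e. (i+1/2,j+1/2), with (i,j) in Z^2 (a graph isomorphism Z^2* -> Z^2).\<close>
definition dual_idx :: "int \<times> int \<Rightarrow> int \<times> int" where
  "dual_idx p = ((fst p - 1) div 2, (snd p - 1) div 2)"

text \<open>||u - u*||_1 = 1 for u in Z^2 and u* in Z^2* (u* given in doubled coordinates).\<close>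
definition dual_nbr :: "int \<times> int \<Rightarrow> int \<times> int \<Rightarrow> bool" where
  "dual_nbr u us \<longleftrightarrow> \<bar>fst us - 2 * fst u\<bar> = 1 \<and> \<bar>snd us - 2 * snd u\<bar> = 1"

definition dual_saw :: "(int \<times> int) list \<Rightarrow> int \<times> int \<Rightarrow> int \<times> int \<Rightarrow> bool" where
  "dual_saw \<gamma> us vs \<longleftrightarrow> \<gamma> \<noteq> [] \<and> hd \<gamma> = us \<and> last \<gamma> = vs \<and> distinct \<gamma> \<and>
     (\<forall>p\<in>set \<gamma>. dual p) \<and> (\<forall>i. Suc i < length \<gamma> \<longrightarrow> nn2 (\<gamma> ! i) (\<gamma> ! Suc i))"

definition Egam :: "int \<times> int \<Rightarrow> int \<times> int \<Rightarrow> (int \<times> int) list \<Rightarrow> int \<times> int \<Rightarrow> int \<times> int \<Rightarrow> bool" where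
  "Egam u v \<gamma> p q \<longleftrightarrow> {p, q} = {emb u, hd \<gamma>} \<or> {p, q} = {emb v, last \<gamma>} \<or>
     (\<exists>i. Suc i < length \<gamma> \<and> {p, q} = {\<gamma> ! i, \<gamma> ! Suc i})"

definition Zedge :: "int \<times> int \<Rightarrow> int \<times> int \<Rightarrow> bool" where
  "Zedge p q \<longleftrightarrow> primal p \<and> primal q \<and> nn2 p q"

definition adj :: "int \<times> int \<Rightarrow> int \<times> int \<Rightarrow> (int \<times> int) list \<Rightarrow> int \<times> int \<Rightarrow> int \<times> int \<Rightarrow> bool" where
  "adj u v \<gamma> p q \<longleftrightarrow> Zedge p q \<or> Egam u v \<gamma> p q"

text \<open>An edge of Z^2 crosses an edge of gamma iff the two (perpendicular unit)
  segments have the same midpoint.\<close>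
definition crosses_gamma :: "(int \<times> int) list \<Rightarrow> int \<times> int \<Rightarrow> int \<times> int \<Rightarrow> bool" where
  "crosses_gamma \<gamma> p q \<longleftrightarrow> (\<exists>i. Suc i < length \<gamma> \<and>
     fst p + fst q = fst (\<gamma> ! i) + fst (\<gamma> ! Suc i) \<and> snd p + snd q = snd (\<gamma> ! i) + snd (\<gamma> ! Suc i))"

definition xw :: "real \<Rightarrow> int \<times> int \<Rightarrow> int \<times> int \<Rightarrow> (int \<times> int) list \<Rightarrow> int \<times> int \<Rightarrow> int \<times> int \<Rightarrow> real" where
  "xw \<beta> u v \<gamma> p q =
     (if Egam u v \<gamma> p q then 1
      else if Zedge p q \<and> crosses_gamma \<gamma> p q then - tanh \<beta> else tanh \<beta>)"

definition cyc :: "'a list \<Rightarrow> nat \<Rightarrow> 'a" where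
  "cyc l i = l ! (i mod length l)"

definition closed_path :: "int \<times> int \<Rightarrow> int \<times> int \<Rightarrow> (int \<times> int) list \<Rightarrow> (int \<times> int) list \<Rightarrow> bool" where
  "closed_path u v \<gamma> l \<longleftrightarrow> l \<noteq> [] \<and>
     (\<forall>i < length l. adj u v \<gamma> (cyc l i) (cyc l (i + 1)) \<and> cyc l (i + 2) \<noteq> cyc l i)"

definition vless :: "int \<times> int \<Rightarrow> int \<times> int \<Rightarrow> bool" where
  "vless p q \<longleftrightarrow> fst p < fst q \<or> (fst p = fst q \<and> snd p < snd q)"

definition lex_le :: "(int \<times> int) list \<Rightarrow> (int \<times> int) list \<Rightarrow> bool" where
  "lex_le xs ys \<longleftrightarrow> xs = ys \<or> (xs, ys) \<in> lexord {(p, q). vless p q}"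

definition is_loop :: "int \<times> int \<Rightarrow> int \<times> int \<Rightarrow> (int \<times> int) list \<Rightarrow> (int \<times> int) list \<Rightarrow> bool" where
  "is_loop u v \<gamma> l \<longleftrightarrow> closed_path u v \<gamma> l \<and>
     (\<forall>k < length l. lex_le l (rotate k l) \<and> lex_le l (rotate k (rev l)))"

definition mult :: "'a list \<Rightarrow> nat" where
  "mult l = length l div (LEAST p. 0 < p \<and> (\<forall>i < length l. cyc l (i + p) = cyc l i))"

definition dirc :: "int \<times> int \<Rightarrow> int \<times> int \<Rightarrow> complex" where
  "dirc a b = Complex (of_int (fst b - fst a)) (of_int (snd b - snd a))"

definition turn :: "int \<times> int \<Rightarrow> int \<times> int \<Rightarrow> int \<times> int \<Rightarrow> real" where
  "turn a b c = Arg (dirc b c / dirc a b)"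

definition winding :: "(int \<times> int) list \<Rightarrow> real" where
  "winding l = (\<Sum>i < length l. turn (cyc l i) (cyc l (i + 1)) (cyc l (i + 2)))"

definition loop_sgn :: "(int \<times> int) list \<Rightarrow> complex" where
  "loop_sgn l = - exp (\<i> * complex_of_real (winding l / 2))"

definition loop_weight :: "real \<Rightarrow> int \<times> int \<Rightarrow> int \<times> int \<Rightarrow> (int \<times> int) list \<Rightarrow> (int \<times> int) list \<Rightarrow> complex" where
  "loop_weight \<beta> u v \<gamma> l = loop_sgn l / of_nat (mult l) *
     complex_of_real (\<Prod>i < length l. xw \<beta> u v \<gamma> (cyc l i) (cyc l (i + 1)))"

definition loops_r :: "int \<times> int \<Rightarrow> int \<times> int \<Rightarrow> (int \<times> int) list \<Rightarrow> nat \<Rightarrow> (int \<times> int) list set" where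
  "loops_r u v \<gamma> r = {l. is_loop u v \<gamma> l \<and>
     card {i. i < length l \<and> {cyc l i, cyc l (i + 1)} = {emb u, hd \<gamma>}} = 1 \<and>
     card {i. i < length l \<and> Zedge (cyc l i) (cyc l (i + 1))} = r}"

definition f_r :: "real \<Rightarrow> int \<times> int \<Rightarrow> int \<times> int \<Rightarrow> (int \<times> int) list \<Rightarrow> nat \<Rightarrow> complex" where
  "f_r \<beta> u v \<gamma> r = (\<Sum>l \<in> loops_r u v \<gamma> r. loop_weight \<beta> u v \<gamma> l)"

definition dual_plus_corr :: "real \<Rightarrow> int \<times> int \<Rightarrow> int \<times> int \<Rightarrow> real" where
  "dual_plus_corr \<beta> us vs = Lim rect_filter (\<lambda>R. plus_corr \<beta> R (dual_idx us) (dual_idx vs))"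

end

theory Submission
  imports Defs "HOL-Analysis.Analysis"
begin

text \<open>
  Reversing the couplings crossed by a dual path turns spin correlations into order-disorder correlations. Moving the
  free end of the path across an edge is an elementary identity for these, and it says that suitable combinations
  attached to the edges entering and leaving a vertex are related by the Kac-Ward transition matrix (a turn by the angle
  a has weight exp(i a / 2)). The monodromy is wrong only at the vertex v itself, which produces a source term. Thus the free
  two-point function is the partition function with weights x'_gamma times the resolvent of the transition operator
  between v and u, a sum over non-backtracking walks, and since the operator has norm at most x (1 + sqrt 2) < 1 on square
  summable functions this sum is controlled uniformly in the rectangle.

  Closing a walk by gamma gives exactly the loops that traverse the edge from u to us once. The winding of gamma is
  compared with its crossings of two vertical rays by a discrete form of Hopf's theorem on total turning. Finally the ratio of the
  partition functions with weights x'_gamma and x is the plus two-point function of the dual model by Kramers-Wannier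
  duality, and that function decreases in the domain by Griffiths' second inequality, so that its limit exists.
\<close>

text \<open>The obstacle is a sign. For a loop closed by gamma, both the total turning and the
  negative weights depend on gamma, and neither is determined by the walk from v to u alone. The
  weights \<open>xw\<close> differ from those of two vertical disorder lines
  (\<open>step_weight\<close>) by the gauge function \<open>path_cross\<close>, so a walk from v to
  u collects \<open>path_cross\<close> at its two ends; the discrete Hopf theorem extracts the same
  two factors from the turning of gamma. They cancel, and what remains is minus
  \<open>side_sign\<close>, the normalisation with which the corner field at u is recovered from the
  resolvent. The bound must not degrade with the rectangle. Every operator therefore acts on
  functions on the whole lattice, and the rectangle enters only through weights that vanish outside
  it. The contraction constant is local: as a quadratic form, the squared norm of the 4 by 4 matrix
  of turns is 3 + 2 M with M symmetric and M^2 = 2, so the norm is 1 + sqrt 2, and x (1 + sqrt 2) <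
  1 is exactly tanh beta < sqrt 2 - 1.\<close>

type_synonym vertex = "int \<times> int"

section \<open>Spin sums\<close>

text \<open>The half-angle phase of a turn from direction a to b is h b / h a times tw a b, for a square root h of the
  direction that is cut along a ray slightly clockwise of the upward direction; the tie on the vertical axis in
  right_of_cut places the ray there.\<close>

definition right_of_cut :: "vertex \<Rightarrow> bool" where
  "right_of_cut a \<longleftrightarrow> fst a > 0 \<or> (fst a = 0 \<and> snd a < 0)"

definition tw :: "vertex \<Rightarrow> vertex \<Rightarrow> real" where
  "tw a b = (if right_of_cut a \<noteq> right_of_cut b \<and>
     (if right_of_cut a then fst a * snd b - snd a * fst b > 0 else fst a * snd b - snd a * fst b < 0)
     then -1 else 1)"

definition dirs :: "vertex set" where
  "dirs = {(1,0),(0,1),(-1,0),(0,-1)}"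

text \<open>Faces are named by their lower left vertex. The edges of sign -1 are those crossed by the vertical disorder
  line running from the face f down to infinity.\<close>

definition column_sign :: "vertex \<Rightarrow> vertex \<Rightarrow> vertex \<Rightarrow> real" where
  "column_sign f p q = (if snd p = snd q \<and> min (fst p) (fst q) = fst f \<and> snd p \<le> snd f then -1 else 1)"

lemma tw_sq [simp]: "tw a b * tw a b = 1" "tw a b * (tw a b * c) = c"
  by (auto simp: tw_def)

lemma column_sign_sq [simp]: "column_sign f p q * column_sign f p q = 1"
  "column_sign f p q * (column_sign f p q * c) = c"
  by (auto simp: column_sign_def)

lemma column_sign_commute: "column_sign f q p = column_sign f p q"
  by (auto simp: column_sign_def min.commute)

lemma abs_column_sign [simp]: "\<bar>column_sign f p q\<bar> = 1"
  by (auto simp: column_sign_def)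

lemma abs_tw [simp]: "\<bar>tw p q\<bar> = 1"
  by (auto simp: tw_def)

definition transition :: "vertex \<Rightarrow> vertex \<Rightarrow> real" where
  "transition d' d = (if d' = - d then 0 else tw d' d)"

lemma finite_dirs [simp]: "finite dirs" by (simp add: dirs_def)

lemma configs_eq_image:
  "configs V F = (\<lambda>h x. if x \<in> V - F then h x else 1) ` (PiE (V - F) (\<lambda>_. {-1, 1}))"
proof (intro set_eqI iffI)
  fix \<sigma> assume "\<sigma> \<in> configs V F"
  then have "\<sigma> = (\<lambda>x. if x \<in> V - F then restrict \<sigma> (V - F) x else 1)"
    "restrict \<sigma> (V - F) \<in> PiE (V - F) (\<lambda>_. {-1, 1})"
    by (auto simp: configs_def fun_eq_iff)
  then show "\<sigma> \<in> (\<lambda>h x. if x \<in> V - F then h x else 1) ` (PiE (V - F) (\<lambda>_. {-1, 1}))"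
    by (rule image_eqI)
qed (fastforce simp: configs_def PiE_def Pi_def)

lemma finite_configs [simp]: "finite V \<Longrightarrow> finite (configs V F)"
  unfolding configs_eq_image by (intro finite_imageI finite_PiE) auto

lemma configs_val: "\<sigma> \<in> configs V F \<Longrightarrow> \<sigma> x = 1 \<or> \<sigma> x = -1"
  unfolding configs_def by blast

lemma configs_sq: "\<sigma> \<in> configs V F \<Longrightarrow> \<sigma> x * \<sigma> x = 1"
  using configs_val[of \<sigma> V F x] by auto

lemma ones_in_configs: "(\<lambda>_. 1) \<in> configs V F"
  by (auto simp: configs_def)

lemma configs_mult: "\<sigma> \<in> configs V F \<Longrightarrow> \<tau> \<in> configs V F \<Longrightarrow> (\<lambda>x. \<sigma> x * \<tau> x) \<in> configs V F"
  by (force simp: configs_def)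

lemma sum_configs_shift:
  assumes "g \<in> configs V F"
  shows "(\<Sum>\<sigma>\<in>configs V F. h \<sigma>) = (\<Sum>\<sigma>\<in>configs V F. h (\<lambda>x. \<sigma> x * g x))"
proof (rule sum.reindex_bij_witness[where i = "\<lambda>\<sigma> x. \<sigma> x * g x" and j = "\<lambda>\<sigma> x. \<sigma> x * g x"])
  fix \<sigma> assume "\<sigma> \<in> configs V F"
  show "(\<lambda>x. \<sigma> x * g x * g x) = \<sigma>" using configs_sq[OF assms] by (simp add: mult.assoc)
  then show "h (\<lambda>x. \<sigma> x * g x * g x) = h \<sigma>" by simp
qed (use configs_sq[OF assms] configs_mult assms in \<open>simp_all add: mult.assoc\<close>)

lemma finite_rect [simp]: "finite (rect R)"
proof -
  obtain a b c d where R: "R = (a,b,c,d)" by (cases R)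
  have "rect R \<subseteq> {a..b} \<times> {c..d}" by (auto simp: R rect_def)
  then show ?thesis by (rule finite_subset) auto
qed

lemma finite_nn_edges [simp]: "finite V \<Longrightarrow> finite (nn_edges V)"
  by (rule finite_subset[of _ "V \<times> V"]) (auto simp: nn_edges_def)

text \<open>With w constantly tanh beta this is, up to a power of cosh beta, the numerator of a free
  correlation. In this high-temperature form, reversing a coupling changes one factor only. At p = v
  the marked spins cancel and a partition function remains.\<close>

definition spin_sum :: "vertex set \<Rightarrow> (vertex \<Rightarrow> vertex \<Rightarrow> real) \<Rightarrow> vertex \<Rightarrow> vertex \<Rightarrow> real" where
  "spin_sum V w p v = (\<Sum>\<sigma>\<in>configs V {}. \<sigma> p * \<sigma> v * (\<Prod>(a,b)\<in>nn_edges V. 1 + w a b * (\<sigma> a * \<sigma> b)))"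

lemma spin_sum_cong:
  assumes "\<And>a b. (a,b) \<in> nn_edges V \<Longrightarrow> w a b = w' a b"
  shows "spin_sum V w p v = spin_sum V w' p v"
  unfolding spin_sum_def
  by (intro sum.cong refl arg_cong2[where f="(*)"] prod.cong) (auto simp: assms)

text \<open>Substituting the product of \<sigma> and g for \<sigma> transfers the signs from the
  couplings to the two marked spins. This is how a disorder line is deformed across a set of
  vertices.\<close>

lemma spin_sum_gauge:
  assumes g: "\<And>x. g x = 1 \<or> g x = -1" and p: "p \<in> V" and v: "v \<in> V"
  shows "spin_sum V (\<lambda>a b. w a b * (g a * g b)) p v = g p * g v * spin_sum V w p v"
proof -
  define g' where "g' x = (if x \<in> V then g x else 1)" for x
  have g': "g' \<in> configs V {}" using g by (auto simp: g'_def configs_def)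
  have "spin_sum V w p v = (\<Sum>\<sigma>\<in>configs V {}. \<sigma> p * g' p * (\<sigma> v * g' v) *
      (\<Prod>(a,b)\<in>nn_edges V. 1 + w a b * (\<sigma> a * g' a * (\<sigma> b * g' b))))"
    unfolding spin_sum_def by (rule sum_configs_shift[OF g'])
  also have "\<dots> = (\<Sum>\<sigma>\<in>configs V {}. g p * g v * (\<sigma> p * \<sigma> v *
      (\<Prod>(a,b)\<in>nn_edges V. 1 + w a b * (g a * g b) * (\<sigma> a * \<sigma> b))))"
  proof (rule sum.cong[OF refl])
    fix \<sigma>
    have "(\<Prod>(a,b)\<in>nn_edges V. 1 + w a b * (\<sigma> a * g' a * (\<sigma> b * g' b))) =
      (\<Prod>(a,b)\<in>nn_edges V. 1 + w a b * (g a * g b) * (\<sigma> a * \<sigma> b))"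
      by (intro prod.cong) (auto simp: nn_edges_def g'_def)
    then show "\<sigma> p * g' p * (\<sigma> v * g' v) * (\<Prod>(a,b)\<in>nn_edges V. 1 + w a b * (\<sigma> a * g' a * (\<sigma> b * g' b)))
      = g p * g v * (\<sigma> p * \<sigma> v * (\<Prod>(a,b)\<in>nn_edges V. 1 + w a b * (g a * g b) * (\<sigma> a * \<sigma> b)))"
      using p v by (simp add: g'_def)
  qed
  also have "\<dots> = g p * g v * spin_sum V (\<lambda>a b. w a b * (g a * g b)) p v"
    by (simp add: spin_sum_def sum_distrib_left)
  finally have e: "spin_sum V w p v = g p * g v * spin_sum V (\<lambda>a b. w a b * (g a * g b)) p v" .
  have "g p * g v * (g p * g v) = 1" using g[of p] g[of v] by auto
  then show ?thesis unfolding e by (simp add: mult.assoc[symmetric])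
qed

text \<open>With s = w \<sigma>(a) \<sigma>(b), the two factors 1 + s and 1 - s of the edge differ
  by 2 s and add up to 2. The s in the difference carries the marked spin from p to the other end
  q.\<close>

lemma spin_sum_flip:
  assumes V: "finite V" and e: "(a,b) \<in> nn_edges V" and w': "w' a b = - w a b"
    and eq: "\<And>c d. (c,d) \<in> nn_edges V \<Longrightarrow> (c,d) \<noteq> (a,b) \<Longrightarrow> w' c d = w c d"
    and pq: "(p = a \<and> q = b) \<or> (p = b \<and> q = a)"
  shows "spin_sum V w p v - spin_sum V w' p v = w a b * (spin_sum V w q v + spin_sum V w' q v)"
proof -
  define R where "R \<sigma> = (\<Prod>(c,d)\<in>nn_edges V - {(a,b)}. 1 + w c d * (\<sigma> c * \<sigma> d))" for \<sigma>
  have P: "(\<Prod>(c,d)\<in>nn_edges V. 1 + w c d * (\<sigma> c * \<sigma> d)) = (1 + w a b * (\<sigma> a * \<sigma> b)) * R \<sigma>" for \<sigma>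
    using prod.remove[OF finite_nn_edges[OF V] e, of "\<lambda>(c,d). 1 + w c d * (\<sigma> c * \<sigma> d)"]
    by (simp add: R_def)
  have "(\<Prod>(c,d)\<in>nn_edges V - {(a,b)}. 1 + w' c d * (\<sigma> c * \<sigma> d)) = R \<sigma>" for \<sigma>
    unfolding R_def
  proof (rule prod.cong[OF refl])
    fix z assume "z \<in> nn_edges V - {(a,b)}"
    then show "(case z of (c,d) \<Rightarrow> 1 + w' c d * (\<sigma> c * \<sigma> d)) = (case z of (c,d) \<Rightarrow> 1 + w c d * (\<sigma> c * \<sigma> d))"
      using eq[of "fst z" "snd z"] by (cases z) simp
  qed
  then have P': "(\<Prod>(c,d)\<in>nn_edges V. 1 + w' c d * (\<sigma> c * \<sigma> d)) = (1 - w a b * (\<sigma> a * \<sigma> b)) * R \<sigma>" for \<sigma>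
    using prod.remove[OF finite_nn_edges[OF V] e, of "\<lambda>(c,d). 1 + w' c d * (\<sigma> c * \<sigma> d)"]
    by (simp add: w')
  have "spin_sum V w p v - spin_sum V w' p v = (\<Sum>\<sigma>\<in>configs V {}. 2 * w a b * \<sigma> q * \<sigma> v * R \<sigma>)"
    unfolding spin_sum_def P P' sum_subtractf[symmetric]
  proof (rule sum.cong[OF refl])
    fix \<sigma> assume \<sigma>: "\<sigma> \<in> configs V {}"
    have "\<sigma> q = \<sigma> p * (\<sigma> a * \<sigma> b)"
      using pq configs_val[OF \<sigma>, of a] configs_val[OF \<sigma>, of b] by auto
    then show "\<sigma> p * \<sigma> v * ((1 + w a b * (\<sigma> a * \<sigma> b)) * R \<sigma>) - \<sigma> p * \<sigma> v * ((1 - w a b * (\<sigma> a * \<sigma> b)) * R \<sigma>) =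
         2 * w a b * \<sigma> q * \<sigma> v * R \<sigma>" by (simp add: algebra_simps)
  qed
  also have "\<dots> = w a b * (spin_sum V w q v + spin_sum V w' q v)"
    unfolding spin_sum_def P P' sum.distrib[symmetric] sum_distrib_left
    by (rule sum.cong[OF refl]) (simp add: algebra_simps)
  finally show ?thesis .
qed

section \<open>The corner field and its Kac-Ward recursion\<close>

text \<open>Lines running down from both faces carry the same flux as reversing the edges crossed by
  a dual path between the faces. The value 0 outside V lets every rectangle be treated on the whole
  lattice.\<close>

definition step_weight :: "vertex set \<Rightarrow> real \<Rightarrow> vertex \<Rightarrow> vertex \<Rightarrow> vertex \<Rightarrow> vertex \<Rightarrow> real" where
  "step_weight V x us vs p q = (if p \<in> V \<and> q \<in> V then x * column_sign us p q * column_sign vs p q else 0)"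

text \<open>In this section us, vs and f are faces. The corner field is the order-disorder correlation with disorder lines
  at us and f; it has a branch cut (cut_sign) running upwards from v, and the signs side_sign and vertical_sign move
  this cut to the corner between v and vs. In the high-temperature expansion, psi_field p d collects the configurations
  containing the edge that enters p in direction d.\<close>

definition corner_sum :: "vertex set \<Rightarrow> real \<Rightarrow> vertex \<Rightarrow> vertex \<Rightarrow> vertex \<Rightarrow> vertex \<Rightarrow> real" where
  "corner_sum V x us v p f = spin_sum V (\<lambda>a b. x * column_sign us a b * column_sign f a b) p v"

definition cut_sign :: "vertex \<Rightarrow> int \<Rightarrow> int \<Rightarrow> real" where
  "cut_sign v i j = (if fst v = i \<and> snd v \<le> j then -1 else 1)"

definition side_sign :: "vertex \<Rightarrow> vertex \<Rightarrow> vertex \<Rightarrow> int \<Rightarrow> real" where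
  "side_sign v vs p c = (if (fst p \<le> fst vs) \<noteq> (fst v \<le> fst vs) \<or> fst p = fst v \<and> c = fst vs \<and> snd p > snd vs
     then -1 else 1)"

definition vertical_sign :: "vertex \<Rightarrow> vertex \<Rightarrow> int \<Rightarrow> int \<Rightarrow> real" where
  "vertical_sign v vs i j = (if i = fst v then if fst vs = fst v then 1 else cut_sign v i j
     else if (i \<le> fst vs) = (fst v \<le> fst vs) then 1 else -1)"

definition psi_field :: "vertex set \<Rightarrow> real \<Rightarrow> vertex \<Rightarrow> vertex \<Rightarrow> vertex \<Rightarrow> vertex \<Rightarrow> vertex \<Rightarrow> real" where
  "psi_field V x us v vs p d = (case p of (i,j) \<Rightarrow> let C = corner_sum V x us v p in if p \<notin> V then 0 else
     if d = (-1,0) then side_sign v vs p i * (C (i,j-1) - C (i,j)) / 2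
     else if d = (1,0) then side_sign v vs p (i-1) * (C (i-1,j-1) - C (i-1,j)) / 2
     else if d = (0,-1) then vertical_sign v vs i j * (C (i-1,j) + cut_sign v i j * C (i,j)) / 2
     else vertical_sign v vs i (j-1) * (C (i-1,j-1) - cut_sign v i (j-1) * C (i,j-1)) / 2)"

text \<open>\<open>psi_field\<close> at - d and \<open>out_field\<close> at d belong to the same
  edge at p and differ in the relative sign of the two corners beside it: one combination keeps the
  high-temperature configurations containing the edge, the other those without it.\<close>

definition out_field :: "vertex set \<Rightarrow> real \<Rightarrow> vertex \<Rightarrow> vertex \<Rightarrow> vertex \<Rightarrow> vertex \<Rightarrow> vertex \<Rightarrow> real" where
  "out_field V x us v vs p d = (case p of (i,j) \<Rightarrow> let C = corner_sum V x us v p in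
     if d = (1,0) then side_sign v vs p i * (C (i,j-1) + C (i,j)) / 2
     else if d = (-1,0) then side_sign v vs p (i-1) * (C (i-1,j-1) + C (i-1,j)) / 2
     else if d = (0,1) then vertical_sign v vs i j * (C (i-1,j) - cut_sign v i j * C (i,j)) / 2
     else vertical_sign v vs i (j-1) * (C (i-1,j-1) + cut_sign v i (j-1) * C (i,j-1)) / 2)"

context
  fixes V :: "vertex set" and x :: real and us v vs :: "vertex"
  assumes V: "finite V" and v: "v \<in> V"
    and vs1: "fst vs = fst v \<or> fst vs = fst v - 1"
    and vs2: "snd vs = snd v \<or> snd vs = snd v - 1"
begin

abbreviation (input) "corner \<equiv> corner_sum V x us v"
abbreviation (input) "csgn \<equiv> cut_sign v"
abbreviation (input) "kap \<equiv> side_sign v vs"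
abbreviation (input) "kv \<equiv> vertical_sign v vs"
abbreviation (input) "psi \<equiv> psi_field V x us v vs"
abbreviation (input) "out \<equiv> out_field V x us v vs"

text \<open>The disorder lines of the faces below and above the edge from (i,j) to (i+1,j) differ in
  that edge only, so \<open>spin_sum_flip\<close> applies; when the edge is missing the two sums
  agree.\<close>

lemma corner_right:
  assumes "p \<in> V" "p = (i,j) \<and> q = (i+1,j) \<or> p = (i+1,j) \<and> q = (i,j)"
  shows "corner p (i,j-1) - corner p (i,j) =
    (if q \<in> V then x * column_sign us p q else 0) * (corner q (i,j-1) + corner q (i,j))"
proof -
  let ?w = "\<lambda>f a b. x * column_sign us a b * column_sign f a b"
  have same: "?w (i,j-1) a b = ?w (i,j) a b" if "(a,b) \<in> nn_edges V" "(a,b) \<noteq> ((i,j),(i+1,j))" for a b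
  proof -
    have "column_sign (i,j-1) a b = column_sign (i,j) a b"
      using that by (auto simp: nn_edges_def column_sign_def min_def)
    then show ?thesis by simp
  qed
  show ?thesis
  proof (cases "q \<in> V")
    case True
    then have e: "((i,j),(i+1,j)) \<in> nn_edges V" using assms by (auto simp: nn_edges_def)
    have "corner p (i,j-1) - corner p (i,j) = ?w (i,j-1) (i,j) (i+1,j) * (corner q (i,j-1) + corner q (i,j))"
      unfolding corner_sum_def
    proof (rule spin_sum_flip[OF V e])
      show "?w (i,j) (i,j) (i+1,j) = - ?w (i,j-1) (i,j) (i+1,j)" by (simp add: column_sign_def)
      show "?w (i,j) a b = ?w (i,j-1) a b" if "(a,b) \<in> nn_edges V" "(a,b) \<noteq> ((i,j),(i+1,j))" for a b
        by (rule same[OF that, symmetric])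
    qed (use assms in blast)
    moreover have "?w (i,j-1) (i,j) (i+1,j) = x * column_sign us p q"
      using assms(2) by (auto simp: column_sign_def)
    ultimately show ?thesis using True by simp
  next
    case False
    have "corner p (i,j-1) = corner p (i,j)"
      unfolding corner_sum_def
    proof (rule spin_sum_cong)
      fix a b assume e: "(a,b) \<in> nn_edges V"
      moreover have "(a,b) \<noteq> ((i,j),(i+1,j))" using e False assms(2) by (auto simp: nn_edges_def)
      ultimately show "?w (i,j-1) a b = ?w (i,j) a b" by (rule same)
    qed
    then show ?thesis using False by simp
  qed
qed

text \<open>The disorder lines of the faces left and right of the edge from (i,j) to (i,j+1) lie in
  adjacent columns. The gauge transformation by -1 on the half column of vertices (i,l) with l \<le>
  j moves one line onto the other and leaves the sign of that edge reversed. If v lies in the half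
  column its spin changes sign too, which is the factor \<open>cut_sign\<close>.\<close>

lemma corner_up:
  assumes p: "p \<in> V" and pq: "p = (i,j) \<and> q = (i,j+1) \<and> s = 1 \<or> p = (i,j+1) \<and> q = (i,j) \<and> s = -1"
  shows "corner p (i-1,j) + s * csgn i j * corner p (i,j) =
    (if q \<in> V then x * column_sign us p q else 0) * (corner q (i-1,j) + s * csgn i j * corner q (i,j))"
proof -
  let ?w = "\<lambda>f a b. x * column_sign us a b * column_sign f a b"
  define g :: "vertex \<Rightarrow> real" where "g a = (if fst a = i \<and> snd a \<le> j then -1 else 1)" for a
  let ?w' = "\<lambda>a b. ?w (i-1,j) a b * (g a * g b)"
  have gv: "g v = csgn i j" by (auto simp: g_def cut_sign_def)
  have c2: "csgn i j * csgn i j = 1" by (auto simp: cut_sign_def)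
  have gp: "g p = - s" "s = 1 \<or> s = -1" using pq by (auto simp: g_def)
  have gauge: "spin_sum V ?w' a v = g a * csgn i j * corner a (i-1,j)" if "a \<in> V" for a
    unfolding corner_sum_def gv[symmetric] by (rule spin_sum_gauge) (auto simp: g_def that v)
  have same: "?w' a b = ?w (i,j) a b" if "(a,b) \<in> nn_edges V" "(a,b) \<noteq> ((i,j),(i,j+1))" for a b
  proof -
    from that(1) consider "b = (fst a + 1, snd a)" | "b = (fst a, snd a + 1)" by (auto simp: nn_edges_def)
    then have "column_sign (i-1,j) a b * (g a * g b) = column_sign (i,j) a b"
      using that(2) by cases (cases a; auto simp: column_sign_def g_def)+
    then show ?thesis by (simp add: mult.assoc)
  qed
  show ?thesis
  proof (cases "q \<in> V")
    case True
    then have e: "((i,j),(i,j+1)) \<in> nn_edges V" using assms by (auto simp: nn_edges_def)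
    have gq: "g q = s" using pq by (auto simp: g_def)
    have "spin_sum V (?w (i,j)) p v - spin_sum V ?w' p v
        = ?w (i,j) (i,j) (i,j+1) * (spin_sum V (?w (i,j)) q v + spin_sum V ?w' q v)"
    proof (rule spin_sum_flip[OF V e])
      show "?w' (i,j) (i,j+1) = - ?w (i,j) (i,j) (i,j+1)" by (simp add: column_sign_def g_def)
    qed (use same pq in blast)+
    then have "corner p (i,j) + s * csgn i j * corner p (i-1,j) =
       x * (corner q (i,j) + s * csgn i j * corner q (i-1,j))"
      unfolding gauge[OF p] gauge[OF True] gp gq by (simp add: corner_sum_def column_sign_def)
    then have "s * csgn i j * (corner p (i,j) + s * csgn i j * corner p (i-1,j)) =
       s * csgn i j * (x * (corner q (i,j) + s * csgn i j * corner q (i-1,j)))" by simp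
    moreover have "s * csgn i j * (A + s * csgn i j * B) = B + s * csgn i j * A" for A B
      using gp(2) c2 by (auto simp: algebra_simps)
    moreover have "s * csgn i j * (x * (A + s * csgn i j * B)) = x * (B + s * csgn i j * A)" for A B
      using gp(2) c2 by (auto simp: algebra_simps)
    ultimately show ?thesis using True pq by (auto simp: column_sign_def)
  next
    case False
    have "spin_sum V ?w' p v = corner p (i,j)"
      unfolding corner_sum_def
    proof (rule spin_sum_cong)
      fix a b assume e: "(a,b) \<in> nn_edges V"
      moreover have "(a,b) \<noteq> ((i,j),(i,j+1))" using e False pq by (auto simp: nn_edges_def)
      ultimately show "?w' a b = ?w (i,j) a b" by (rule same)
    qed
    then have "corner p (i,j) = - s * csgn i j * corner p (i-1,j)" using gauge[OF p] gp by simp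
    then show ?thesis using False gp(2) c2 by (auto simp: algebra_simps)
  qed
qed

text \<open>Crossing an edge exchanges the two relative signs of the corners beside it. The factor
  \<open>column_sign vs\<close> of the step comes from \<open>side_sign\<close>, which changes when
  the column of vs is crossed at or below vs.\<close>

lemma psi_field_out_field:
  assumes d: "d \<in> dirs" shows "psi (p + d) d = step_weight V x us vs p (p + d) * out p d"
proof (cases "p + d \<in> V")
  case False then show ?thesis by (simp add: psi_field_def Let_def step_weight_def split: prod.split)
next
  case q: True
  obtain i j where p: "p = (i,j)" by (cases p)
  consider (R) "d = (1,0)" | (U) "d = (0,1)" | (L) "d = (-1,0)" | (D) "d = (0,-1)"
    using d by (auto simp: dirs_def)
  then show ?thesis
  proof cases
    case R
    have q': "(i+1,j) \<in> V" using q R p by simp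
    have k: "kap (i+1,j) i = column_sign vs (i,j) (i+1,j) * kap (i,j) i"
      using vs1 by (cases "i = fst vs") (auto simp: side_sign_def column_sign_def)
    show ?thesis using corner_right[OF q', of i j "(i,j)"] q'
      by (simp add: R p psi_field_def Let_def out_field_def Let_def step_weight_def k column_sign_commute)
  next
    case L
    have q': "(i-1,j) \<in> V" using q L p by simp
    have k: "kap (i-1,j) (i-1) = column_sign vs (i-1,j) (i,j) * kap (i,j) (i-1)"
      using vs1 by (cases "i - 1 = fst vs") (auto simp: side_sign_def column_sign_def)
    show ?thesis using corner_right[OF q', of "i-1" j "(i,j)"] q'
      by (simp add: L p psi_field_def Let_def out_field_def Let_def step_weight_def k column_sign_commute)
  next
    case U
    have q': "(i,j+1) \<in> V" using q U p by simp
    show ?thesis using corner_up[OF q', of i j "(i,j)" "-1"] q'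
      by (simp add: U p psi_field_def Let_def out_field_def Let_def step_weight_def column_sign_def)
  next
    case D
    have q': "(i,j-1) \<in> V" using q D p by simp
    show ?thesis using corner_up[OF q', of i "j-1" "(i,j)" 1] q'
      by (simp add: D p psi_field_def Let_def out_field_def Let_def step_weight_def column_sign_def)
  qed
qed

lemma transition_sums:
  "(\<Sum>d'\<in>dirs. transition d' (1,0) * \<phi> d') = \<phi> (1,0) - \<phi> (0,1) + \<phi> (0,-1)"
  "(\<Sum>d'\<in>dirs. transition d' (0,1) * \<phi> d') = \<phi> (0,1) - \<phi> (1,0) + \<phi> (-1,0)"
  "(\<Sum>d'\<in>dirs. transition d' (-1,0) * \<phi> d') = \<phi> (0,1) + \<phi> (-1,0) + \<phi> (0,-1)"
  "(\<Sum>d'\<in>dirs. transition d' (0,-1) * \<phi> d') = \<phi> (1,0) + \<phi> (-1,0) + \<phi> (0,-1)"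
  by (simp_all add: dirs_def transition_def tw_def right_of_cut_def)

text \<open>Both sides are linear in the four corner values at p, and away from v their coefficients
  agree. At v the branch cut ends, the signs around the vertex are inconsistent, and the discrepancy
  is carried by the corner at vs, where the cut has been moved. The first argument of
  \<open>tw\<close> in the source is the direction from the centre of the face vs to v, in doubled
  coordinates.\<close>

lemma out_field_recursion:
  assumes p: "p \<in> V" and d: "d \<in> dirs"
  shows "out p d = (\<Sum>d'\<in>dirs. transition d' d * psi p d')
    + (if p = v then tw (2 * (fst v - fst vs) - 1, 2 * (snd v - snd vs) - 1) d * corner v vs else 0)"
proof -
  obtain i j where ij: "p = (i,j)" by (cases p)
  obtain i' j' where v': "v = (i',j')" by (cases v)
  obtain c t where vs': "vs = (c,t)" by (cases vs)
  have cc: "c = i' \<or> c = i' - 1" "t = j' \<or> t = j' - 1" using vs1 vs2 by (auto simp: v' vs')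
  have psi: "psi p (-1,0) = kap p i * (corner p (i,j-1) - corner p (i,j)) / 2"
    "psi p (1,0) = kap p (i-1) * (corner p (i-1,j-1) - corner p (i-1,j)) / 2"
    "psi p (0,-1) = kv i j * (corner p (i-1,j) + csgn i j * corner p (i,j)) / 2"
    "psi p (0,1) = kv i (j-1) * (corner p (i-1,j-1) - csgn i (j-1) * corner p (i,j-1)) / 2"
    using p by (simp_all add: psi_field_def Let_def ij)
  have out: "out p (-1,0) = kap p (i-1) * (corner p (i-1,j-1) + corner p (i-1,j)) / 2"
    "out p (1,0) = kap p i * (corner p (i,j-1) + corner p (i,j)) / 2"
    "out p (0,1) = kv i j * (corner p (i-1,j) - csgn i j * corner p (i,j)) / 2"
    "out p (0,-1) = kv i (j-1) * (corner p (i-1,j-1) + csgn i (j-1) * corner p (i,j-1)) / 2"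
    by (simp_all add: out_field_def Let_def ij)
  have *: "d = (1,0) \<or> d = (0,1) \<or> d = (-1,0) \<or> d = (0,-1)" using d by (auto simp: dirs_def)
  \<comment> \<open>The cut runs up the column of v: it is absent off that column and below v,
    passes through p consistently above v, and ends at v.\<close>
  consider "i \<noteq> i'" | "i = i'" "j > j'" | "i = i'" "j < j'" | "p = v" by (auto simp: ij v') linarith
  then show ?thesis
  proof cases
    case 1
    then have "p \<noteq> v" "kap p i = kap p (i-1)" "kv i j = kap p i" "kv i (j-1) = kap p i" "csgn i j = 1" "csgn i (j-1) = 1"
      unfolding side_sign_def vertical_sign_def cut_sign_def by (auto simp: ij v' vs')
    then show ?thesis using * by (elim disjE) (simp_all add: transition_sums psi out field_simps)
  next
    case 2
    then have n: "p \<noteq> v" "csgn i j = -1" "csgn i (j-1) = -1" unfolding cut_sign_def by (auto simp: ij v')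
    from cc(1) have "kap p i = 1 \<and> kap p (i-1) = -1 \<and> kv i j = -1 \<and> kv i (j-1) = -1 \<or>
      kap p i = -1 \<and> kap p (i-1) = 1 \<and> kv i j = 1 \<and> kv i (j-1) = 1"
      using 2 cc(2) unfolding side_sign_def vertical_sign_def cut_sign_def by (elim disjE) (simp_all add: ij v' vs')
    with n show ?thesis using * by (elim disjE conjE) (simp_all add: transition_sums psi out field_simps)
  next
    case 3
    then have n: "p \<noteq> v" "csgn i j = 1" "csgn i (j-1) = 1" unfolding cut_sign_def by (auto simp: ij v')
    have "kap p i = 1 \<and> kap p (i-1) = 1 \<and> kv i j = 1 \<and> kv i (j-1) = 1"
      using 3 cc unfolding side_sign_def vertical_sign_def cut_sign_def by (elim disjE) (simp_all add: ij v' vs')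
    with n show ?thesis using * by (elim disjE conjE) (simp_all add: transition_sums psi out field_simps)
  next
    case 4
    then have e: "i = i'" "j = j'" by (auto simp: ij v')
    have n: "csgn i j = -1" "csgn i (j-1) = 1" unfolding cut_sign_def by (auto simp: e v')
    have k: "kap p i = (if c = i' \<and> t = j' - 1 then -1 else 1)" "kap p (i-1) = (if c = i' - 1 \<and> t = j' - 1 then -1 else 1)"
      "kv i j = (if c = i' then 1 else -1)" "kv i (j-1) = 1"
      using cc unfolding side_sign_def vertical_sign_def cut_sign_def by (auto simp: e ij v' vs')
    have "corner v vs = corner p (c,t)" using 4 vs' by simp
    moreover have "fst v = i" "snd v = j" "fst vs = c" "snd vs = t" by (simp_all add: v' e vs')
    ultimately have src: "(if p = v then tw (2 * (fst v - fst vs) - 1, 2 * (snd v - snd vs) - 1) d * corner v vs else 0)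
        = tw (2 * (i - c) - 1, 2 * (j - t) - 1) d * corner p (c,t)" using 4 by simp
    from cc have "c = i \<or> c = i - 1" "t = j \<or> t = j - 1" by (simp_all add: e)
    then show ?thesis unfolding src using *
      by (elim disjE; hypsubst; simp add: transition_sums psi out n k e[symmetric] tw_def right_of_cut_def field_simps)
  qed
qed

lemma psi_field_recursion:
  assumes d: "d \<in> dirs"
  shows "psi p d = step_weight V x us vs (p - d) p * ((\<Sum>d'\<in>dirs. transition d' d * psi (p - d) d')
    + (if p - d = v then tw (2 * (fst v - fst vs) - 1, 2 * (snd v - snd vs) - 1) d * corner v vs else 0))"
  using psi_field_out_field[OF d, of "p - d"] out_field_recursion[OF _ d, of "p - d"] by (auto simp: step_weight_def)

text \<open>The definition of \<open>psi_field\<close> is inverted: its four values at p determine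
  each corner. The second argument of \<open>tw\<close> points from p to the centre of f, so the
  formula adds one last turn of the walk, into the corner.\<close>

lemma corner_sum_psi_field:
  assumes p: "p \<in> V" "p \<noteq> v"
    and f: "fst f = fst p \<or> fst f = fst p - 1" "snd f = snd p \<or> snd f = snd p - 1"
  shows "corner p f = kap p (fst f) * (\<Sum>d\<in>dirs. tw d (2 * (fst f - fst p) + 1, 2 * (snd f - snd p) + 1) * psi p d)"
proof -
  obtain i j where ij: "p = (i,j)" by (cases p)
  obtain i' j' where v': "v = (i',j')" by (cases v)
  obtain c t where vs': "vs = (c,t)" by (cases vs)
  have cc: "c = i' \<or> c = i' - 1" "t = j' \<or> t = j' - 1" using vs1 vs2 by (auto simp: v' vs')
  have ff: "f = (i,j) \<or> f = (i-1,j) \<or> f = (i,j-1) \<or> f = (i-1,j-1)" using f by (cases f) (auto simp: ij)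
  have psi: "psi p (-1,0) = kap p i * (corner p (i,j-1) - corner p (i,j)) / 2"
    "psi p (1,0) = kap p (i-1) * (corner p (i-1,j-1) - corner p (i-1,j)) / 2"
    "psi p (0,-1) = kv i j * (corner p (i-1,j) + csgn i j * corner p (i,j)) / 2"
    "psi p (0,1) = kv i (j-1) * (corner p (i-1,j-1) - csgn i (j-1) * corner p (i,j-1)) / 2"
    using p by (simp_all add: psi_field_def Let_def ij)
  have k2: "kap p i * kap p i = 1" for i by (simp add: side_sign_def)
  have sums: "(\<Sum>d\<in>dirs. tw d (1,1) * \<phi> d) = \<phi> (1,0) - \<phi> (0,1) - \<phi> (-1,0) + \<phi> (0,-1)"
    "(\<Sum>d\<in>dirs. tw d (-1,1) * \<phi> d) = \<phi> (0,1) - \<phi> (1,0) + \<phi> (-1,0) + \<phi> (0,-1)"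
    "(\<Sum>d\<in>dirs. tw d (-1,-1) * \<phi> d) = \<phi> (1,0) + \<phi> (0,1) + \<phi> (-1,0) + \<phi> (0,-1)"
    "(\<Sum>d\<in>dirs. tw d (1,-1) * \<phi> d) = \<phi> (1,0) - \<phi> (0,1) + \<phi> (-1,0) + \<phi> (0,-1)" for \<phi>
    by (simp_all add: dirs_def tw_def right_of_cut_def)
  consider "i \<noteq> i'" | "i = i'" "j > j'" | "i = i'" "j < j'" using p by (auto simp: ij v') linarith
  then show ?thesis
  proof cases
    case 1
    then have "kap p i = kap p (i-1)" "kv i j = kap p (i-1)" "kv i (j-1) = kap p (i-1)" "csgn i j = 1" "csgn i (j-1) = 1"
      unfolding side_sign_def vertical_sign_def cut_sign_def by (auto simp: ij v' vs')
    moreover have "kap p (i-1) = 1 \<or> kap p (i-1) = -1" by (simp add: side_sign_def)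
    ultimately show ?thesis using ff by (elim disjE) (simp_all add: sums psi[unfolded ij] ij field_simps)
  next
    case 2
    then have n: "csgn i j = -1" "csgn i (j-1) = -1" unfolding cut_sign_def by (auto simp: ij v')
    from cc(1) have "kap p i = 1 \<and> kap p (i-1) = -1 \<and> kv i j = -1 \<and> kv i (j-1) = -1 \<or>
      kap p i = -1 \<and> kap p (i-1) = 1 \<and> kv i j = 1 \<and> kv i (j-1) = 1"
      using 2 cc(2) unfolding side_sign_def vertical_sign_def cut_sign_def by (elim disjE) (simp_all add: ij v' vs')
    with n ff show ?thesis
      by (elim disjE conjE) (simp_all add: sums psi[unfolded ij] ij field_simps)
  next
    case 3
    then have n: "csgn i j = 1" "csgn i (j-1) = 1" unfolding cut_sign_def by (auto simp: ij v')
    have "kap p i = 1 \<and> kap p (i-1) = 1 \<and> kv i j = 1 \<and> kv i (j-1) = 1"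
      using 3 cc unfolding side_sign_def vertical_sign_def cut_sign_def by (elim disjE) (simp_all add: ij v' vs')
    with n ff show ?thesis
      by (elim disjE conjE) (simp_all add: sums psi[unfolded ij] ij field_simps)
  qed
qed

end

hide_const (open) corner csgn kap kv psi out

section \<open>The transition operator\<close>

definition propagate :: "(vertex \<Rightarrow> vertex \<Rightarrow> real) \<Rightarrow> (vertex \<Rightarrow> vertex \<Rightarrow> real) \<Rightarrow>
    vertex \<Rightarrow> vertex \<Rightarrow> real" where
  "propagate W \<phi> p d = W (p - d) p * (\<Sum>d'\<in>dirs. transition d' d * \<phi> (p - d) d')"

definition source :: "(vertex \<Rightarrow> vertex \<Rightarrow> real) \<Rightarrow> vertex \<Rightarrow> vertex \<Rightarrow>
    vertex \<Rightarrow> vertex \<Rightarrow> real" where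
  "source W v c p d = (if p - d = v then W v p * tw c d else 0)"

text \<open>The sum over non-backtracking walks of n + 1 steps from v to p with last step d, entered from direction c.\<close>

definition walk_sum :: "(vertex \<Rightarrow> vertex \<Rightarrow> real) \<Rightarrow> vertex \<Rightarrow> vertex \<Rightarrow> nat \<Rightarrow>
    vertex \<Rightarrow> vertex \<Rightarrow> real" where
  "walk_sum W v c n = (propagate W ^^ n) (source W v c)"

text \<open>The squared l2 norm restricted to B. Bounds uniform over finite B stand for bounds on
  the whole lattice, so that no infinite sums over vertices occur.\<close>

definition energy :: "(vertex \<Rightarrow> vertex \<Rightarrow> real) \<Rightarrow> vertex set \<Rightarrow> real" where
  "energy \<phi> B = (\<Sum>p\<in>B. \<Sum>d\<in>dirs. (\<phi> p d)\<^sup>2)"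

lemma transition_norm:
  "(\<Sum>d\<in>dirs. (\<Sum>d'\<in>dirs. transition d' d * \<phi> d')\<^sup>2) \<le> (1 + sqrt 2)\<^sup>2 * (\<Sum>d\<in>dirs. (\<phi> d)\<^sup>2)"
proof -
  define a b c e where "a = \<phi> (1,0)" "b = \<phi> (0,1)" "c = \<phi> (-1,0)" "e = \<phi> (0,-1)"
  have l: "(\<Sum>d\<in>dirs. (\<Sum>d'\<in>dirs. transition d' d * \<phi> d')\<^sup>2) =
    (a - b + e)\<^sup>2 + (b - a + c)\<^sup>2 + (b + c + e)\<^sup>2 + (a + c + e)\<^sup>2"
    by (simp add: dirs_def transition_def tw_def right_of_cut_def a_b_c_e_def algebra_simps)
  have r: "(\<Sum>d\<in>dirs. (\<phi> d)\<^sup>2) = a\<^sup>2 + b\<^sup>2 + c\<^sup>2 + e\<^sup>2"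
    by (simp add: dirs_def a_b_c_e_def)
  define s where "s = sqrt (2::real)"
  have s: "s * s = 2" "s > 0" by (auto simp: s_def)
  \<comment> \<open>For M (a,b,c,e) = (e - b, c - a, b + e, a + c) one has M^2 = 2, so this is the
    squared norm of (s - M) (a,b,c,e). Expanding it bounds the quadratic form of M by s.\<close>
  have "0 \<le> (s * a - (e - b))\<^sup>2 + (s * b - (c - a))\<^sup>2 + (s * c - (b + e))\<^sup>2 + (s * e - (a + c))\<^sup>2"
    by simp
  also have "\<dots> = (s * s + 2) * (a\<^sup>2 + b\<^sup>2 + c\<^sup>2 + e\<^sup>2) - 2 * s * (a * (e - b) + b * (c - a) + c * (b + e) + e * (a + c))"
    by (simp add: power2_eq_square algebra_simps)
  also have "\<dots> = 2 * s * (s * (a\<^sup>2 + b\<^sup>2 + c\<^sup>2 + e\<^sup>2) - (a * (e - b) + b * (c - a) + c * (b + e) + e * (a + c)))"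
  proof -
    have "(s * s + 2) * Q - 2 * s * L = 2 * s * (s * Q - L)" if "s * s = 2" for Q L
      using that by (simp add: right_diff_distrib mult.assoc[symmetric])
    then show ?thesis using s(1) by blast
  qed
  finally have "a * (e - b) + b * (c - a) + c * (b + e) + e * (a + c) \<le> s * (a\<^sup>2 + b\<^sup>2 + c\<^sup>2 + e\<^sup>2)"
    using s(2) by (simp add: zero_le_mult_iff)
  moreover have "(a - b + e)\<^sup>2 + (b - a + c)\<^sup>2 + (b + c + e)\<^sup>2 + (a + c + e)\<^sup>2
     = 3 * (a\<^sup>2 + b\<^sup>2 + c\<^sup>2 + e\<^sup>2) + 2 * (a * (e - b) + b * (c - a) + c * (b + e) + e * (a + c))"
    by (simp add: power2_eq_square algebra_simps)
  moreover have "(1 + s)\<^sup>2 = 3 + 2 * s" using s(1) by (simp add: power2_eq_square algebra_simps)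
  ultimately show ?thesis unfolding l r s_def[symmetric] by (simp add: algebra_simps)
qed

definition preds :: "vertex set \<Rightarrow> vertex set" where
  "preds B = (\<lambda>(p,d). p - d) ` (B \<times> dirs)"

lemma finite_preds: "finite B \<Longrightarrow> finite (preds B)"
  by (simp add: preds_def)

text \<open>For fixed d the map from p to p - d sends B injectively into \<open>preds B\<close>, so
  the bound \<open>transition_norm\<close> at single vertices adds up to a bound on the whole
  set.\<close>

lemma energy_propagate:
  assumes W: "\<And>p q. \<bar>W p q\<bar> \<le> x" and B: "finite B"
  shows "energy (propagate W \<phi>) B \<le> (x * (1 + sqrt 2))\<^sup>2 * energy \<phi> (preds B)"
proof -
  define G where "G q d = (\<Sum>d'\<in>dirs. transition d' d * \<phi> q d')\<^sup>2" for q d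
  have x0: "0 \<le> x" using W[of 0 0] by linarith
  have "energy (propagate W \<phi>) B \<le> (\<Sum>p\<in>B. \<Sum>d\<in>dirs. x\<^sup>2 * G (p - d) d)"
    unfolding energy_def
  proof (intro sum_mono)
    fix p d
    have "(W (p - d) p)\<^sup>2 \<le> x\<^sup>2" using W[of "p - d" p] x0 abs_le_square_iff by force
    then show "(propagate W \<phi> p d)\<^sup>2 \<le> x\<^sup>2 * G (p - d) d"
      by (simp add: propagate_def G_def power_mult_distrib mult_right_mono)
  qed
  also have "\<dots> = x\<^sup>2 * (\<Sum>d\<in>dirs. \<Sum>p\<in>B. G (p - d) d)"
    by (subst sum.swap) (simp add: sum_distrib_left)
  also have "\<dots> \<le> x\<^sup>2 * (\<Sum>d\<in>dirs. \<Sum>q\<in>preds B. G q d)"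
  proof (intro mult_left_mono sum_mono)
    fix d assume d: "d \<in> dirs"
    have "(\<Sum>p\<in>B. G (p - d) d) = (\<Sum>q\<in>(\<lambda>p. p - d) ` B. G q d)"
      by (subst sum.reindex) (auto simp: inj_on_def)
    also have "\<dots> \<le> (\<Sum>q\<in>preds B. G q d)"
      by (rule sum_mono2) (use d in \<open>auto simp: finite_preds B G_def\<close>, auto simp: preds_def)
    finally show "(\<Sum>p\<in>B. G (p - d) d) \<le> (\<Sum>q\<in>preds B. G q d)" .
  qed auto
  also have "\<dots> = x\<^sup>2 * (\<Sum>q\<in>preds B. \<Sum>d\<in>dirs. G q d)" by (subst sum.swap) simp
  also have "\<dots> \<le> x\<^sup>2 * (\<Sum>q\<in>preds B. (1 + sqrt 2)\<^sup>2 * (\<Sum>d\<in>dirs. (\<phi> q d)\<^sup>2))"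
    unfolding G_def by (intro mult_left_mono sum_mono transition_norm) auto
  also have "\<dots> = (x * (1 + sqrt 2))\<^sup>2 * energy \<phi> (preds B)"
    by (simp add: energy_def sum_distrib_left power_mult_distrib mult.assoc)
  finally show ?thesis .
qed

lemma energy_iterate:
  assumes W: "\<And>p q. \<bar>W p q\<bar> \<le> x" and M: "\<And>B. finite B \<Longrightarrow> energy \<phi> B \<le> M" and B: "finite B"
  shows "energy ((propagate W ^^ n) \<phi>) B \<le> ((x * (1 + sqrt 2)) ^ n)\<^sup>2 * M"
  using B
proof (induction n arbitrary: B)
  case (Suc n)
  have "energy ((propagate W ^^ Suc n) \<phi>) B \<le> (x * (1 + sqrt 2))\<^sup>2 * energy ((propagate W ^^ n) \<phi>) (preds B)"
    by simp (rule energy_propagate[OF W Suc.prems])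
  also have "\<dots> \<le> (x * (1 + sqrt 2))\<^sup>2 * (((x * (1 + sqrt 2)) ^ n)\<^sup>2 * M)"
    by (intro mult_left_mono Suc.IH finite_preds Suc.prems) auto
  finally show ?case by (simp add: power_mult_distrib mult_ac)
qed (simp add: M)

lemma iterate_bound:
  assumes W: "\<And>p q. \<bar>W p q\<bar> \<le> x" and M: "\<And>B. finite B \<Longrightarrow> energy \<phi> B \<le> M" and d: "d \<in> dirs"
  shows "\<bar>(propagate W ^^ n) \<phi> p d\<bar> \<le> (x * (1 + sqrt 2)) ^ n * sqrt M"
proof -
  let ?t = "(propagate W ^^ n) \<phi>"
  have x0: "0 \<le> x" using W[of 0 0] by linarith
  have "(?t p d)\<^sup>2 \<le> energy ?t {p}"
    unfolding energy_def using member_le_sum[OF d, of "\<lambda>d. (?t p d)\<^sup>2"] by simp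
  also have "\<dots> \<le> ((x * (1 + sqrt 2)) ^ n)\<^sup>2 * M" by (rule energy_iterate) (rule W, erule M, simp)
  finally have "sqrt ((?t p d)\<^sup>2) \<le> sqrt (((x * (1 + sqrt 2)) ^ n)\<^sup>2 * M)" by (rule real_sqrt_le_mono)
  then show ?thesis using x0 by (simp add: real_sqrt_mult)
qed

text \<open>The source lives on the four steps leaving v, each contributing at most x^2; hence the
  factor 2 x in \<open>walk_sum_bound\<close>.\<close>

lemma energy_source:
  assumes W: "\<And>p q. \<bar>W p q\<bar> \<le> x" and B: "finite B"
  shows "energy (source W v c) B \<le> 4 * x\<^sup>2"
proof -
  have x0: "0 \<le> x" using W[of 0 0] by linarith
  have "energy (source W v c) B = (\<Sum>d\<in>dirs. \<Sum>p\<in>B. (source W v c p d)\<^sup>2)"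
    unfolding energy_def by (rule sum.swap)
  also have "\<dots> \<le> (\<Sum>d\<in>dirs. x\<^sup>2)"
  proof (rule sum_mono)
    fix d
    have "(\<Sum>p\<in>B. (source W v c p d)\<^sup>2) \<le> (\<Sum>p\<in>B. if p = v + d then x\<^sup>2 else 0)"
    proof (rule sum_mono)
      fix p
      have "(W v p)\<^sup>2 \<le> x\<^sup>2" using W[of v p] x0 abs_le_square_iff by force
      moreover have "(tw c d)\<^sup>2 = 1" by (simp add: tw_def)
      ultimately show "(source W v c p d)\<^sup>2 \<le> (if p = v + d then x\<^sup>2 else 0)"
        by (auto simp: source_def power_mult_distrib)
    qed
    also have "\<dots> \<le> x\<^sup>2" using B by (simp add: sum.delta)
    finally show "(\<Sum>p\<in>B. (source W v c p d)\<^sup>2) \<le> x\<^sup>2" .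
  qed
  also have "\<dots> = 4 * x\<^sup>2" by (simp add: dirs_def)
  finally show ?thesis .
qed

lemma walk_sum_bound:
  assumes W: "\<And>p q. \<bar>W p q\<bar> \<le> x" and d: "d \<in> dirs"
  shows "\<bar>walk_sum W v c n p d\<bar> \<le> (x * (1 + sqrt 2)) ^ n * (2 * x)"
proof -
  have x0: "0 \<le> x" using W[of 0 0] by linarith
  have "sqrt (4 * x\<^sup>2) = 2 * x" using x0 by (simp add: real_sqrt_mult)
  moreover have "\<bar>walk_sum W v c n p d\<bar> \<le> (x * (1 + sqrt 2)) ^ n * sqrt (4 * x\<^sup>2)"
    unfolding walk_sum_def
  proof (rule iterate_bound)
    show "energy (source W v c) B \<le> 4 * x\<^sup>2" if "finite B" for B
      by (rule energy_source[where x = x]) (rule W, rule that)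
  qed (rule W, rule d)
  ultimately show ?thesis by simp
qed

text \<open>The equation says that \<phi> is a times the source plus its own propagation. Iterating
  it leaves as remainder the n-fold propagation of \<phi>, which decays geometrically because finite
  support gives \<phi> finite energy.\<close>

lemma resolvent_expansion:
  assumes W: "\<And>p q. \<bar>W p q\<bar> \<le> x" and x: "x * (1 + sqrt 2) < 1" and V: "finite V"
    and eq: "\<And>p d. d \<in> dirs \<Longrightarrow> \<phi> p d = W (p - d) p * ((\<Sum>d'\<in>dirs. transition d' d * \<phi> (p - d) d')
       + (if p - d = v then tw c d * a else 0))"
    and supp: "\<And>p d. p \<notin> V \<Longrightarrow> \<phi> p d = 0" and d: "d \<in> dirs"
  shows "(\<lambda>n. a * walk_sum W v c n p d) sums \<phi> p d"
proof -
  define T where "T n = (propagate W ^^ n) \<phi>" for n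
  have x0: "0 \<le> x" using W[of 0 0] by linarith
  have step: "T n p d = a * walk_sum W v c n p d + T (Suc n) p d" if "d \<in> dirs" for n p d
    using that
  proof (induction n arbitrary: p d)
    case 0
    have "\<phi> p d = a * source W v c p d + propagate W \<phi> p d"
      using eq[OF 0, of p] by (auto simp: source_def propagate_def algebra_simps)
    then show ?case by (simp add: T_def walk_sum_def)
  next
    case (Suc n)
    have "T (Suc n) p d = W (p - d) p * (\<Sum>d'\<in>dirs. transition d' d * T n (p - d) d')"
      by (simp add: T_def propagate_def)
    also have "\<dots> = W (p - d) p * (\<Sum>d'\<in>dirs. transition d' d * (a * walk_sum W v c n (p - d) d' + T (Suc n) (p - d) d'))"
      using Suc.IH by simp
    also have "\<dots> = a * walk_sum W v c (Suc n) p d + T (Suc (Suc n)) p d"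
      by (simp add: T_def walk_sum_def propagate_def algebra_simps sum.distrib sum_distrib_left)
    finally show ?case .
  qed
  have "(\<Sum>n<N. a * walk_sum W v c n p d) = \<phi> p d - T N p d" for N
    by (induction N) (use step[OF d, of _ p] in \<open>simp_all add: T_def\<close>)
  moreover have "(\<lambda>N. T N p d) \<longlonglongrightarrow> 0"
  proof (rule Lim_null_comparison)
    have M: "energy \<phi> B \<le> energy \<phi> V" if "finite B" for B
    proof -
      have "energy \<phi> B = energy \<phi> (B \<inter> V)"
        unfolding energy_def by (rule sum.mono_neutral_right) (use that supp in auto)
      also have "\<dots> \<le> energy \<phi> V"
        unfolding energy_def by (rule sum_mono2) (auto simp: V sum_nonneg)
      finally show ?thesis .
    qed
    show "\<forall>\<^sub>F n in sequentially. norm (T n p d) \<le> (x * (1 + sqrt 2)) ^ n * sqrt (energy \<phi> V)"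
    proof (rule always_eventually, rule allI)
      fix n
      have "\<bar>(propagate W ^^ n) \<phi> p d\<bar> \<le> (x * (1 + sqrt 2)) ^ n * sqrt (energy \<phi> V)"
        by (rule iterate_bound) (rule W, erule M, rule d)
      then show "norm (T n p d) \<le> (x * (1 + sqrt 2)) ^ n * sqrt (energy \<phi> V)"
        by (simp add: T_def)
    qed
    show "(\<lambda>n. (x * (1 + sqrt 2)) ^ n * sqrt (energy \<phi> V)) \<longlonglongrightarrow> 0"
      using x x0 by (intro tendsto_mult_left_zero LIMSEQ_power_zero) auto
  qed
  ultimately show ?thesis unfolding sums_def using tendsto_diff[OF tendsto_const, of "\<lambda>N. T N p d" 0 sequentially "\<phi> p d"]
    by simp
qed

text \<open>A walk of n + 1 steps ending at p stays within distance n + 1 of p, so only weights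
  inside the box of size N enter.\<close>

lemma walk_sum_local:
  assumes "\<And>p q. \<bar>fst p\<bar> \<le> N \<Longrightarrow> \<bar>snd p\<bar> \<le> N \<Longrightarrow> \<bar>fst q\<bar> \<le> N \<Longrightarrow> \<bar>snd q\<bar> \<le> N \<Longrightarrow> W p q = W' p q"
    and "\<bar>fst p\<bar> + int n < N" "\<bar>snd p\<bar> + int n < N" "d \<in> dirs"
  shows "walk_sum W v c n p d = walk_sum W' v c n p d"
  using assms(2-)
proof (induction n arbitrary: p d)
  case 0
  then have "W (p - d) p = W' (p - d) p" by (intro assms(1)) (auto simp: dirs_def)
  then show ?case by (auto simp: walk_sum_def source_def)
next
  case (Suc n)
  then have "W (p - d) p = W' (p - d) p" by (intro assms(1)) (auto simp: dirs_def)
  moreover have "walk_sum W v c n (p - d) d' = walk_sum W' v c n (p - d) d'" if "d' \<in> dirs" for d'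
    using Suc.prems by (intro Suc.IH that) (auto simp: dirs_def)
  ultimately show ?case by (simp add: walk_sum_def propagate_def)
qed

text \<open>Tannery's theorem: by locality each term is eventually constant along F, and the
  geometric bound on the terms is the same for all R.\<close>

lemma walk_sum_series_tendsto:
  fixes W :: "vertex \<Rightarrow> vertex \<Rightarrow> real" and WR :: "'r \<Rightarrow> vertex \<Rightarrow> vertex \<Rightarrow> real"
  assumes WR: "\<And>R p q. \<bar>WR R p q\<bar> \<le> x" and x: "x * (1 + sqrt 2) < 1" and F: "F \<noteq> bot"
    and ev: "\<And>N. \<forall>\<^sub>F R in F. \<forall>p q. \<bar>fst p\<bar> \<le> N \<and> \<bar>snd p\<bar> \<le> N \<and> \<bar>fst q\<bar> \<le> N \<and> \<bar>snd q\<bar> \<le> N \<longrightarrow> WR R p q = W p q"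
    and d: "d \<in> dirs"
  shows "((\<lambda>R. \<Sum>n. walk_sum (WR R) v c n p d) \<longlongrightarrow> (\<Sum>n. walk_sum W v c n p d)) F"
proof (rule tannerys_theorem[THEN conjunct2, THEN conjunct2])
  have x0: "0 \<le> x" using WR[of undefined 0 0] by linarith
  show "((\<lambda>R. walk_sum (WR R) v c n p d) \<longlongrightarrow> walk_sum W v c n p d) F" for n
  proof (rule tendsto_eventually)
    let ?N = "\<bar>fst p\<bar> + \<bar>snd p\<bar> + int n + 1"
    show "\<forall>\<^sub>F R in F. walk_sum (WR R) v c n p d = walk_sum W v c n p d"
      using ev[of ?N]
    proof eventually_elim
      case (elim R)
      then show ?case by (intro walk_sum_local[where N = ?N] d) auto
    qed
  qed
  show "\<forall>\<^sub>F (n, R) in at_top \<times>\<^sub>F F. norm (walk_sum (WR R) v c n p d) \<le> (x * (1 + sqrt 2)) ^ n * (2 * x)"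
  proof (rule always_eventually, clarify)
    fix n R
    show "norm (walk_sum (WR R) v c n p d) \<le> (x * (1 + sqrt 2)) ^ n * (2 * x)"
      unfolding real_norm_def by (rule walk_sum_bound) (rule WR, rule d)
  qed
  show "summable (\<lambda>n. (x * (1 + sqrt 2)) ^ n * (2 * x))"
    using x x0 by (intro summable_mult2 summable_geometric) auto
qed (fact F)

section \<open>Walk sums as sums over lists of vertices\<close>

definition walks :: "nat \<Rightarrow> vertex \<Rightarrow> vertex \<Rightarrow> vertex list set" where
  "walks n v p = {xs. length xs = n + 2 \<and> xs ! 0 = v \<and> xs ! (n + 1) = p \<and>
     (\<forall>i<n+1. xs ! Suc i - xs ! i \<in> dirs) \<and> (\<forall>i<n. xs ! (i + 2) \<noteq> xs ! i)}"

definition walk_weight :: "(vertex \<Rightarrow> vertex \<Rightarrow> real) \<Rightarrow> vertex \<Rightarrow> nat \<Rightarrow> vertex list \<Rightarrow> real" where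
  "walk_weight W c n xs = tw c (xs ! 1 - xs ! 0) * (\<Prod>i<n+1. W (xs ! i) (xs ! Suc i)) *
     (\<Prod>i<n. tw (xs ! Suc i - xs ! i) (xs ! (i + 2) - xs ! Suc i))"

text \<open>Splitting off the last vertex: a walk to p with last step d is a shorter walk to p - d
  whose own last step is not - d.\<close>

lemma walks_Suc_witness:
  assumes d: "d \<in> dirs"
  shows "(\<Sum>xs\<in>{xs \<in> walks (Suc n) v p. p - xs ! (n + 1) = d}. g xs) =
    (\<Sum>(d',ys)\<in>(SIGMA d':{d' \<in> dirs. d' \<noteq> - d}. {ys \<in> walks n v (p - d). p - d - ys ! n = d'}). g (ys @ [p]))"
proof (rule sum.reindex_bij_witness[where i = "\<lambda>(d',ys). ys @ [p]" and j = "\<lambda>xs. (xs ! (n+1) - xs ! n, butlast xs)"])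
  fix xs assume xs: "xs \<in> {xs \<in> walks (Suc n) v p. p - xs ! (n + 1) = d}"
  then have len: "length xs = n + 3" and p: "xs ! (n + 2) = p" and q: "xs ! (n + 1) = p - d"
    by (auto simp: walks_def algebra_simps)
  have "butlast xs @ [last xs] = xs" by (rule append_butlast_last_id) (use len in auto)
  moreover have "last xs = p" using len p by (subst last_conv_nth) auto
  ultimately have eq: "butlast xs @ [p] = xs" by simp
  then show "(case (xs ! (n+1) - xs ! n, butlast xs) of (d',ys) \<Rightarrow> ys @ [p]) = xs" by simp
  show "(case (xs ! (n+1) - xs ! n, butlast xs) of (d',ys) \<Rightarrow> g (ys @ [p])) = g xs" using eq by simp
  have nth: "butlast xs ! i = xs ! i" if "i < n + 2" for i using that len by (simp add: nth_butlast)
  have st: "xs ! Suc i - xs ! i \<in> dirs" if "i < n + 2" for i using xs that by (auto simp: walks_def)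
  have nb: "xs ! Suc (Suc i) \<noteq> xs ! i" if "i < n + 1" for i using xs that by (auto simp: walks_def)
  have "xs ! (n+1) - xs ! n \<noteq> - d"
  proof
    assume "xs ! (n+1) - xs ! n = - d"
    then have "xs ! n = p" using q by (simp add: algebra_simps)
    then show False using nb[of n] p by simp
  qed
  moreover have "butlast xs \<in> walks n v (p - d)"
    using len st nb q xs by (auto simp: walks_def nth)
  ultimately show "(xs ! (n+1) - xs ! n, butlast xs) \<in>
     (SIGMA d':{d' \<in> dirs. d' \<noteq> - d}. {ys \<in> walks n v (p - d). p - d - ys ! n = d'})"
    using st[of n] q by (auto simp: nth)
next
  fix z assume "z \<in> (SIGMA d':{d' \<in> dirs. d' \<noteq> - d}. {ys \<in> walks n v (p - d). p - d - ys ! n = d'})"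
  then obtain d' ys where z: "z = (d',ys)" "d' \<in> dirs" "d' \<noteq> - d" "ys \<in> walks n v (p - d)" "p - d - ys ! n = d'" by auto
  then have len: "length ys = n + 2" and q: "ys ! (n+1) = p - d" by (auto simp: walks_def)
  have nth: "(ys @ [p]) ! i = (if i < n + 2 then ys ! i else p)" if "i < n + 3" for i
    using that len by (auto simp: nth_append less_Suc_eq_le)
  show "(case (case z of (d',ys) \<Rightarrow> ys @ [p]) of xs \<Rightarrow> (xs ! (n+1) - xs ! n, butlast xs)) = z"
    using z q by (simp add: nth)
  have st: "(ys @ [p]) ! Suc i - (ys @ [p]) ! i \<in> dirs" if "i < n + 2" for i
  proof (cases "i < n + 1")
    case True then show ?thesis using z(4) by (simp add: nth walks_def)
  next
    case False then have "i = n + 1" using that by simp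
    then show ?thesis using d q by (simp add: nth)
  qed
  have nb: "(ys @ [p]) ! (i+2) \<noteq> (ys @ [p]) ! i" if "i < n + 1" for i
  proof (cases "i < n")
    case True then show ?thesis using z(4) by (simp add: nth walks_def)
  next
    case False then have i: "i = n" using that by simp
    have "p \<noteq> ys ! n"
    proof
      assume "p = ys ! n" then have "d' = - d" using z(5) by simp
      then show False using z(3) by simp
    qed
    then show ?thesis by (simp add: i nth)
  qed
  have "ys @ [p] \<in> walks (Suc n) v p"
    using len st nb z(4) by (auto simp: walks_def nth)
  moreover have "p - (ys @ [p]) ! (n+1) = d" using q by (simp add: nth)
  ultimately show "(case z of (d',ys) \<Rightarrow> ys @ [p]) \<in> {xs \<in> walks (Suc n) v p. p - xs ! (n + 1) = d}"
    using z(1) by simp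
qed

lemma walks_0: "{xs \<in> walks 0 v p. p - xs ! 0 = d} = (if p - d = v \<and> d \<in> dirs then {[v,p]} else {})"
proof -
  have w: "xs \<in> walks 0 v p \<longleftrightarrow> xs = [v,p] \<and> p - v \<in> dirs" for xs
    by (auto simp: walks_def length_Suc_conv numeral_2_eq_2)
  have e: "p - v = d \<longleftrightarrow> p - d = v" by (metis diff_diff_eq2 add_diff_cancel_left')
  have "{xs \<in> walks 0 v p. p - xs ! 0 = d} = {xs. xs = [v,p] \<and> p - v \<in> dirs \<and> p - v = d}"
    unfolding w by (rule Collect_cong) auto
  also have "\<dots> = (if p - v = d \<and> d \<in> dirs then {[v,p]} else {})" by (cases "p - v = d") auto
  finally show ?thesis by (simp only: e)
qed

lemma finite_walks: "finite (walks n v p)"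
proof -
  have "walks n v p \<subseteq> {xs. set xs \<subseteq> {fst p - int n - 1..fst p + int n + 1} \<times> {snd p - int n - 1..snd p + int n + 1} \<and> length xs = n + 2}"
  proof
    fix xs assume xs: "xs \<in> walks n v p"
    then have len: "length xs = n + 2" and p: "xs ! (n+1) = p"
      and st: "\<And>i. i < n + 1 \<Longrightarrow> xs ! Suc i - xs ! i \<in> dirs" by (auto simp: walks_def)
    have "\<bar>fst (xs ! (n + 1 - k)) - fst p\<bar> \<le> int k \<and> \<bar>snd (xs ! (n + 1 - k)) - snd p\<bar> \<le> int k" if "k \<le> n + 1" for k
      using that
    proof (induction k)
      case (Suc k)
      have "Suc (n + 1 - Suc k) = n + 1 - k" using Suc.prems by simp
      then have "xs ! (n + 1 - k) - xs ! (n + 1 - Suc k) \<in> dirs" using st[of "n + 1 - Suc k"] Suc.prems by simp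
      then have "\<bar>fst (xs ! (n + 1 - k)) - fst (xs ! (n + 1 - Suc k))\<bar> \<le> 1"
        "\<bar>snd (xs ! (n + 1 - k)) - snd (xs ! (n + 1 - Suc k))\<bar> \<le> 1"
        by (auto simp: dirs_def prod_eq_iff)
      moreover have "\<bar>y - z\<bar> \<le> int (Suc k)" if "\<bar>w - y\<bar> \<le> 1" "\<bar>w - z\<bar> \<le> int k" for w y z :: int
        using that by linarith
      ultimately show ?case using Suc.IH Suc.prems by (meson Suc_leD)
    qed (use p in simp)
    note near = this
    have *: "\<bar>fst (xs ! i) - fst p\<bar> \<le> int n + 1 \<and> \<bar>snd (xs ! i) - snd p\<bar> \<le> int n + 1" if "i \<le> n + 1" for i
    proof -
      have "n + 1 - (n + 1 - i) = i" "int (n + 1 - i) \<le> int n + 1" using that by auto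
      then show ?thesis using near[of "n + 1 - i"] by simp
    qed
    have "x \<in> {fst p - int n - 1..fst p + int n + 1} \<times> {snd p - int n - 1..snd p + int n + 1}" if x: "x \<in> set xs" for x
    proof -
      obtain i where i: "i < length xs" "xs ! i = x" using x by (metis in_set_conv_nth)
      then have "\<bar>fst x - fst p\<bar> \<le> int n + 1" "\<bar>snd x - snd p\<bar> \<le> int n + 1"
        using *[of i] len by auto
      then show ?thesis unfolding mem_Times_iff atLeastAtMost_iff abs_le_iff by auto
    qed
    then show "xs \<in> {xs. set xs \<subseteq> {fst p - int n - 1..fst p + int n + 1} \<times> {snd p - int n - 1..snd p + int n + 1} \<and> length xs = n + 2}"
      using len by auto
  qed
  then show ?thesis by (rule finite_subset) (intro finite_lists_length_eq, simp)
qed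

lemma walk_sum_walks:
  assumes "d \<in> dirs"
  shows "walk_sum W v c n p d = (\<Sum>xs\<in>{xs \<in> walks n v p. p - xs ! n = d}. walk_weight W c n xs)"
  using assms
proof (induction n arbitrary: p d)
  case 0
  then show ?case
    by (auto simp: walks_0 walk_sum_def source_def walk_weight_def)
next
  case (Suc n)
  have "walk_sum W v c (Suc n) p d = W (p - d) p * (\<Sum>d'\<in>dirs. transition d' d * walk_sum W v c n (p - d) d')"
    by (simp add: walk_sum_def propagate_def)
  also have "(\<Sum>d'\<in>dirs. transition d' d * walk_sum W v c n (p - d) d') =
     (\<Sum>d'\<in>{d' \<in> dirs. d' \<noteq> - d}. tw d' d * walk_sum W v c n (p - d) d')"
    by (rule sum.mono_neutral_cong_right) (auto simp: transition_def)
  also have "W (p - d) p * \<dots> = (\<Sum>d'\<in>{d' \<in> dirs. d' \<noteq> - d}. \<Sum>ys\<in>{ys \<in> walks n v (p - d). p - d - ys ! n = d'}.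
      walk_weight W c (Suc n) (ys @ [p]))"
    unfolding sum_distrib_left
  proof (intro sum.cong refl)
    fix d' assume d': "d' \<in> {d' \<in> dirs. d' \<noteq> - d}"
    then have "walk_sum W v c n (p - d) d' = (\<Sum>ys\<in>{ys \<in> walks n v (p - d). p - d - ys ! n = d'}. walk_weight W c n ys)"
      using Suc.IH by blast
    then have "W (p - d) p * (tw d' d * walk_sum W v c n (p - d) d') =
      (\<Sum>ys\<in>{ys \<in> walks n v (p - d). p - d - ys ! n = d'}. W (p - d) p * (tw d' d * walk_weight W c n ys))"
      by (simp add: sum_distrib_left)
    also have "\<dots> = (\<Sum>ys\<in>{ys \<in> walks n v (p - d). p - d - ys ! n = d'}. walk_weight W c (Suc n) (ys @ [p]))"
    proof (intro sum.cong refl)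
      fix ys assume "ys \<in> {ys \<in> walks n v (p - d). p - d - ys ! n = d'}"
      then have len: "length ys = n + 2" and q: "ys ! (n+1) = p - d" and r: "p - d - ys ! n = d'" by (auto simp: walks_def)
      have nth: "(ys @ [p]) ! i = ys ! i" if "i < n + 2" for i using that len by (simp add: nth_append)
      have last: "(ys @ [p]) ! Suc (Suc n) = p" using len by (simp add: nth_append)
      have A: "(\<Prod>i<n+1. W ((ys @ [p]) ! i) ((ys @ [p]) ! Suc i)) = (\<Prod>i<n+1. W (ys ! i) (ys ! Suc i))"
        by (intro prod.cong refl) (simp add: nth)
      have B: "(\<Prod>i<n. tw ((ys @ [p]) ! Suc i - (ys @ [p]) ! i) ((ys @ [p]) ! (i + 2) - (ys @ [p]) ! Suc i)) =
          (\<Prod>i<n. tw (ys ! Suc i - ys ! i) (ys ! (i + 2) - ys ! Suc i))"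
        by (intro prod.cong refl) (simp add: nth)
      have "walk_weight W c (Suc n) (ys @ [p]) =
        tw c (ys ! 1 - ys ! 0) * ((\<Prod>i<n+1. W (ys ! i) (ys ! Suc i)) * W (p - d) p) *
        ((\<Prod>i<n. tw (ys ! Suc i - ys ! i) (ys ! (i + 2) - ys ! Suc i)) * tw d' d)"
        unfolding walk_weight_def
        using A B q r by (simp add: nth last)
      then show "W (p - d) p * (tw d' d * walk_weight W c n ys) = walk_weight W c (Suc n) (ys @ [p])"
        by (simp add: walk_weight_def mult_ac)
    qed
    finally show "W (p - d) p * (tw d' d * walk_sum W v c n (p - d) d') = \<dots>" .
  qed
  also have "\<dots> = (\<Sum>(d',ys)\<in>(SIGMA d':{d' \<in> dirs. d' \<noteq> - d}. {ys \<in> walks n v (p - d). p - d - ys ! n = d'}).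
      walk_weight W c (Suc n) (ys @ [p]))"
    by (rule sum.Sigma) (auto simp: finite_walks)
  also have "\<dots> = (\<Sum>xs\<in>{xs \<in> walks (Suc n) v p. p - xs ! (n + 1) = d}. walk_weight W c (Suc n) xs)"
    by (rule walks_Suc_witness[OF Suc.prems, symmetric])
  finally show ?case by simp
qed

lemma sum_walk_sum_walks:
  "(\<Sum>d\<in>dirs. g d * walk_sum W v c n p d) = (\<Sum>xs\<in>walks n v p. g (p - xs ! n) * walk_weight W c n xs)"
proof -
  have "(\<Sum>d\<in>dirs. g d * walk_sum W v c n p d) =
    (\<Sum>d\<in>dirs. \<Sum>xs\<in>{xs \<in> walks n v p. p - xs ! n = d}. g (p - xs ! n) * walk_weight W c n xs)"
    by (intro sum.cong refl) (simp add: walk_sum_walks sum_distrib_left)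
  also have "\<dots> = (\<Sum>xs\<in>walks n v p. g (p - xs ! n) * walk_weight W c n xs)"
    by (rule sum.group[OF finite_walks finite_dirs]) (auto simp: walks_def)
  finally show ?thesis .
qed

section \<open>A discrete Hopf theorem on total turning\<close>

definition axis2 :: "vertex set" where "axis2 = {(2,0),(0,2),(-2,0),(0,-2)}"
definition diag :: "vertex set" where "diag = {(1,1),(-1,1),(-1,-1),(1,-1)}"

text \<open>The segment from a to a + t meets the cut ray of \<open>tw\<close>. In the application a
  is a secant and t its increment, so that \<open>tw\<close> counts the crossings of the cut by a
  moving secant.\<close>

definition crosses :: "vertex \<Rightarrow> vertex \<Rightarrow> bool" where
  "crosses a t \<longleftrightarrow> right_of_cut a \<noteq> right_of_cut (a + t) \<and>
     (if right_of_cut a then fst a * snd t - snd a * fst t > 0 else fst a * snd t - snd a * fst t < 0)"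

lemma tw_crosses: "tw a (a + t) = (if crosses a t then -1 else 1)"
  by (simp add: tw_def crosses_def algebra_simps)

lemma crosses_reverse: "crosses (a + s) (- s) = crosses a s"
  by (auto simp: crosses_def algebra_simps)

text \<open>The two ways around the parallelogram with corners a, a + s, a + s + t, a + t cross the
  cut equally often modulo 2. This expresses that its boundary does not wind around 0.\<close>

definition square_ok :: "vertex \<Rightarrow> vertex \<Rightarrow> vertex \<Rightarrow> bool" where
  "square_ok a s t \<longleftrightarrow> (crosses a s \<noteq> crosses (a + s) t) = (crosses a t \<noteq> crosses (a + t) s)"

lemma square_ok_swap: "square_ok a t s = square_ok a s t"
  by (auto simp: square_ok_def)

lemma square_ok_flip: "square_ok (a + s) (- s) t = square_ok a s t"
proof -
  have "crosses (a + s + t) (- s) = crosses (a + t) s"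
    using crosses_reverse[of "a + t" s] by (simp add: algebra_simps)
  then show ?thesis by (auto simp: square_ok_def crosses_reverse)
qed

text \<open>The pairs listed represent all pairs of non-parallel steps up to exchange and change of
  sign. The common parity k of the coordinates is made explicit so that the parity constraint
  becomes linear.\<close>

lemma square_ok_basic:
  assumes "x = 2 * m + k" "y = 2 * n + k" "k = 0 \<or> k = 1"
    and a: "(x,y) \<noteq> 0" "(x,y) + s \<noteq> 0" "(x,y) + t \<noteq> 0" "(x,y) + s + t \<noteq> 0"
    and st: "(s,t) \<in> {((2,0),(1,1)), ((2,0),(-1,1)), ((0,2),(1,1)), ((0,2),(-1,1)), ((1,1),(-1,1))} \<or> (s,t) = ((2,0),(0,2)) \<and> k = 0"
  shows "square_ok (x,y) s t"
  using st a assms(1-3) unfolding insert_iff empty_iff prod.inject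
  by (elim disjE conjE FalseE; hypsubst; simp add: square_ok_def crosses_def right_of_cut_def zero_prod_def; smt (z3))

text \<open>Secants have coordinates of equal parity, and a cell of that lattice has area 2. The
  parallelogram has area at most 2 unless its sides are perpendicular axis steps; then it is a 2 by
  2 square whose only interior lattice point is the centre, which has odd coordinates for even a and
  so is not 0.\<close>

lemma crosses_square:
  assumes s: "s \<in> axis2 \<union> diag" and t: "t \<in> axis2 \<union> diag"
    and a: "a \<noteq> 0" "a + s \<noteq> 0" "a + t \<noteq> 0" "a + s + t \<noteq> 0"
    and par: "even (fst a) = even (snd a)" "s \<in> axis2 \<Longrightarrow> t \<in> axis2 \<Longrightarrow> even (fst a)"
  shows "square_ok a s t"
proof -
  define B :: "vertex set" where "B = {(2,0),(0,2),(1,1),(-1,1)}"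
  have base: "square_ok a s t" if st: "s \<in> B" "t \<in> B"
    and a: "a \<noteq> 0" "a + s \<noteq> 0" "a + t \<noteq> 0" "a + s + t \<noteq> 0"
    and par: "even (fst a) = even (snd a)" "s \<in> axis2 \<Longrightarrow> t \<in> axis2 \<Longrightarrow> even (fst a)" for a s t
  proof -
    obtain x y where xy: "a = (x,y)" by (cases a)
    define k m n where "k = x mod 2" "m = x div 2" "n = y div 2"
    have "even x = even y" using par(1) by (simp add: xy)
    then have k: "k = 0 \<or> k = 1" "k = 0 \<longleftrightarrow> even x" "x = 2 * m + k" "y = 2 * n + k"
      unfolding k_m_n_def by presburger+
    let ?P = "\<lambda>s t. (s,t) \<in> {((2,0),(1,1)), ((2,0),(-1,1)), ((0,2),(1,1)), ((0,2),(-1,1)), ((1,1),(-1,1))}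
      \<or> (s,t) = ((2,0),(0,2)) \<and> k = 0"
    consider "s = t" | "?P s t" | "?P t s"
    proof -
      have "k = 0" if "s = (2,0) \<and> t = (0,2) \<or> s = (0,2) \<and> t = (2,0)"
      proof -
        have "s \<in> axis2" "t \<in> axis2" using that by (auto simp: axis2_def)
        then show ?thesis using par(2) k(2) xy by simp
      qed
      then show ?thesis using st that unfolding B_def by (elim insertE emptyE) simp_all
    qed
    then show ?thesis
    proof cases
      case 1 then show ?thesis by (simp add: square_ok_def)
    next
      case 2
      show ?thesis unfolding xy by (rule square_ok_basic[OF k(3,4,1) a[unfolded xy] 2])
    next
      case 3
      have "a + t + s \<noteq> 0" using a(4) by (simp add: add_ac)
      then have "square_ok a t s"
        unfolding xy by (rule square_ok_basic[OF k(3,4,1) a(1)[unfolded xy] a(3)[unfolded xy] a(2)[unfolded xy] _ 3])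
      then show ?thesis by (simp add: square_ok_swap)
    qed
  qed
  have neg: "d \<in> B \<or> - d \<in> B" if "d \<in> axis2 \<union> diag" for d
    using that by (auto simp: axis2_def diag_def B_def)
  have ax: "- d \<in> axis2 \<longleftrightarrow> d \<in> axis2" for d by (cases d) (auto simp: axis2_def)
  have ev: "even (fst d)" "even (snd d)" if "d \<in> axis2" for d using that by (auto simp: axis2_def)
  have evd: "even (fst d) = even (snd d)" if "d \<in> axis2 \<union> diag" for d using that by (auto simp: axis2_def diag_def)
  have half: "square_ok a s t" if s: "s \<in> axis2 \<union> diag" and t: "t \<in> B" "t \<in> axis2 \<union> diag"
    and a: "a \<noteq> 0" "a + s \<noteq> 0" "a + t \<noteq> 0" "a + s + t \<noteq> 0"
    and par: "even (fst a) = even (snd a)" "s \<in> axis2 \<Longrightarrow> t \<in> axis2 \<Longrightarrow> even (fst a)" for a s t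
  proof (cases "s \<in> B")
    case True then show ?thesis using base[OF True t(1) a par] by blast
  next
    case False
    then have "- s \<in> B" using neg[OF s] by blast
    then have "square_ok (a + s) (- s) t"
    proof (rule base[OF _ t(1)])
      show "a + s + - s \<noteq> 0" using a(1) by simp
      show "a + s + - s + t \<noteq> 0" using a(3) by simp
      show "even (fst (a + s)) = even (snd (a + s))" using par(1) evd[OF s] by simp
      show "even (fst (a + s))" if "- s \<in> axis2" "t \<in> axis2"
        using that par(2) ev(1)[of s] by (simp add: ax)
    qed (fact a)+
    then show ?thesis by (simp add: square_ok_flip)
  qed
  show ?thesis
  proof (cases "t \<in> B")
    case True then show ?thesis using half[OF s True t a par] by blast
  next
    case False
    then have t': "- t \<in> B" using neg[OF t] by blast
    have t'': "- t \<in> axis2 \<union> diag" using t by (auto simp: axis2_def diag_def)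
    have "square_ok (a + t) s (- t)"
    proof (rule half[OF s t' t''])
      show "a + t + - t \<noteq> 0" using a(1) by simp
      show "a + t + s \<noteq> 0" using a(4) by (simp add: add_ac)
      have "a + t + s + - t = a + s" by (simp add: add_ac)
      then show "a + t + s + - t \<noteq> 0" using a(2) by simp
      show "even (fst (a + t)) = even (snd (a + t))" using par(1) evd[OF t] by simp
      show "even (fst (a + t))" if "s \<in> axis2" "- t \<in> axis2"
        using that par(2) ev(1)[of t] by (simp add: ax)
    qed (fact a)+
    then show ?thesis using square_ok_flip[of a t s] by (simp add: square_ok_swap)
  qed
qed

text \<open>The sum of two non-opposite steps points between them, so the turn from s to t, being
  less than pi, can be split at s + t.\<close>

lemma tw_triangle:
  assumes "s \<in> axis2 \<union> diag" "t \<in> axis2 \<union> diag" "s + t \<noteq> 0"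
  shows "tw s (s + t) * tw (s + t) t = tw s t"
  using assms unfolding axis2_def diag_def Un_iff insert_iff empty_iff
  by (elim disjE FalseE; simp add: tw_def right_of_cut_def zero_prod_def)

lemma tw_square:
  assumes "s \<in> axis2 \<union> diag" "t \<in> axis2 \<union> diag"
    and "a \<noteq> 0" "a + s \<noteq> 0" "a + t \<noteq> 0" "a + s + t \<noteq> 0"
    and "even (fst a) = even (snd a)" "s \<in> axis2 \<Longrightarrow> t \<in> axis2 \<Longrightarrow> even (fst a)"
  shows "tw a (a + s) * tw (a + s) (a + s + t) = tw a (a + t) * tw (a + t) (a + s + t)"
proof -
  have e: "a + s + t = a + t + s" by (simp add: add_ac)
  have "tw (a + t) (a + s + t) = (if crosses (a + t) s then -1 else 1)"
    unfolding e by (rule tw_crosses)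
  then show ?thesis using crosses_square[OF assms] by (auto simp: tw_crosses square_ok_def)
qed

text \<open>Hopf's argument: the tangents form the diagonal of the triangle of secants P j - P i, and pushing the diagonal
  across one elementary square does not change the turning, since the four secants of a square span a parallelogram
  without interior lattice points and hence do not wind around 0.\<close>

lemma discrete_hopf:
  fixes P :: "nat \<Rightarrow> vertex"
  assumes st: "\<And>i. i \<le> n \<Longrightarrow> P (Suc i) - P i \<in> axis2 \<union> diag"
    and inj: "\<And>i j. i < j \<Longrightarrow> j \<le> Suc n \<Longrightarrow> P i \<noteq> P j"
    and par: "\<And>i j. i < j \<Longrightarrow> j \<le> Suc n \<Longrightarrow> even (fst (P j - P i)) = even (snd (P j - P i))"
    and par2: "\<And>i j. i < j \<Longrightarrow> j \<le> n \<Longrightarrow> P (Suc i) - P i \<in> axis2 \<Longrightarrow> P (Suc j) - P j \<in> axis2 \<Longrightarrow> even (fst (P j - P i))"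
  shows "(\<Prod>i<n. tw (P (Suc i) - P i) (P (Suc (Suc i)) - P (Suc i))) =
    (\<Prod>j<n. tw (P (Suc j) - P 0) (P (Suc (Suc j)) - P 0)) *
    (\<Prod>i<n. tw (P (Suc n) - P i) (P (Suc n) - P (Suc i)))"
  using assms
proof (induction n)
  case (Suc n)
  note st = Suc.prems(1) and inj = Suc.prems(2) and par = Suc.prems(3) and par2 = Suc.prems(4)
  let ?d = "\<lambda>i j. P j - P i"
  define m where "m = Suc n"
  have sq: "tw (?d i m) (?d (Suc i) m) * tw (?d (Suc i) m) (?d (Suc i) (Suc m)) =
      tw (?d i m) (?d i (Suc m)) * tw (?d i (Suc m)) (?d (Suc i) (Suc m))" if "i < n" for i
  proof -
    \<comment> \<open>Advancing the initial index of a secant subtracts a step of the path,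
      advancing the final index adds one.\<close>
    let ?s = "- (P (Suc i) - P i)" and ?t = "P (Suc m) - P m"
    have neg: "d \<in> axis2 \<Longrightarrow> - d \<in> axis2" "d \<in> diag \<Longrightarrow> - d \<in> diag" for d
      by (auto simp: axis2_def diag_def)
    have s: "?s \<in> axis2 \<union> diag" using st[of i] neg that by fastforce
    have t: "?t \<in> axis2 \<union> diag" using st[of m] by (simp add: m_def)
    have eqs: "?d i m + ?s = ?d (Suc i) m" "?d i m + ?t = ?d i (Suc m)" "?d i m + ?s + ?t = ?d (Suc i) (Suc m)"
      by (simp_all add: algebra_simps)
    have nz: "?d i' j' \<noteq> 0" if "i' < j'" "j' \<le> Suc m" for i' j'
      using inj[of i' j'] that by (simp add: m_def)
    have "tw (?d i m) (?d i m + ?s) * tw (?d i m + ?s) (?d i m + ?s + ?t) =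
       tw (?d i m) (?d i m + ?t) * tw (?d i m + ?t) (?d i m + ?s + ?t)"
    proof (rule tw_square[OF s t])
      show "?d i m \<noteq> 0" "?d i m + ?s \<noteq> 0" "?d i m + ?t \<noteq> 0" "?d i m + ?s + ?t \<noteq> 0"
        unfolding eqs using nz that by (auto simp: m_def)
      show "even (fst (?d i m)) = even (snd (?d i m))" using par[of i m] that by (simp add: m_def)
      show "even (fst (?d i m))" if "?s \<in> axis2" "?t \<in> axis2"
        using par2[of i m] neg(1)[OF that(1)] that(2) \<open>i < n\<close> by (simp add: m_def)
    qed
    then show ?thesis unfolding eqs(3) unfolding eqs(1,2) .
  qed
  \<comment> \<open>The secants ending at P m are exchanged for those ending at P (Suc m), one
    square at a time.\<close>
  have claim: "tw (?d 0 m) (?d 0 (Suc m)) * (\<Prod>i<k. tw (?d i (Suc m)) (?d (Suc i) (Suc m))) =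
      (\<Prod>i<k. tw (?d i m) (?d (Suc i) m)) * tw (?d k m) (?d k (Suc m))" if "k \<le> n" for k
    using that
  proof (induction k)
    case (Suc k)
    have "tw (?d 0 m) (?d 0 (Suc m)) * (\<Prod>i<Suc k. tw (?d i (Suc m)) (?d (Suc i) (Suc m))) =
      ((\<Prod>i<k. tw (?d i m) (?d (Suc i) m)) * tw (?d k m) (?d k (Suc m))) * tw (?d k (Suc m)) (?d (Suc k) (Suc m))"
      using Suc by (simp add: mult.assoc)
    also have "\<dots> = (\<Prod>i<k. tw (?d i m) (?d (Suc i) m)) * (tw (?d k m) (?d (Suc k) m) * tw (?d (Suc k) m) (?d (Suc k) (Suc m)))"
      using sq[of k] Suc.prems by (simp add: mult.assoc)
    finally show ?case by (simp add: mult.assoc)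
  qed simp
  \<comment> \<open>The last cell is a triangle, since its fourth secant P m - P m would
    vanish.\<close>
  have tri: "tw (?d n m) (?d m (Suc m)) = tw (?d n m) (?d n (Suc m)) * tw (?d n (Suc m)) (?d m (Suc m))"
  proof -
    have e: "?d n m + ?d m (Suc m) = ?d n (Suc m)" by simp
    have "tw (?d n m) (?d n m + ?d m (Suc m)) * tw (?d n m + ?d m (Suc m)) (?d m (Suc m)) = tw (?d n m) (?d m (Suc m))"
    proof (rule tw_triangle)
      show "?d n m + ?d m (Suc m) \<noteq> 0" unfolding e using inj[of n "Suc m"] by (simp add: m_def)
    qed (use st[of n] st[of m] in \<open>simp_all add: m_def\<close>)
    then show ?thesis unfolding e by simp
  qed
  have IH: "(\<Prod>i<n. tw (?d i (Suc i)) (?d (Suc i) (Suc (Suc i)))) =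
    (\<Prod>j<n. tw (?d 0 (Suc j)) (?d 0 (Suc (Suc j)))) * (\<Prod>i<n. tw (?d i m) (?d (Suc i) m))"
    unfolding m_def
  proof (rule Suc.IH)
    show "P (Suc i) - P i \<in> axis2 \<union> diag" if "i \<le> n" for i using st[of i] that by simp
    show "P i \<noteq> P j" if "i < j" "j \<le> Suc n" for i j using inj[of i j] that by simp
    show "even (fst (P j - P i)) = even (snd (P j - P i))" if "i < j" "j \<le> Suc n" for i j
      using par[of i j] that by simp
    show "even (fst (P j - P i))" if "i < j" "j \<le> n" "P (Suc i) - P i \<in> axis2" "P (Suc j) - P j \<in> axis2" for i j
      using par2[of i j] that by simp
  qed
  have "(\<Prod>i<Suc n. tw (?d i (Suc i)) (?d (Suc i) (Suc (Suc i)))) =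
    (\<Prod>j<n. tw (?d 0 (Suc j)) (?d 0 (Suc (Suc j)))) * ((\<Prod>i<n. tw (?d i m) (?d (Suc i) m)) * tw (?d n m) (?d n (Suc m)))
    * tw (?d n (Suc m)) (?d m (Suc m))"
    using IH tri by (simp add: m_def mult.assoc)
  also have "\<dots> = (\<Prod>j<Suc n. tw (?d 0 (Suc j)) (?d 0 (Suc (Suc j)))) *
     (\<Prod>i<Suc n. tw (?d i (Suc m)) (?d (Suc i) (Suc m)))"
    unfolding claim[OF order.refl, symmetric] by (simp add: m_def mult_ac)
  finally show ?case by (simp add: m_def)
qed simp

text \<open>Crossings of the dual path with the vertical ray going up from w.\<close>
definition up_cross :: "vertex \<Rightarrow> vertex \<Rightarrow> vertex \<Rightarrow> real" where
  "up_cross w p q = (if (fst p > 2 * fst w) \<noteq> (fst q > 2 * fst w) \<and> snd p > 2 * snd w then -1 else 1)"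

definition path_cross :: "vertex \<Rightarrow> vertex list \<Rightarrow> real" where
  "path_cross w \<gamma> = (\<Prod>i<length \<gamma> - 1. up_cross w (\<gamma> ! i) (\<gamma> ! Suc i))"

lemma dual_step_cases:
  assumes "dual p" "dual q" "nn2 p q"
  obtains i j where "p = (2*i+1, 2*j+1)" "q = (2*i+3, 2*j+1) \<or> q = (2*i-1, 2*j+1) \<or> q = (2*i+1, 2*j+3) \<or> q = (2*i+1, 2*j-1)"
proof -
  obtain i j where p: "p = (2*i+1, 2*j+1)" using assms(1) by (cases p) (auto simp: dual_def elim!: oddE)
  obtain k l where q: "q = (2*k+1, 2*l+1)" using assms(2) by (cases q) (auto simp: dual_def elim!: oddE)
  have "\<bar>i - k\<bar> + \<bar>j - l\<bar> = 1" using assms(3) by (simp add: p q nn2_def) presburger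
  then have "k = i + 1 \<and> l = j \<or> k = i - 1 \<and> l = j \<or> k = i \<and> l = j + 1 \<or> k = i \<and> l = j - 1" by linarith
  then show ?thesis by (intro that[OF p]) (auto simp: q)
qed

text \<open>A secant from w to a dual vertex has odd coordinates, so it is never vertical, and it
  crosses the cut exactly when the dual step crosses the ray going up from w. For secants pointing
  to w the ray is the downward one, whose crossings are those of the whole vertical line times those
  of the upward ray.\<close>

lemma tw_from_vertex:
  assumes "dual p" "dual q" "nn2 p q"
  shows "tw (p - emb w) (q - emb w) = up_cross w p q"
    and "tw (emb w - p) (emb w - q) = up_cross w p q * (if (fst p > 2 * fst w) \<noteq> (fst q > 2 * fst w) then -1 else 1)"
proof -
  obtain i j where p: "p = (2*i+1, 2*j+1)" and q: "q = (2*i+3, 2*j+1) \<or> q = (2*i-1, 2*j+1) \<or> q = (2*i+1, 2*j+3) \<or> q = (2*i+1, 2*j-1)"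
    using dual_step_cases[OF assms] by metis
  obtain a b where w: "w = (a,b)" by (cases w)
  have i: "i < a - 1 \<or> i = a - 1 \<or> i = a \<or> i > a" and j: "j < b - 1 \<or> j = b - 1 \<or> j = b \<or> j > b" by linarith+
  show "tw (p - emb w) (q - emb w) = up_cross w p q"
    using q i j by (elim disjE; simp add: p w tw_def right_of_cut_def up_cross_def emb_def)
  show "tw (emb w - p) (emb w - q) = up_cross w p q * (if (fst p > 2 * fst w) \<noteq> (fst q > 2 * fst w) then -1 else 1)"
    using q i j by (elim disjE; simp add: p w tw_def right_of_cut_def up_cross_def emb_def)
qed

definition gamma_sign :: "vertex list \<Rightarrow> vertex \<Rightarrow> vertex \<Rightarrow> real" where
  "gamma_sign \<gamma> p q = (if crosses_gamma \<gamma> (emb p) (emb q) then -1 else 1)"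

text \<open>The dual edge and the two lines going down from its ends bound the half strip of
  vertices below it, which are those with \<open>up_cross\<close> equal to -1. The edge from p to q
  crosses this boundary exactly when one of its ends lies inside.\<close>

lemma edge_cross:
  assumes r: "dual r" "dual r'" "nn2 r r'" and pq: "q - p \<in> dirs"
  shows "(if fst (emb p) + fst (emb q) = fst r + fst r' \<and> snd (emb p) + snd (emb q) = snd r + snd r' then -1 else 1) =
    column_sign (dual_idx r) p q * column_sign (dual_idx r') p q * (up_cross p r r' * up_cross q r r')"
proof -
  obtain i j where r: "r = (2*i+1, 2*j+1)" and r': "r' = (2*i+3, 2*j+1) \<or> r' = (2*i-1, 2*j+1) \<or> r' = (2*i+1, 2*j+3) \<or> r' = (2*i+1, 2*j-1)"
    using dual_step_cases[OF r] by metis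
  obtain a b where p: "p = (a,b)" by (cases p)
  have q: "q = (a+1,b) \<or> q = (a-1,b) \<or> q = (a,b+1) \<or> q = (a,b-1)"
    using pq by (cases q) (auto simp: p dirs_def)
  have di: "dual_idx r = (i,j)" by (simp add: dual_idx_def r)
  from r' consider (1) "r' = (2*i+3, 2*j+1)" "dual_idx r' = (i+1,j)" | (2) "r' = (2*i-1, 2*j+1)" "dual_idx r' = (i-1,j)"
    | (3) "r' = (2*i+1, 2*j+3)" "dual_idx r' = (i,j+1)" | (4) "r' = (2*i+1, 2*j-1)" "dual_idx r' = (i,j-1)"
    by (elim disjE) (simp_all add: dual_idx_def)
  then show ?thesis
  proof cases
    case 1 show ?thesis unfolding 1(2) di using q unfolding 1(1) r p
      by (elim disjE; hypsubst; auto simp: emb_def column_sign_def up_cross_def; presburger)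
  next
    case 2 show ?thesis unfolding 2(2) di using q unfolding 2(1) r p
      by (elim disjE; hypsubst; auto simp: emb_def column_sign_def up_cross_def; presburger)
  next
    case 3 show ?thesis unfolding 3(2) di using q unfolding 3(1) r p
      by (elim disjE; hypsubst; auto simp: emb_def column_sign_def up_cross_def; presburger)
  next
    case 4 show ?thesis unfolding 4(2) di using q unfolding 4(1) r p
      by (elim disjE; hypsubst; auto simp: emb_def column_sign_def up_cross_def; presburger)
  qed
qed

lemma prod_sign_unique:
  fixes k :: nat
  assumes "\<And>i j. i < k \<Longrightarrow> j < k \<Longrightarrow> Q i \<Longrightarrow> Q j \<Longrightarrow> i = j"
  shows "(\<Prod>i<k. if Q i then -1 else 1) = (if \<exists>i<k. Q i then -1 else 1 :: real)"
proof (cases "\<exists>i<k. Q i")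
  case True
  then obtain i where i: "i < k" "Q i" by blast
  have "(\<Prod>i<k. if Q i then -1 else 1) = (\<Prod>j<k. if j = i then -1 else (1::real))"
    by (intro prod.cong refl) (use assms i in auto)
  also have "\<dots> = -1" using i(1) by (subst prod.delta) auto
  finally show ?thesis using True by simp
qed auto

text \<open>In the product of \<open>edge_cross\<close> along gamma the lines at inner vertices
  occur twice and cancel, so the signs of \<open>xw\<close> are those of two vertical lines up to
  the gauge function \<open>path_cross\<close>. Distinct path vertices ensure that no two steps
  share a midpoint, so each crossed edge contributes one factor -1.\<close>

lemma gamma_sign_eq:
  assumes \<gamma>: "dual_saw \<gamma> us vs" and pq: "q - p \<in> dirs"
  shows "gamma_sign \<gamma> p q = column_sign (dual_idx us) p q * column_sign (dual_idx vs) p q *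
    (path_cross p \<gamma> * path_cross q \<gamma>)"
proof -
  have ne: "\<gamma> \<noteq> []" and us: "hd \<gamma> = us" and vs: "last \<gamma> = vs" and dist: "distinct \<gamma>"
    and du: "\<And>p. p \<in> set \<gamma> \<Longrightarrow> dual p" and nn: "\<And>i. Suc i < length \<gamma> \<Longrightarrow> nn2 (\<gamma> ! i) (\<gamma> ! Suc i)"
    using \<gamma> by (auto simp: dual_saw_def)
  define k where "k = length \<gamma> - 1"
  define Q where "Q i \<longleftrightarrow> fst (emb p) + fst (emb q) = fst (\<gamma>!i) + fst (\<gamma>!Suc i) \<and> snd (emb p) + snd (emb q) = snd (\<gamma>!i) + snd (\<gamma>!Suc i)" for i
  have step: "dual (\<gamma>!i)" "dual (\<gamma>!Suc i)" "nn2 (\<gamma>!i) (\<gamma>!Suc i)" if "i < k" for i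
    using that du nn by (auto simp: k_def)
  have uniq: "i = j" if ij: "i < k" "j < k" "Q i" "Q j" for i j
  proof -
    obtain a b where A: "\<gamma>!i = (2*a+1, 2*b+1)" "\<gamma>!Suc i = (2*a+3, 2*b+1) \<or> \<gamma>!Suc i = (2*a-1, 2*b+1) \<or> \<gamma>!Suc i = (2*a+1, 2*b+3) \<or> \<gamma>!Suc i = (2*a+1, 2*b-1)"
      using dual_step_cases[OF step[OF ij(1)]] by metis
    obtain c d where C: "\<gamma>!j = (2*c+1, 2*d+1)" "\<gamma>!Suc j = (2*c+3, 2*d+1) \<or> \<gamma>!Suc j = (2*c-1, 2*d+1) \<or> \<gamma>!Suc j = (2*c+1, 2*d+3) \<or> \<gamma>!Suc j = (2*c+1, 2*d-1)"
      using dual_step_cases[OF step[OF ij(2)]] by metis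
    have "fst (\<gamma>!i) + fst (\<gamma>!Suc i) = fst (\<gamma>!j) + fst (\<gamma>!Suc j)" "snd (\<gamma>!i) + snd (\<gamma>!Suc i) = snd (\<gamma>!j) + snd (\<gamma>!Suc j)"
      using ij(3,4) by (simp_all add: Q_def)
    then have "\<gamma>!i = \<gamma>!j \<or> \<gamma>!i = \<gamma>!Suc j \<and> \<gamma>!Suc i = \<gamma>!j"
      using A C by (elim disjE; simp; presburger)
    moreover have "i < length \<gamma>" "j < length \<gamma>" "Suc i < length \<gamma>" "Suc j < length \<gamma>" using ij by (auto simp: k_def)
    ultimately show ?thesis using dist nth_eq_iff_index_eq by (metis Suc_n_not_le_n le_SucI order.refl)
  qed
  have tele: "(\<Prod>i<m. f i * f (Suc i)) = f 0 * f m" if "\<And>i. f i * f i = (1::real)" for f :: "nat \<Rightarrow> real" and m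
  proof (induction m)
    case (Suc m)
    have "f 0 * f m * (f m * f (Suc m)) = f 0 * (f m * f m) * f (Suc m)" by (simp only: mult.assoc)
    then show ?case using Suc that by simp
  qed (simp add: that)
  have "gamma_sign \<gamma> p q = (if \<exists>i<k. Q i then -1 else 1)"
    unfolding gamma_sign_def crosses_gamma_def Q_def k_def by (simp add: less_diff_conv)
  also have "\<dots> = (\<Prod>i<k. if Q i then -1 else 1)" using prod_sign_unique[of k Q] uniq by simp
  also have "\<dots> = (\<Prod>i<k. column_sign (dual_idx (\<gamma>!i)) p q * column_sign (dual_idx (\<gamma>!Suc i)) p q *
     (up_cross p (\<gamma>!i) (\<gamma>!Suc i) * up_cross q (\<gamma>!i) (\<gamma>!Suc i)))"
    unfolding Q_def by (intro prod.cong refl edge_cross step pq) auto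
  also have "\<dots> = column_sign (dual_idx (\<gamma>!0)) p q * column_sign (dual_idx (\<gamma>!k)) p q *
    (path_cross p \<gamma> * path_cross q \<gamma>)"
    unfolding prod.distrib path_cross_def k_def[symmetric] tele[of "\<lambda>i. column_sign (dual_idx (\<gamma>!i)) p q", simplified, unfolded prod.distrib] by simp
  finally show ?thesis using us vs ne by (simp add: hd_conv_nth last_conv_nth k_def)
qed

section \<open>Loops through the added edge\<close>

text \<open>With integer indices modulo the length, rotation and reversal of a closed path are the
  affine index maps from i to s i + k with s = 1 or s = -1, the form used in
  \<open>cyc_equiv\<close>.\<close>

definition zc :: "'a list \<Rightarrow> int \<Rightarrow> 'a" where
  "zc l i = l ! nat (i mod int (length l))"

lemma zc_cyc: "zc l (int i) = cyc l i"
  by (simp add: zc_def cyc_def zmod_int[symmetric])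

lemma zc_mod: "zc l (i mod int (length l)) = zc l i"
  by (simp add: zc_def)

lemma zc_cong: "i mod int (length l) = j mod int (length l) \<Longrightarrow> zc l i = zc l j"
  by (simp add: zc_def)

lemma zc_nth: "0 \<le> i \<Longrightarrow> i < int (length l) \<Longrightarrow> zc l i = l ! nat i"
  by (simp add: zc_def)

lemma zc_ext:
  assumes "length m = length l" "\<And>i. zc m i = zc l i" shows "m = l"
proof (rule nth_equalityI[OF assms(1)])
  fix i assume "i < length m"
  then show "m ! i = l ! i" using assms(2)[of "int i"] assms(1) by (simp add: zc_nth)
qed

lemma zc_rotate:
  assumes "l \<noteq> []" shows "zc (rotate k l) i = zc l (i + int k)"
proof -
  have N: "int (length l) > 0" using assms by simp
  define r where "r = nat (i mod int (length l))"
  have r: "r < length l" "int r = i mod int (length l)" using N by (auto simp: r_def nat_less_iff)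
  have "zc (rotate k l) i = l ! ((k + r) mod length l)"
    using r by (simp add: zc_def nth_rotate r_def[symmetric])
  also have "(k + r) mod length l = nat ((i + int k) mod int (length l))"
  proof -
    have "int ((k + r) mod length l) = (int k + i mod int (length l)) mod int (length l)"
      using r by (simp add: zmod_int)
    also have "\<dots> = (i + int k) mod int (length l)" by (simp add: mod_simps add.commute)
    finally show ?thesis by linarith
  qed
  finally show ?thesis by (simp add: zc_def)
qed

lemma zc_rev:
  assumes "l \<noteq> []" shows "zc (rev l) i = zc l (- 1 - i)"
proof -
  have N: "int (length l) > 0" using assms by simp
  define r where "r = i mod int (length l)"
  have r: "0 \<le> r" "r < int (length l)" using N by (auto simp: r_def)
  have "zc (rev l) i = l ! (length l - Suc (nat r))"
    using r by (simp add: zc_def r_def[symmetric] rev_nth nat_less_iff)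
  also have "length l - Suc (nat r) = nat ((- 1 - i) mod int (length l))"
  proof -
    have "(- 1 - i) mod int (length l) = (- 1 - r) mod int (length l)"
      unfolding r_def by (simp add: mod_simps)
    also have "\<dots> = (- 1 - r + int (length l)) mod int (length l)" by simp
    also have "\<dots> = - 1 - r + int (length l)" using r by (intro mod_pos_pos_trivial) auto
    finally show ?thesis using r by simp
  qed
  finally show ?thesis by (simp add: zc_def)
qed

definition cyc_equiv :: "'a list \<Rightarrow> 'a list \<Rightarrow> bool" where
  "cyc_equiv m l \<longleftrightarrow> length m = length l \<and> (\<exists>s\<in>{1,-1}. \<exists>k. \<forall>i. zc m i = zc l (s * i + k))"

lemma cyc_equiv_refl: "cyc_equiv l l"
  unfolding cyc_equiv_def by (intro conjI bexI[of _ 1] exI[of _ 0]) auto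

lemma cyc_equiv_sym: assumes "cyc_equiv m l" shows "cyc_equiv l m"
proof -
  obtain s k where s: "s \<in> {1,-1}" and z: "\<And>i. zc m i = zc l (s * i + k)" and len: "length m = length l"
    using assms unfolding cyc_equiv_def by blast
  have "zc l i = zc m (s * i + (- s * k))" for i
  proof -
    have "s * (s * i + - s * k) + k = i" using s by auto
    then show ?thesis by (simp add: z)
  qed
  then show ?thesis unfolding cyc_equiv_def using len by (intro conjI bexI[OF _ s] exI[of _ "- s * k"] allI) simp_all
qed

lemma cyc_equiv_trans: assumes "cyc_equiv m l" "cyc_equiv l n" shows "cyc_equiv m n"
proof -
  obtain s k where s: "s \<in> {1,-1}" and z: "\<And>i. zc m i = zc l (s * i + k)" and len: "length m = length l"
    using assms unfolding cyc_equiv_def by blast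
  obtain t j where t: "t \<in> {1,-1}" and z': "\<And>i. zc l i = zc n (t * i + j)" and len': "length l = length n"
    using assms unfolding cyc_equiv_def by blast
  have "zc m i = zc n ((t * s) * i + (t * k + j))" for i
    by (simp add: z z' algebra_simps)
  moreover have "t * s \<in> {1,-1}" using s t by auto
  ultimately show ?thesis unfolding cyc_equiv_def using len len' by metis
qed

lemma cyc_equiv_rotate: "cyc_equiv (rotate k l) l"
proof (cases "l = []")
  case False
  then show ?thesis
    unfolding cyc_equiv_def by (intro conjI bexI[of _ 1] exI[of _ "int k"]) (auto simp: zc_rotate)
qed (simp add: cyc_equiv_refl)

lemma cyc_equiv_rev: "cyc_equiv (rev l) l"
proof (cases "l = []")
  case False
  show ?thesis unfolding cyc_equiv_def
    by (intro conjI bexI[of _ "-1"] exI[of _ "-1"]) (auto simp: zc_rev[OF False] intro!: arg_cong[where f = "zc l"])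
qed (simp add: cyc_equiv_refl)

lemma cyc_equiv_cases:
  assumes e: "cyc_equiv m l" and l: "l \<noteq> []"
  shows "\<exists>k<length l. m = rotate k l \<or> m = rotate k (rev l)"
proof -
  obtain s k where s: "s \<in> {1,-1}" and z: "\<And>i. zc m i = zc l (s * i + k)" and len: "length m = length l"
    using e unfolding cyc_equiv_def by blast
  have N: "int (length l) > 0" using l by simp
  show ?thesis
  proof (cases "s = 1")
    case True
    define k' where "k' = nat (k mod int (length l))"
    have k': "k' < length l" "int k' = k mod int (length l)" using N by (auto simp: k'_def nat_less_iff)
    have "m = rotate k' l"
    proof (rule zc_ext)
      show "zc m i = zc (rotate k' l) i" for i
        unfolding zc_rotate[OF l] z k'(2) True by (rule zc_cong) (simp add: mod_simps)
    qed (simp add: len)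
    then show ?thesis using k'(1) by blast
  next
    case False
    then have s1: "s = -1" using s by simp
    have l': "rev l \<noteq> []" using l by simp
    define k' where "k' = nat ((- 1 - k) mod int (length l))"
    have k': "k' < length l" "int k' = (- 1 - k) mod int (length l)" using N by (auto simp: k'_def nat_less_iff)
    have "m = rotate k' (rev l)"
    proof (rule zc_ext)
      fix i
      have "(- 1 - (i + int k')) mod int (length l) = (- i + k) mod int (length l)"
      proof -
        have "(- 1 - (i + int k')) mod int (length l) = ((- 1 - i) - (- 1 - k) mod int (length l)) mod int (length l)"
          unfolding k'(2) by (simp add: algebra_simps)
        also have "\<dots> = ((- 1 - i) - (- 1 - k)) mod int (length l)" by (rule mod_diff_right_eq)
        finally show ?thesis by simp
      qed
      then show "zc m i = zc (rotate k' (rev l)) i"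
        unfolding zc_rotate[OF l'] zc_rev[OF l] z s1 by (intro zc_cong) simp
    qed (simp add: len)
    then show ?thesis using k'(1) by blast
  qed
qed

lemma periodic_bij:
  assumes N: "(N::int) > 0" and s: "s \<in> {1,-1::int}"
  shows "bij_betw (\<lambda>i. (s * i + k) mod N) {0..<N} {0..<N}"
proof (rule bij_betwI[where g = "\<lambda>i. (s * (i - k)) mod N"])
  have ss: "s * (s * a) = a" for a using s by auto
  show "(s * ((s * x + k) mod N - k)) mod N = x" if "x \<in> {0..<N}" for x
  proof -
    have "(s * ((s * x + k) mod N - k)) mod N = (s * ((s * x + k) - k)) mod N"
      by (metis mod_diff_left_eq mod_mult_right_eq)
    then show ?thesis using that by (simp add: ss)
  qed
  show "(s * ((s * (y - k)) mod N) + k) mod N = y" if "y \<in> {0..<N}" for y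
  proof -
    have "(s * ((s * (y - k)) mod N) + k) mod N = (s * (s * (y - k)) + k) mod N"
      by (metis mod_add_left_eq mod_mult_right_eq)
    then show ?thesis using that by (simp add: ss)
  qed
qed (use N in auto)

lemma prod_periodic:
  fixes g :: "int \<Rightarrow> real"
  assumes N: "(N::int) > 0" and s: "s \<in> {1,-1::int}" and g: "\<And>i. g (i mod N) = g i"
  shows "(\<Prod>i\<in>{0..<N}. g (s * i + k)) = (\<Prod>i\<in>{0..<N}. g i)"
  using prod.reindex_bij_betw[OF periodic_bij[OF N s], of g k] by (simp add: g)

lemma card_periodic:
  assumes N: "(N::int) > 0" and s: "s \<in> {1,-1::int}" and g: "\<And>i. P (i mod N) = P i"
  shows "card {i \<in> {0..<N}. P (s * i + k)} = card {i \<in> {0..<N}. P i}"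
proof -
  have "(\<Sum>i\<in>{0..<N}. if P (s * i + k) then 1 else 0 :: nat) = (\<Sum>i\<in>{0..<N}. if P i then 1 else 0)"
    using sum.reindex_bij_betw[OF periodic_bij[OF N s], of "\<lambda>i. if P i then 1 else 0" k] by (simp add: g)
  then show ?thesis by (simp add: sum.If_cases Int_def)
qed

lemma prod_cyc:
  fixes g :: "int \<Rightarrow> real"
  shows "(\<Prod>i<N. g (int i)) = (\<Prod>i\<in>{0..<int N}. g i)"
proof -
  have "{0..<int N} = int ` {..<N}" using image_int_atLeastLessThan[of 0 N] by (simp add: lessThan_atLeast0)
  then show ?thesis by (simp add: prod.reindex)
qed

lemma card_cyc: "card {i. i < N \<and> P (int i)} = card {i \<in> {0..<int N}. P i}"
proof -
  have "{i \<in> {0..<int N}. P i} = int ` {i. i < N \<and> P (int i)}"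
  proof (intro set_eqI iffI)
    fix i assume "i \<in> {i \<in> {0..<int N}. P i}"
    then show "i \<in> int ` {i. i < N \<and> P (int i)}" by (intro image_eqI[of _ _ "nat i"]) auto
  qed auto
  then show ?thesis by (simp add: card_image)
qed

text \<open>The angle in units of pi/4, in the branch from -3/2 pi to pi/4 on which tw is based.\<close>

definition angle_index :: "vertex \<Rightarrow> int" where
  "angle_index a = (if a = (2,0) then 0 else if a = (1,1) then 1 else if a = (0,2) then - 6 else if a = (-1,1) then - 5
     else if a = (-2,0) then - 4 else if a = (-1,-1) then - 3 else if a = (0,-2) then - 2 else - 1)"

lemma angle_index_polar:
  assumes "a \<in> axis2 \<union> diag"
  shows "\<exists>r>0. Complex (of_int (fst a)) (of_int (snd a)) = of_real r * cis (pi * of_int (angle_index a) / 4)"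
proof -
  have sh: "cis (x - pi) = - cis x" for x by (simp add: complex_eq_iff cos_diff sin_diff)
  have c: "cis (- (pi * 3) / 4) = - cis (pi / 4)" "cis (- (pi * 5) / 4) = - cis (- (pi / 4))" "cis (- (pi * 6) / 4) = - cis (- (pi / 2))"
    using sh[of "pi/4"] sh[of "-(pi/4)"] sh[of "-(pi/2)"] by (simp_all add: field_simps)
  have s: "sqrt 2 * (sqrt 2 / 2) = (1::real)" by simp
  have t: "sin (pi * 3 / 4) = sqrt 2 / 2" "cos (pi * 3 / 4) = - (sqrt 2 / 2)" "sin (pi * 5 / 4) = - (sqrt 2 / 2)" "cos (pi * 5 / 4) = - (sqrt 2 / 2)"
    using c(1,2) by (auto simp: complex_eq_iff cos_45 sin_45 field_simps)
  show ?thesis using assms unfolding axis2_def diag_def Un_iff insert_iff empty_iff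
  proof (elim disjE FalseE)
    assume "a = (2,0)" then show ?thesis by (intro exI[of _ 2]) (simp add: angle_index_def complex_eq_iff)
  next
    assume "a = (0,2)" then show ?thesis using c(3)
      by (intro exI[of _ 2]) (simp add: angle_index_def complex_eq_iff)
  next
    assume "a = (-2,0)" then show ?thesis by (intro exI[of _ 2]) (simp add: angle_index_def complex_eq_iff)
  next
    assume "a = (0,-2)" then show ?thesis by (intro exI[of _ 2]) (simp add: angle_index_def complex_eq_iff)
  next
    assume "a = (1,1)" then show ?thesis using s
      by (intro exI[of _ "sqrt 2"]) (simp add: angle_index_def complex_eq_iff cos_45 sin_45)
  next
    assume "a = (-1,1)" then show ?thesis using s
      by (intro exI[of _ "sqrt 2"]) (simp add: angle_index_def complex_eq_iff t)
  next
    assume "a = (-1,-1)" then show ?thesis using s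
      by (intro exI[of _ "sqrt 2"]) (simp add: angle_index_def complex_eq_iff t)
  next
    assume "a = (1,-1)" then show ?thesis using s
      by (intro exI[of _ "sqrt 2"]) (simp add: angle_index_def complex_eq_iff cos_45 sin_45)
  qed
qed

text \<open>Eight units are a full turn, and j counts the full turns that bring the difference of
  the two angles strictly between - pi and pi.\<close>

lemma tw_angle_index:
  assumes "a \<in> axis2 \<union> diag" "b \<in> axis2 \<union> diag" "a + b \<noteq> 0"
  shows "\<exists>j\<in>{-1,0,1}. \<bar>angle_index b - angle_index a + 8 * j\<bar> < 4 \<and> tw a b = (if j = 0 then 1 else - 1)"
  using assms unfolding axis2_def diag_def Un_iff insert_iff empty_iff
  by (elim disjE FalseE; simp add: tw_def right_of_cut_def zero_prod_def angle_index_def)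

text \<open>The turning angle is the difference of the two branch angles plus 2 pi j. Halving turns
  the correction into exp (i pi j), which is \<open>tw\<close>, and leaves the quotient of the
  square roots of the two directions.\<close>

lemma exp_turn:
  assumes a: "q - p \<in> axis2 \<union> diag" and b: "r - q \<in> axis2 \<union> diag" and ne: "r \<noteq> p"
  shows "exp (\<i> * complex_of_real (turn p q r / 2)) = complex_of_real (tw (q - p) (r - q)) *
    (cis (pi * of_int (angle_index (r - q)) / 8) / cis (pi * of_int (angle_index (q - p)) / 8))"
proof -
  let ?a = "q - p" and ?b = "r - q"
  have "?a + ?b \<noteq> 0" using ne by simp
  then obtain j where j: "j \<in> {-1,0,1}" "\<bar>angle_index ?b - angle_index ?a + 8 * j\<bar> < 4" "tw ?a ?b = (if j = 0 then 1 else -1)"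
    using tw_angle_index[OF a b] by blast
  define m where "m = angle_index ?b - angle_index ?a + 8 * j"
  obtain ra where ra: "ra > 0" "dirc p q = of_real ra * cis (pi * of_int (angle_index ?a) / 4)"
    using angle_index_polar[OF a] by (auto simp: dirc_def)
  obtain rb where rb: "rb > 0" "dirc q r = of_real rb * cis (pi * of_int (angle_index ?b) / 4)"
    using angle_index_polar[OF b] by (auto simp: dirc_def)
  have cj: "cis (2 * pi * of_int j) = 1" by (rule cis_multiple_2pi) simp
  have "cis (pi * of_int m / 4) = cis (pi * of_int (angle_index ?b) / 4 - pi * of_int (angle_index ?a) / 4) * cis (2 * pi * of_int j)"
  proof -
    have "pi * of_int m / 4 = (pi * of_int (angle_index ?b) / 4 - pi * of_int (angle_index ?a) / 4) + 2 * pi * of_int j"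
      by (simp add: m_def field_simps)
    then show ?thesis by (simp only: cis_mult)
  qed
  then have div: "dirc q r / dirc p q = of_real (rb / ra) * cis (pi * of_int m / 4)"
    by (simp add: ra rb cj cis_divide[symmetric])
  have t: "turn p q r = pi * of_int m / 4"
    unfolding turn_def
  proof (rule cis_Arg_unique)
    show "sgn (dirc q r / dirc p q) = cis (pi * of_int m / 4)"
      unfolding div using ra rb by (simp add: sgn_mult sgn_of_real sgn_eq[of "cis _"])
    have m4: "-4 < m" "m < 4" using j(2) by (auto simp: m_def)
    have "pi * of_int m < pi * 4" "pi * (-4) < pi * of_int m"
      using m4 by (intro mult_strict_left_mono; simp; linarith?)+
    then show "- pi < pi * of_int m / 4" "pi * of_int m / 4 \<le> pi" by auto
  qed
  have "exp (\<i> * complex_of_real (turn p q r / 2)) = cis (pi * of_int m / 8)"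
    unfolding t by (simp add: cis_conv_exp)
  also have "\<dots> = cis (pi * of_int (angle_index ?b) / 8 - pi * of_int (angle_index ?a) / 8) * cis (pi * of_int j)"
    by (simp add: m_def cis_mult ring_distribs diff_divide_distrib add_divide_distrib)
  also have "cis (pi * of_int j) = complex_of_real (tw ?a ?b)"
    using j(1,3) by (auto simp: complex_eq_iff)
  finally show ?thesis by (simp add: cis_divide[symmetric] mult.commute)
qed

text \<open>Reversing all directions replaces the cut ray by the opposite one. The two rays together
  form a line, so the discrepancy records whether the turn changes sides, and it cancels around a
  closed path.\<close>

lemma tw_reverse:
  assumes "a \<in> axis2 \<union> diag" "b \<in> axis2 \<union> diag" "a + b \<noteq> 0"
  shows "tw (- b) (- a) = tw a b * (if right_of_cut a \<noteq> right_of_cut b then - 1 else 1)"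
  using assms unfolding axis2_def diag_def Un_iff insert_iff empty_iff
  by (elim disjE FalseE; simp add: tw_def right_of_cut_def zero_prod_def)

section \<open>The added arc and the signs of closed paths\<close>

definition arc_point :: "vertex \<Rightarrow> vertex \<Rightarrow> vertex list \<Rightarrow> nat \<Rightarrow> vertex" where
  "arc_point u v \<gamma> i = (emb u # \<gamma> @ [emb v]) ! i"

text \<open>Loops before the choice of the lexicographically smallest representative; unlike
  \<open>loops_r\<close> this set is closed under rotation and reversal.\<close>

definition pre_loops :: "vertex \<Rightarrow> vertex \<Rightarrow> vertex list \<Rightarrow> nat \<Rightarrow> vertex list set" where
  "pre_loops u v \<gamma> r = {l. Defs.closed_path u v \<gamma> l \<and>
     card {i. i < length l \<and> {cyc l i, cyc l (i + 1)} = {emb u, hd \<gamma>}} = 1 \<and>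
     card {i. i < length l \<and> Zedge (cyc l i) (cyc l (i + 1))} = r}"

text \<open>The form of \<open>loop_weight\<close> in which the half-angle phases are replaced by
  signs: the square roots of the directions cancel around a closed path and the multiplicity is
  1.\<close>

definition real_weight :: "real \<Rightarrow> vertex \<Rightarrow> vertex \<Rightarrow> vertex list \<Rightarrow> vertex list \<Rightarrow> real" where
  "real_weight \<beta> u v \<gamma> l =
     - (\<Prod>i\<in>{0..<int (length l)}. tw (zc l (i+1) - zc l i) (zc l (i+2) - zc l (i+1))) *
     (\<Prod>i\<in>{0..<int (length l)}. xw \<beta> u v \<gamma> (zc l i) (zc l (i+1)))"

lemma cyc_zc: "cyc l i = zc l (int i)" "cyc l (i+1) = zc l (int i + 1)" "cyc l (i+2) = zc l (int i + 2)"
  by (simp_all add: zc_cyc[symmetric] add.commute)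

lemma all_cyc:
  assumes l: "l \<noteq> []"
  shows "(\<forall>i<length l. Q (cyc l i) (cyc l (i+1)) (cyc l (i+2))) \<longleftrightarrow> (\<forall>i. Q (zc l i) (zc l (i+1)) (zc l (i+2)))"
proof
  assume h: "\<forall>i<length l. Q (cyc l i) (cyc l (i+1)) (cyc l (i+2))"
  show "\<forall>i. Q (zc l i) (zc l (i+1)) (zc l (i+2))"
  proof
    fix i
    let ?N = "int (length l)"
    define k where "k = nat (i mod ?N)"
    have k: "k < length l" "int k = i mod ?N" using l by (auto simp: k_def nat_less_iff)
    have "zc l (int k) = zc l i" "zc l (int k + 1) = zc l (i + 1)" "zc l (int k + 2) = zc l (i + 2)"
      unfolding k(2) by (rule zc_cong; simp add: mod_simps)+
    then show "Q (zc l i) (zc l (i+1)) (zc l (i+2))" using h k(1) unfolding cyc_zc(2,3) unfolding cyc_zc(1) by metis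
  qed
next
  assume "\<forall>i. Q (zc l i) (zc l (i+1)) (zc l (i+2))"
  then show "\<forall>i<length l. Q (cyc l i) (cyc l (i+1)) (cyc l (i+2))"
    unfolding cyc_zc(2,3) unfolding cyc_zc(1) by blast
qed

lemma closed_path_zc:
  "Defs.closed_path u v \<gamma> l \<longleftrightarrow> l \<noteq> [] \<and> (\<forall>i. adj u v \<gamma> (zc l i) (zc l (i+1)) \<and> zc l (i+2) \<noteq> zc l i)"
proof (cases "l = []")
  case False
  show ?thesis unfolding Defs.closed_path_def
    using all_cyc[OF False, of "\<lambda>a b c. adj u v \<gamma> a b \<and> c \<noteq> a"] False by simp
qed (simp add: Defs.closed_path_def)

lemma card_cyc_edges:
  "card {i. i < length l \<and> Q (cyc l i) (cyc l (i+1))} = card {i \<in> {0..<int (length l)}. Q (zc l i) (zc l (i+1))}"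
  unfolding cyc_zc(2) unfolding cyc_zc(1) by (rule card_cyc)

lemma Egam_sym: "Egam u v \<gamma> q p = Egam u v \<gamma> p q"
  by (simp add: Egam_def insert_commute)

lemma Zedge_sym: "Zedge q p = Zedge p q"
  by (auto simp: Zedge_def nn2_def abs_minus_commute)

lemma adj_sym: "adj u v \<gamma> q p = adj u v \<gamma> p q"
  by (simp add: adj_def Egam_sym[of u v \<gamma> q p] Zedge_sym[of q p])

lemma xw_sym: "xw \<beta> u v \<gamma> q p = xw \<beta> u v \<gamma> p q"
  by (simp add: xw_def crosses_gamma_def Egam_sym[of u v \<gamma> q p] Zedge_sym[of q p] add.commute)

lemma pre_loops_zc:
  "l \<in> pre_loops u v \<gamma> r \<longleftrightarrow> Defs.closed_path u v \<gamma> l \<and>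
     card {i \<in> {0..<int (length l)}. {zc l i, zc l (i+1)} = {emb u, hd \<gamma>}} = 1 \<and>
     card {i \<in> {0..<int (length l)}. Zedge (zc l i) (zc l (i+1))} = r"
  using card_cyc_edges[of l "\<lambda>p q. {p, q} = {emb u, hd \<gamma>}"] card_cyc_edges[of l Zedge]
  by (simp add: pre_loops_def)

lemma pre_loops_equiv:
  assumes l: "l \<in> pre_loops u v \<gamma> r" and e: "cyc_equiv m l"
  shows "m \<in> pre_loops u v \<gamma> r"
proof -
  obtain s k where s: "s \<in> {1,-1}" and z: "\<And>i. zc m i = zc l (s * i + k)" and len: "length m = length l"
    using e unfolding cyc_equiv_def by blast
  have cl: "Defs.closed_path u v \<gamma> l" using l by (simp add: pre_loops_def)
  then have ne: "l \<noteq> []" and a: "\<And>i. adj u v \<gamma> (zc l i) (zc l (i+1))" and nb: "\<And>i. zc l (i+2) \<noteq> zc l i"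
    by (auto simp: closed_path_zc)
  have ne': "m \<noteq> []" using len ne by auto
  have N: "int (length l) > 0" using ne by simp
  have cl': "Defs.closed_path u v \<gamma> m"
    unfolding closed_path_zc
  proof (intro conjI allI ne')
    fix i
    show "adj u v \<gamma> (zc m i) (zc m (i+1))" "zc m (i+2) \<noteq> zc m i"
      using s a[of "i+k"] a[of "-i+k-1"] nb[of "i+k"] nb[of "-i+k-2"]
      by (auto simp: z adj_sym[of _ _ _ "zc l (k - i)"] algebra_simps)
  qed
  have c: "card {i \<in> {0..<int (length m)}. Q (zc m i) (zc m (i+1))} = card {i \<in> {0..<int (length l)}. Q (zc l i) (zc l (i+1))}"
    if sym: "\<And>p q. Q p q = Q q p" for Q
  proof -
    define R where "R i = Q (zc l i) (zc l (i+1))" for i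
    have per: "R (i mod int (length l)) = R i" for i
    proof -
      have "zc l (i mod int (length l) + 1) = zc l (i + 1)" by (rule zc_cong) (simp add: mod_simps)
      then show ?thesis by (simp add: R_def zc_mod)
    qed
    define k' where "k' = (if s = 1 then k else k - 1)"
    have "Q (zc m i) (zc m (i+1)) = R (s * i + k')" for i
      using s sym[of "zc l (k - i)" "zc l (k - (1 + i))"] by (auto simp: z R_def k'_def algebra_simps)
    then show ?thesis using card_periodic[OF N s, of R k'] per len by (simp add: R_def)
  qed
  show ?thesis
    using l cl' c[of "\<lambda>p q. {p, q} = {emb u, hd \<gamma>}", OF arg_cong[OF insert_commute]] c[of Zedge, OF Zedge_sym]
    unfolding pre_loops_zc by simp
qed

text \<open>A smaller period would carry the single passage through the edge at u to a second
  one.\<close>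

lemma pre_loops_mult:
  assumes l: "l \<in> pre_loops u v \<gamma> r" shows "Defs.mult l = 1"
proof -
  define N where "N = length l"
  define Q where "Q i \<longleftrightarrow> {cyc l i, cyc l (i + 1)} = {emb u, hd \<gamma>}" for i
  have cl: "Defs.closed_path u v \<gamma> l" and one: "card {i. i < N \<and> Q i} = 1"
    using l by (simp_all add: pre_loops_def Q_def N_def)
  then have N: "N > 0" by (auto simp: Defs.closed_path_def N_def)
  obtain i where i: "{i. i < N \<and> Q i} = {i}" using one card_1_singletonE by blast
  have "(LEAST p. 0 < p \<and> (\<forall>i<length l. cyc l (i + p) = cyc l i)) = N"
  proof (rule Least_equality)
    show "0 < N \<and> (\<forall>i<length l. cyc l (i + N) = cyc l i)" using N by (simp add: cyc_def N_def)
    fix p assume p: "0 < p \<and> (\<forall>i<length l. cyc l (i + p) = cyc l i)"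
    show "N \<le> p"
    proof (rule ccontr)
      assume "\<not> N \<le> p"
      have per: "cyc l (j + p) = cyc l j" for j
      proof -
        have "cyc l (j + p) = cyc l (j mod N + p)" by (simp add: cyc_def N_def mod_simps)
        also have "\<dots> = cyc l (j mod N)" using p N by (simp add: N_def)
        finally show ?thesis by (simp add: cyc_def N_def)
      qed
      have c: "cyc l (j mod N) = cyc l j" "cyc l (j mod N + 1) = cyc l (j + 1)" for j
        by (simp_all add: cyc_def N_def mod_simps)
      have "i < N" "Q i" using i by auto
      have "Q (i + p)" using \<open>Q i\<close> per[of i] per[of "i+1"] by (simp add: Q_def add_ac)
      then have "Q ((i + p) mod N)" by (simp only: Q_def c)
      then have "(i + p) mod N \<in> {i. i < N \<and> Q i}" using N by simp
      then have "(i + p) mod N = i" unfolding i by simp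
      then show False using \<open>i < N\<close> p \<open>\<not> N \<le> p\<close>
        by (cases "i + p < N") (auto simp: mod_if split: if_splits)
    qed
  qed
  then show ?thesis using N by (simp add: Defs.mult_def N_def)
qed

lemma prod_split_at: "(\<Prod>i<a+b. f i) = (\<Prod>i<a. f i) * (\<Prod>i<b. f (a + i :: nat) :: real)"
  by (induction b) (simp_all add: mult.assoc)

lemma emb_diff: "emb p - emb q = emb (p - q)"
  by (simp add: emb_def prod_eq_iff)

lemma tw_emb: "tw a (emb d) = tw a d" "tw (emb d) a = tw d a"
proof -
  have "fst a * snd (emb d) - snd a * fst (emb d) = 2 * (fst a * snd d - snd a * fst d)"
    "fst (emb d) * snd a - snd (emb d) * fst a = 2 * (fst d * snd a - snd d * fst a)"
    by (simp_all add: emb_def)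
  moreover have "right_of_cut (emb d) = right_of_cut d" by (simp add: right_of_cut_def emb_def)
  ultimately show "tw a (emb d) = tw a d" "tw (emb d) a = tw d a" unfolding tw_def by auto
qed

lemma Zedge_emb: "q - p \<in> dirs \<Longrightarrow> Zedge (emb p) (emb q)"
  by (cases p; cases q) (auto simp: Zedge_def primal_def emb_def nn2_def dirs_def)

text \<open>The walk runs from v to u; its last vertex is dropped because the closed path already
  starts at \<open>emb u\<close>.\<close>

definition loop_of :: "vertex \<Rightarrow> vertex list \<Rightarrow> vertex list \<Rightarrow> vertex list" where
  "loop_of u \<gamma> xs = emb u # \<gamma> @ map emb (butlast xs)"

lemma emb_primal [simp]: "primal (emb p)" by (simp add: primal_def emb_def)

lemma primal_not_dual: "primal p \<Longrightarrow> \<not> dual p" by (simp add: primal_def dual_def)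

lemma emb_inj: "emb p = emb q \<Longrightarrow> p = q" by (cases p; cases q) (simp add: emb_def)

lemma steps_neg: "d \<in> axis2 \<union> diag \<Longrightarrow> - d \<in> axis2 \<union> diag"
  by (auto simp: axis2_def diag_def)

lemma Zedge_step:
  assumes "Zedge p q" shows "q - p \<in> axis2"
proof -
  obtain a b where p: "p = (2*a,2*b)" using assms by (cases p) (auto simp: Zedge_def primal_def elim!: evenE)
  obtain c d where q: "q = (2*c,2*d)" using assms by (cases q) (auto simp: Zedge_def primal_def elim!: evenE)
  have "\<bar>a - c\<bar> + \<bar>b - d\<bar> = 1" using assms by (auto simp: Zedge_def nn2_def p q)
  then have "c = a + 1 \<and> d = b \<or> c = a - 1 \<and> d = b \<or> c = a \<and> d = b + 1 \<or> c = a \<and> d = b - 1" by linarith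
  then show ?thesis by (auto simp: p q axis2_def)
qed

definition arc_turning :: "vertex \<Rightarrow> vertex \<Rightarrow> vertex list \<Rightarrow> real" where
  "arc_turning u v \<gamma> = (\<Prod>i<length \<gamma>. tw (arc_point u v \<gamma> (Suc i) - arc_point u v \<gamma> i)
     (arc_point u v \<gamma> (Suc (Suc i)) - arc_point u v \<gamma> (Suc i)))"

context
  fixes u v us vs :: "vertex" and \<gamma> :: "vertex list" and A :: "nat \<Rightarrow> vertex" and m :: nat
  assumes uv: "u \<noteq> v" and u: "dual_nbr u us" and v: "dual_nbr v vs" and \<gamma>: "dual_saw \<gamma> us vs"
  defines "A \<equiv> arc_point u v \<gamma>" and "m \<equiv> length \<gamma>"
begin

lemma gamma_facts: "\<gamma> \<noteq> []" "hd \<gamma> = us" "last \<gamma> = vs" "distinct \<gamma>" "p \<in> set \<gamma> \<Longrightarrow> dual p"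
  "Suc i < m \<Longrightarrow> nn2 (\<gamma> ! i) (\<gamma> ! Suc i)"
  using \<gamma> by (auto simp: dual_saw_def m_def)

lemma arc_simps: "A 0 = emb u" "i < m \<Longrightarrow> A (Suc i) = \<gamma> ! i"
  "A (Suc (m)) = emb v" "A 1 = us" "A (m) = vs"
proof -
  show "A 0 = emb u" "A (Suc (m)) = emb v" by (simp_all add: arc_point_def A_def m_def nth_append)
  show S: "A (Suc i) = \<gamma> ! i" if "i < m" for i using that by (simp add: arc_point_def A_def m_def nth_append)
  have n0: "m > 0" using gamma_facts(1) by (simp add: m_def)
  show "A 1 = us" using S[OF n0] gamma_facts(1,2) by (simp add: hd_conv_nth)
  show "A (m) = vs" using S[of "m - 1"] n0 gamma_facts(1,3) by (simp add: last_conv_nth m_def)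
qed

lemma arc_dual: "1 \<le> i \<Longrightarrow> i \<le> m \<Longrightarrow> dual (A i)"
  using arc_simps(2)[of "i - 1"] gamma_facts(5)[of "\<gamma> ! (i-1)"] by (simp add: m_def)

lemma dual_us: "dual us" "dual vs"
  using gamma_facts(5)[of us] gamma_facts(5)[of vs] gamma_facts(1-3) by (metis list.set_sel(1), metis last_in_set)

lemma arc_inj:
  assumes "i \<le> Suc (m)" "j \<le> Suc (m)" "A i = A j"
  shows "i = j"
proof -
  have key: "i = j" if ij: "i \<le> j" "j \<le> Suc (m)" "A i = A j" for i j
  proof (rule ccontr)
    assume ne: "i \<noteq> j"
    consider "i = 0" "j = Suc (m)" | "i = 0" "1 \<le> j" "j \<le> m" | "1 \<le> i" "i \<le> m" "j = Suc (m)"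
      | "1 \<le> i" "1 \<le> j" "i \<le> m" "j \<le> m" using ij(1,2) ne by linarith
    then show False
    proof cases
      case 1 then show ?thesis using ij(3) emb_inj uv arc_simps(1,3) by metis
    next
      case 2 then show ?thesis using ij(3) arc_dual[of j] arc_simps(1) primal_not_dual emb_primal by metis
    next
      case 3 then show ?thesis using ij(3) arc_dual[of i] arc_simps(3) primal_not_dual emb_primal by metis
    next
      case 4
      then have lt: "i - 1 < m" "j - 1 < m" and S: "Suc (i - 1) = i" "Suc (j - 1) = j" by auto
      have "\<gamma> ! (i - 1) = \<gamma> ! (j - 1)" using ij(3) arc_simps(2)[OF lt(1)] arc_simps(2)[OF lt(2)] unfolding S by simp
      then have "i - 1 = j - 1" using nth_eq_iff_index_eq[OF gamma_facts(4) lt[unfolded m_def]] by simp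
      then show ?thesis using ne S by simp
    qed
  qed
  show ?thesis using key[of i j] key[of j i] assms by (cases "i \<le> j") auto
qed

lemma Egam_arc: "Egam u v \<gamma> p q \<longleftrightarrow> (\<exists>i\<le>m. {p, q} = {A i, A (Suc i)})"
proof
  assume "Egam u v \<gamma> p q"
  then consider "{p, q} = {emb u, us}" | "{p, q} = {emb v, vs}" | i where "Suc i < m" "{p, q} = {\<gamma> ! i, \<gamma> ! Suc i}"
    unfolding Egam_def gamma_facts(2,3) m_def by blast
  then show "\<exists>i\<le>m. {p, q} = {A i, A (Suc i)}"
  proof cases
    case 1 then show ?thesis using arc_simps(1,4) by (intro exI[of _ 0]) simp
  next
    case 2 then show ?thesis using arc_simps(3,5) by (intro exI[of _ "m"]) (simp add: insert_commute)
  next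
    case (3 i) then show ?thesis using arc_simps(2)[of i] arc_simps(2)[of "Suc i"] by (intro exI[of _ "Suc i"]) simp
  qed
next
  assume "\<exists>i\<le>m. {p, q} = {A i, A (Suc i)}"
  then obtain i where i: "i \<le> m" "{p, q} = {A i, A (Suc i)}" by blast
  consider "i = 0" | "i = m" | "1 \<le> i" "i < m" using i(1) by linarith
  then show "Egam u v \<gamma> p q"
  proof cases
    case 1 then show ?thesis using i(2) arc_simps(1,4) by (simp add: Egam_def gamma_facts(2))
  next
    case 2 then show ?thesis using i(2) arc_simps(3,5) by (simp add: Egam_def gamma_facts(3) insert_commute)
  next
    case 3 then show ?thesis using i(2) arc_simps(2)[of i] arc_simps(2)[of "i-1"]
      unfolding Egam_def m_def[symmetric] by (intro disjI2 exI[of _ "i-1"]) simp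
  qed
qed

lemma arc_step: "i \<le> m \<Longrightarrow> A (Suc i) - A i \<in> axis2 \<union> diag"
proof -
  assume i: "i \<le> m"
  consider "i = 0" | "i = m" | "1 \<le> i" "i < m" using i by linarith
  then show ?thesis
  proof cases
    case 1
    have "us - emb u \<in> diag" using u
      by (cases us; cases u) (auto simp: dual_nbr_def emb_def diag_def abs_if split: if_splits)
    then show ?thesis using 1 arc_simps(1,4) by simp
  next
    case 2
    have "emb v - vs \<in> diag" using v
      by (cases vs; cases v) (auto simp: dual_nbr_def emb_def diag_def abs_if split: if_splits)
    then show ?thesis using 2 arc_simps(3,5) by simp
  next
    case 3
    have nn: "nn2 (A i) (A (Suc i))"
      using gamma_facts(6)[of "i-1"] arc_simps(2)[of i] arc_simps(2)[of "i-1"] 3 by simp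
    have "dual (A i)" "dual (A (Suc i))" using arc_dual 3 by auto
    then have "A (Suc i) - A i \<in> axis2"
      using nn by (rule dual_step_cases) (auto simp: axis2_def)
    then show ?thesis by simp
  qed
qed

lemma adj_step: "adj u v \<gamma> p q \<Longrightarrow> q - p \<in> axis2 \<union> diag"
  unfolding adj_def
proof (elim disjE)
  assume "Zedge p q" then show ?thesis using Zedge_step by auto
next
  assume "Egam u v \<gamma> p q"
  then obtain i where i: "i \<le> m" "{p, q} = {A i, A (Suc i)}" unfolding Egam_arc by blast
  then have "q - p = A (Suc i) - A i \<or> q - p = - (A (Suc i) - A i)"
    by (auto simp: doubleton_eq_iff)
  then show ?thesis using arc_step[OF i(1)] steps_neg by metis
qed

lemma arc_parity:
  assumes i: "i \<le> Suc m"
  shows "even (fst (A i)) \<longleftrightarrow> i = 0 \<or> i = Suc m" "even (snd (A i)) \<longleftrightarrow> i = 0 \<or> i = Suc m"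
proof -
  consider "i = 0" | "i = Suc m" | "1 \<le> i" "i \<le> m" using i by linarith
  then show "even (fst (A i)) \<longleftrightarrow> i = 0 \<or> i = Suc m" "even (snd (A i)) \<longleftrightarrow> i = 0 \<or> i = Suc m"
    by (cases; use arc_dual[of i] in \<open>auto simp: arc_simps(1,3) emb_def dual_def\<close>)+
qed

text \<open>By Hopf's theorem the turning is that of the secants from u, which follow the crossings
  of gamma above u, times that of the secants to v, which follow the crossings above v. The
  remaining factor depends on u, v, us and vs only.\<close>

lemma arc_turning_winding:
  "arc_turning u v \<gamma> = path_cross u \<gamma> * path_cross v \<gamma> *
    (tw (vs - emb u) (emb v - emb u) * tw (emb v - emb u) (emb v - us) *
     (if (fst us > 2 * fst v) \<noteq> (fst vs > 2 * fst v) then -1 else 1))"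
proof -
  have H: "(\<Prod>i<m. tw (A (Suc i) - A i) (A (Suc (Suc i)) - A (Suc i))) =
    (\<Prod>j<m. tw (A (Suc j) - A 0) (A (Suc (Suc j)) - A 0)) *
    (\<Prod>i<m. tw (A (Suc m) - A i) (A (Suc m) - A (Suc i)))"
  proof (rule discrete_hopf)
    show "A (Suc i) - A i \<in> axis2 \<union> diag" if "i \<le> m" for i by (rule arc_step[OF that])
    show "A i \<noteq> A j" if "i < j" "j \<le> Suc m" for i j using arc_inj[of i j] that by auto
    show "even (fst (A j - A i)) = even (snd (A j - A i))" if "i < j" "j \<le> Suc m" for i j
      using arc_parity[of i] arc_parity[of j] that by simp
    \<comment> \<open>The two end segments of the arc are diagonal, so an axis step starts at a dual
      vertex; then A i and A j both have odd coordinates.\<close>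
    show "even (fst (A j - A i))" if ij: "i < j" "j \<le> m" "A (Suc i) - A i \<in> axis2" for i j
    proof -
      have "even (fst d)" if "d \<in> axis2" for d using that by (auto simp: axis2_def)
      from this[OF ij(3)] have "even (fst (A (Suc i) - A i))" .
      then show ?thesis using arc_parity(1)[of i] arc_parity(1)[of "Suc i"] arc_parity(1)[of j] ij by auto
    qed
  qed
  obtain k where k: "m = Suc k" using gamma_facts(1) by (cases m) (auto simp: m_def)
  have step: "dual (A (Suc i))" "dual (A (Suc (Suc i)))" "nn2 (A (Suc i)) (A (Suc (Suc i)))" if "i < k" for i
    using that arc_dual[of "Suc i"] arc_dual[of "Suc (Suc i)"] gamma_facts(6)[of i] arc_simps(2)[of i] arc_simps(2)[of "Suc i"]
    by (auto simp: k)
  have A1: "A (Suc 0) = us" using arc_simps(4) by simp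
  have first: "(\<Prod>j<m. tw (A (Suc j) - A 0) (A (Suc (Suc j)) - A 0)) = path_cross u \<gamma> * tw (vs - emb u) (emb v - emb u)"
  proof -
    have "(\<Prod>j<k. tw (A (Suc j) - A 0) (A (Suc (Suc j)) - A 0)) = path_cross u \<gamma>"
      unfolding path_cross_def m_def[symmetric] k diff_Suc_1 arc_simps(1)
      by (intro prod.cong refl) (use tw_from_vertex(1)[OF step] in \<open>simp add: arc_simps(2) k\<close>)
    then show ?thesis using arc_simps(3,5) by (simp add: k arc_simps(1))
  qed
  \<comment> \<open>The additional factors for secants pointing to v record the changes of side of
    the column of v and telescope to the two ends of gamma.\<close>
  define sd where "sd i = (fst (A (Suc i)) > 2 * fst v)" for i
  have tele: "(\<Prod>i<l. (if sd i \<noteq> sd (Suc i) then -1 else 1 :: real)) = (if sd 0 \<noteq> sd l then -1 else 1)" for l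
    by (induction l) auto
  have second: "(\<Prod>i<m. tw (A (Suc m) - A i) (A (Suc m) - A (Suc i))) =
    tw (emb v - emb u) (emb v - us) * (path_cross v \<gamma> * (if sd 0 \<noteq> sd k then -1 else 1))"
  proof -
    have "(\<Prod>i<k. tw (emb v - A (Suc i)) (emb v - A (Suc (Suc i)))) =
      (\<Prod>i<k. up_cross v (A (Suc i)) (A (Suc (Suc i))) * (if sd i \<noteq> sd (Suc i) then -1 else 1))"
      unfolding sd_def by (intro prod.cong refl tw_from_vertex(2) step) auto
    also have "\<dots> = path_cross v \<gamma> * (if sd 0 \<noteq> sd k then -1 else 1)"
      unfolding prod.distrib tele path_cross_def m_def[symmetric] k diff_Suc_1
      by (intro arg_cong2[where f="(*)"] prod.cong refl) (simp add: arc_simps(2) k)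
    finally show ?thesis
      unfolding k prod.lessThan_Suc_shift by (simp add: k[symmetric] arc_simps(1,3) A1)
  qed
  have "sd 0 = (fst us > 2 * fst v)" "sd k = (fst vs > 2 * fst v)"
    using A1 arc_simps(5) by (simp_all add: sd_def k)
  then show ?thesis
    unfolding arc_turning_def A_def[symmetric] m_def[symmetric] H first second by (simp add: mult_ac)
qed

text \<open>The crossing factors cancel those contained in \<open>arc_turning\<close>, so the right
  side no longer depends on gamma and a comparison of the relative positions of u, v, us and vs
  remains. The minus sign matches the one in \<open>loop_sgn\<close>.\<close>

lemma side_sign_arc_turning:
  shows "side_sign v (dual_idx vs) u (fst (dual_idx us)) = - arc_turning u v \<gamma> * path_cross u \<gamma> * path_cross v \<gamma>"
proof -
  have pc: "path_cross w \<gamma> * path_cross w \<gamma> = 1" for w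
    unfolding path_cross_def prod.distrib[symmetric] by (rule prod.neutral) (simp add: up_cross_def)
  obtain a b where ab: "u = (a,b)" by (cases u)
  obtain X Y where "v = (a+X,b+Y)" by (cases v) (metis add_diff_cancel_left' diff_add_cancel add.commute)
  note ab = ab this
  obtain e1 e2 where e: "us = (2*a+e1,2*b+e2)" "e1 = 1 \<or> e1 = -1" "e2 = 1 \<or> e2 = -1"
    using u by (cases us) (auto simp: dual_nbr_def ab abs_if split: if_splits intro: that[of "_ - 2*a" "_ - 2*b"])
  obtain f1 f2 where f: "vs = (2*(a+X)+f1,2*(b+Y)+f2)" "f1 = 1 \<or> f1 = -1" "f2 = 1 \<or> f2 = -1"
    using v by (cases vs) (auto simp: dual_nbr_def ab abs_if split: if_splits intro: that[of "_ - 2*(a+X)" "_ - 2*(b+Y)"])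
  have XY: "X < 0 \<or> X = 0 \<or> X > 0" "Y < 0 \<or> Y = 0 \<or> Y > 0" by linarith+
  have XY0: "X = 0 \<Longrightarrow> Y \<noteq> 0" using uv by (auto simp: ab)
  have du: "dual_idx us = (a + (if e1 = 1 then 0 else -1), b + (if e2 = 1 then 0 else -1))"
    using e(2,3) by (elim disjE; simp add: e(1) dual_idx_def)
  have dv: "dual_idx vs = (a + X + (if f1 = 1 then 0 else -1), b + Y + (if f2 = 1 then 0 else -1))"
    using f(2,3) by (elim disjE; simp add: f(1) dual_idx_def)
  have T1: "tw (vs - emb u) (emb v - emb u) = (if X = 0 \<and> f1 = 1 \<and> Y > 0 then -1 else 1)"
  proof -
    have d: "vs - emb u = (2 * X + f1, 2 * Y + f2)" "emb v - emb u = (2 * X, 2 * Y)"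
      by (simp_all add: ab f(1) emb_def)
    show ?thesis unfolding d using f(2) XY(1)
      by (elim disjE; simp add: tw_def right_of_cut_def; linarith?)
  qed
  have T2: "tw (emb v - emb u) (emb v - us) = (if X = 0 \<and> e1 = -1 \<and> Y > 0 then -1 else 1)"
  proof -
    have d: "emb v - us = (2 * X - e1, 2 * Y - e2)" "emb v - emb u = (2 * X, 2 * Y)"
      by (simp_all add: ab e(1) emb_def)
    show ?thesis unfolding d using e(2) XY(1)
      by (elim disjE; simp add: tw_def right_of_cut_def; linarith?)
  qed
  have T3: "(fst us > 2 * fst v) = (e1 > 2 * X)" "(fst vs > 2 * fst v) = (f1 = 1)"
    using f(2) by (auto simp: ab e(1) f(1))
  have K: "side_sign v (dual_idx vs) u (fst (dual_idx us)) =
    (if (a \<le> a + X + (if f1 = 1 then 0 else -1)) \<noteq> (f1 = 1) \<or>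
       X = 0 \<and> e1 = f1 \<and> b > b + Y + (if f2 = 1 then 0 else -1) then -1 else 1)"
    using e(2) f(2) unfolding side_sign_def du dv ab by auto
  have "side_sign v (dual_idx vs) u (fst (dual_idx us)) = - (tw (vs - emb u) (emb v - emb u) * tw (emb v - emb u) (emb v - us) *
     (if (fst us > 2 * fst v) \<noteq> (fst vs > 2 * fst v) then -1 else 1))"
    unfolding K T1 T2 T3 using XY(1)
  proof (elim disjE)
    assume "X = 0"
    with XY0 XY(2) have "X = 0" "Y < 0 \<or> Y > 0" by auto
    then show "(if (a \<le> a + X + (if f1 = 1 then 0 else -1)) \<noteq> (f1 = 1) \<or>
       X = 0 \<and> e1 = f1 \<and> b > b + Y + (if f2 = 1 then 0 else -1) then -1 else 1 :: real) =
      - ((if X = 0 \<and> f1 = 1 \<and> Y > 0 then -1 else 1) * (if X = 0 \<and> e1 = -1 \<and> Y > 0 then -1 else 1) *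
       (if (e1 > 2 * X) \<noteq> (f1 = 1) then -1 else 1))"
      using e(2) f(2,3) by (elim disjE; simp)
  qed (use e(2) f(2) in \<open>(elim disjE; simp)+\<close>)
  then show ?thesis
    unfolding arc_turning_winding using pc by (simp add: mult_ac)
qed

text \<open>Around a closed path the quotients h (i + 1) / h i multiply to 1, and only the signs
  \<open>tw\<close> survive.\<close>

lemma loop_weight_real:
  assumes l: "l \<in> pre_loops u v \<gamma> r"
  shows "loop_weight \<beta> u v \<gamma> l = complex_of_real (real_weight \<beta> u v \<gamma> l)"
proof -
  have cl: "Defs.closed_path u v \<gamma> l" using l by (simp add: pre_loops_def)
  then have ne: "l \<noteq> []" and a: "\<And>i. adj u v \<gamma> (zc l i) (zc l (i+1))" and nb: "\<And>i. zc l (i+2) \<noteq> zc l i"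
    by (auto simp: closed_path_zc)
  have N: "int (length l) > 0" using ne by simp
  let ?I = "{0..<int (length l)}"
  define D where "D i = zc l (i+1) - zc l i" for i
  define h where "h i = cis (pi * of_int (angle_index (D i)) / 8)" for i
  have st: "D i \<in> axis2 \<union> diag" for i using adj_step[OF a[of i]] by (simp add: D_def)
  have ex: "exp (\<i> * complex_of_real (turn (zc l i) (zc l (i+1)) (zc l (i+2)) / 2)) = complex_of_real (tw (D i) (D (i+1))) * (h (i+1) / h i)" for i
    using exp_turn[of "zc l (i+1)" "zc l i" "zc l (i+2)"] st[of i] st[of "i+1"] nb[of i] by (simp add: D_def h_def add.assoc)
  have hper: "h (i mod int (length l)) = h i" for i
  proof -
    have "zc l (i mod int (length l) + 1) = zc l (i + 1)" by (rule zc_cong) (simp add: mod_simps)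
    then show ?thesis by (simp add: h_def D_def zc_mod)
  qed
  have hprod: "(\<Prod>i\<in>?I. h (i+1)) = (\<Prod>i\<in>?I. h i)"
    using prod.reindex_bij_betw[OF periodic_bij[OF N, of 1 1], of h] by (simp add: hper)
  have hne: "(\<Prod>i\<in>?I. h i) \<noteq> 0" by (simp add: h_def)
  have "winding l = (\<Sum>i<length l. turn (zc l (int i)) (zc l (int i + 1)) (zc l (int i + 2)))"
    unfolding winding_def cyc_zc(2,3) unfolding cyc_zc(1) by simp
  also have "\<dots> = (\<Sum>i\<in>?I. turn (zc l i) (zc l (i+1)) (zc l (i+2)))"
  proof -
    have "?I = int ` {..<length l}" using image_int_atLeastLessThan[of 0 "length l"] by (simp add: lessThan_atLeast0)
    then show ?thesis by (simp add: sum.reindex)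
  qed
  finally have "exp (\<i> * complex_of_real (winding l / 2)) =
      (\<Prod>i\<in>?I. exp (\<i> * complex_of_real (turn (zc l i) (zc l (i+1)) (zc l (i+2)) / 2)))"
    by (simp add: exp_sum[symmetric] sum_distrib_left sum_divide_distrib)
  also have "\<dots> = complex_of_real (\<Prod>i\<in>?I. tw (D i) (D (i+1)))"
    unfolding ex prod.distrib prod_dividef hprod using hne by simp
  finally have sg: "loop_sgn l = - complex_of_real (\<Prod>i\<in>?I. tw (D i) (D (i+1)))" by (simp add: loop_sgn_def)
  have "(\<Prod>i<length l. xw \<beta> u v \<gamma> (cyc l i) (cyc l (i+1))) = (\<Prod>i\<in>?I. xw \<beta> u v \<gamma> (zc l i) (zc l (i+1)))"
    unfolding cyc_zc(2) unfolding cyc_zc(1) by (rule prod_cyc)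
  then show ?thesis
    unfolding loop_weight_def sg real_weight_def pre_loops_mult[OF l] by (simp add: D_def add.assoc)
qed

text \<open>Rotation permutes the factors. Under reversal the turn at j acquires the factor \<rho> j
  times \<rho> (j + 1) from \<open>tw_reverse\<close>, and every \<rho> occurs twice around the
  loop.\<close>

lemma real_weight_equiv:
  assumes l: "Defs.closed_path u v \<gamma> l" and e: "cyc_equiv l' l"
  shows "real_weight \<beta> u v \<gamma> l' = real_weight \<beta> u v \<gamma> l"
proof -
  obtain s k where s: "s \<in> {1,-1}" and z: "\<And>i. zc l' i = zc l (s * i + k)" and len: "length l' = length l"
    using e unfolding cyc_equiv_def by blast
  have ne: "l \<noteq> []" and a: "\<And>i. adj u v \<gamma> (zc l i) (zc l (i+1))" and nb: "\<And>i. zc l (i+2) \<noteq> zc l i"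
    using l by (auto simp: closed_path_zc)
  have N: "int (length l) > 0" using ne by simp
  let ?I = "{0..<int (length l)}"
  define D where "D i = zc l (i+1) - zc l i" for i
  have st: "D i \<in> axis2 \<union> diag" for i using adj_step[OF a[of i]] by (simp add: D_def)
  have nz: "D i + D (i+1) \<noteq> 0" for i using nb[of i] by (simp add: D_def add.assoc)
  define T where "T i = tw (D i) (D (i+1))" for i
  define X where "X i = xw \<beta> u v \<gamma> (zc l i) (zc l (i+1))" for i
  have z1: "zc l (i mod int (length l) + c) = zc l (i + c)" for i c by (rule zc_cong) (simp add: mod_simps)
  have per: "D (i mod int (length l) + c) = D (i + c)" for i c
    using z1[of i c] z1[of i "c+1"] by (simp add: D_def add.assoc)
  have Tper: "T (i mod int (length l)) = T i" and Xper: "X (i mod int (length l)) = X i" for i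
    using per[of i 0] per[of i 1] z1[of i 0] z1[of i 1] by (simp_all add: T_def X_def)
  have rl: "real_weight \<beta> u v \<gamma> l = - (\<Prod>i\<in>?I. T i) * (\<Prod>i\<in>?I. X i)"
    by (simp add: real_weight_def T_def X_def D_def add.assoc)
  show ?thesis
  proof (cases "s = 1")
    case True
    have "real_weight \<beta> u v \<gamma> l' = - (\<Prod>i\<in>?I. T (s * i + k)) * (\<Prod>i\<in>?I. X (s * i + k))"
      unfolding real_weight_def len z T_def X_def D_def True by (simp add: add_ac)
    then show ?thesis
      unfolding rl using prod_periodic[OF N s, of T k] prod_periodic[OF N s, of X k] Tper Xper by simp
  next
    case False
    then have s1: "s = -1" using s by simp
    define \<rho> where "\<rho> i = (if right_of_cut (D i) then 1 else - 1 :: real)" for i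
    have \<rho>per: "\<rho> (i mod int (length l)) = \<rho> i" for i using per[of i 0] by (simp add: \<rho>_def)
    have rev: "tw (- D (j+1)) (- D j) = T j * (\<rho> j * \<rho> (j+1))" for j
      unfolding T_def tw_reverse[OF st[of j] st[of "j+1"] nz] by (simp add: \<rho>_def)
    have "(\<Prod>i\<in>?I. \<rho> (i+1)) = (\<Prod>i\<in>?I. \<rho> i)"
      using prod_periodic[OF N, of 1 \<rho> 1] \<rho>per by simp
    moreover have "(\<Prod>i\<in>?I. \<rho> i) * (\<Prod>i\<in>?I. \<rho> i) = 1"
      unfolding prod.distrib[symmetric] by (rule prod.neutral) (simp add: \<rho>_def)
    ultimately have \<rho>1: "(\<Prod>i\<in>?I. \<rho> i * \<rho> (i+1)) = 1" by (simp add: prod.distrib)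
    have TR: "tw (zc l' (i+1) - zc l' i) (zc l' (i+2) - zc l' (i+1)) = tw (- D (s * i + (k - 2) + 1)) (- D (s * i + (k - 2)))" for i
      unfolding z D_def s1 by (simp add: algebra_simps)
    define Y where "Y j = tw (- D (j+1)) (- D j)" for j
    have Yper: "Y (i mod int (length l)) = Y i" for i using per[of i 0] per[of i 1] by (simp add: Y_def)
    have "(\<Prod>i\<in>?I. tw (zc l' (i+1) - zc l' i) (zc l' (i+2) - zc l' (i+1))) = (\<Prod>i\<in>?I. Y (s * i + (k - 2)))"
      unfolding TR Y_def by simp
    also have "\<dots> = (\<Prod>i\<in>?I. Y i)" by (rule prod_periodic[OF N s]) (rule Yper)
    also have "\<dots> = (\<Prod>i\<in>?I. T i)" unfolding Y_def rev prod.distrib[of T] \<rho>1 by simp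
    finally have A: "(\<Prod>i\<in>?I. tw (zc l' (i+1) - zc l' i) (zc l' (i+2) - zc l' (i+1))) = (\<Prod>i\<in>?I. T i)" .
    have "xw \<beta> u v \<gamma> (zc l' i) (zc l' (i+1)) = X (s * i + (k - 1))" for i
      unfolding z X_def s1 by (subst xw_sym) (simp add: algebra_simps)
    then have B: "(\<Prod>i\<in>?I. xw \<beta> u v \<gamma> (zc l' i) (zc l' (i+1))) = (\<Prod>i\<in>?I. X i)"
      using prod_periodic[OF N s, of X "k - 1"] Xper by simp
    show ?thesis unfolding rl unfolding real_weight_def len A B ..
  qed
qed

section \<open>Closed paths through the edge at u and walks from v to u\<close>

lemma path_length_pos: "m > 0" using gamma_facts(1) by (simp add: m_def)

text \<open>Inner vertices of the arc have no other neighbours, so a non-backtracking path that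
  enters the arc has to follow it to its end.\<close>

lemma adj_arc_point:
  assumes i: "1 \<le> i" "i \<le> m" and a: "adj u v \<gamma> (A i) q"
  shows "q = A (i - 1) \<or> q = A (Suc i)"
proof -
  have "\<not> Zedge (A i) q" using arc_dual[OF i] primal_not_dual unfolding Zedge_def by blast
  then obtain k where k: "k \<le> m" "{A i, q} = {A k, A (Suc k)}" using a unfolding adj_def Egam_arc by blast
  then consider "A i = A k" "q = A (Suc k)" | "A i = A (Suc k)" "q = A k" by (auto simp: doubleton_eq_iff)
  then show ?thesis
  proof cases
    case 1 then have "i = k" using arc_inj[of i k] i k(1) by simp
    then show ?thesis using 1 by simp
  next
    case 2 then have "i = Suc k" using arc_inj[of i "Suc k"] i k(1) by simp
    then show ?thesis using 2 by simp
  qed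
qed

lemma adj_primal:
  assumes p: "primal p" and a: "adj u v \<gamma> p q"
  shows "Zedge p q \<or> p = emb u \<and> q = us \<or> p = emb v \<and> q = vs"
proof (rule ccontr)
  assume n: "\<not> ?thesis"
  then obtain k where k: "k \<le> m" "{p, q} = {A k, A (Suc k)}" using a unfolding adj_def Egam_arc by blast
  then consider "p = A k" "q = A (Suc k)" | "p = A (Suc k)" "q = A k" by (auto simp: doubleton_eq_iff)
  then show False
  proof cases
    case 1
    then have "k = 0" using arc_dual[of k] k(1) p primal_not_dual by fastforce
    then show False using 1 n arc_simps(1,4) by simp
  next
    case 2
    then have "k = m" using arc_dual[of "Suc k"] k(1) p primal_not_dual by fastforce
    then show False using 2 n arc_simps(3,5) by simp
  qed
qed

lemma loop_of_zc:
  assumes xs: "xs \<in> walks n v u"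
  shows "length (loop_of u \<gamma> xs) = m + n + 2"
    and "i \<le> Suc m \<Longrightarrow> zc (loop_of u \<gamma> xs) (int i) = A i"
    and "j \<le> n + 1 \<Longrightarrow> zc (loop_of u \<gamma> xs) (int (Suc m + j)) = emb (xs ! j)"
    and "zc (loop_of u \<gamma> xs) (int (m + n + 3)) = us"
proof -
  have len: "length xs = n + 2" and x0: "xs ! 0 = v" and xl: "xs ! (n + 1) = u" using xs by (auto simp: walks_def)
  show L: "length (loop_of u \<gamma> xs) = m + n + 2" using len by (simp add: loop_of_def m_def)
  have nth: "zc (loop_of u \<gamma> xs) (int i) = loop_of u \<gamma> xs ! i" if "i < m + n + 2" for i
    using that L by (simp add: zc_nth)
  have c: "zc (loop_of u \<gamma> xs) (int (Suc m + j)) = emb (xs ! j)" if "j \<le> n" for j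
  proof -
    have "zc (loop_of u \<gamma> xs) (int (Suc m + j)) = loop_of u \<gamma> xs ! (Suc m + j)" using that by (intro nth) simp
    also have "\<dots> = emb (xs ! j)" using that len by (simp add: loop_of_def nth_append nth_butlast m_def)
    finally show ?thesis .
  qed
  have b: "zc (loop_of u \<gamma> xs) (int i) = A i" if "i \<le> m" for i
  proof -
    have "zc (loop_of u \<gamma> xs) (int i) = loop_of u \<gamma> xs ! i" using that by (intro nth) simp
    also have "\<dots> = A i" using that by (cases i) (simp_all add: loop_of_def arc_point_def nth_append A_def m_def)
    finally show ?thesis .
  qed
  show "zc (loop_of u \<gamma> xs) (int i) = A i" if "i \<le> Suc m"
  proof (cases "i = Suc m")
    case True then show ?thesis using c[of 0] x0 arc_simps(3) by simp
  next
    case False then show ?thesis using b that by simp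
  qed
  have shift: "zc (loop_of u \<gamma> xs) (int (m + n + 2 + k)) = zc (loop_of u \<gamma> xs) (int k)" for k
  proof (rule zc_cong)
    have "int (m + n + 2 + k) = int k + int (length (loop_of u \<gamma> xs))" by (simp add: L)
    then show "int (m + n + 2 + k) mod int (length (loop_of u \<gamma> xs)) = int k mod int (length (loop_of u \<gamma> xs))"
      by (simp only: mod_add_self2)
  qed
  show "zc (loop_of u \<gamma> xs) (int (Suc m + j)) = emb (xs ! j)" if "j \<le> n + 1"
  proof (cases "j = n + 1")
    case True
    then have "Suc m + j = m + n + 2 + 0" by simp
    then show ?thesis using shift[of 0] b[of 0] arc_simps(1) xl True by simp
  next
    case False then show ?thesis using c that by simp
  qed
  have "zc (loop_of u \<gamma> xs) (int (m + n + 2 + 1)) = us"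
    unfolding shift using b[of 1] arc_simps(4) path_length_pos by simp
  moreover have "m + n + 2 + 1 = m + n + 3" by simp
  ultimately show "zc (loop_of u \<gamma> xs) (int (m + n + 3)) = us" by (simp only:)
qed

lemma loop_of_pre_loops:
  assumes xs: "xs \<in> walks n v u" shows "loop_of u \<gamma> xs \<in> pre_loops u v \<gamma> (Suc n)"
proof -
  let ?l = "loop_of u \<gamma> xs"
  note L = loop_of_zc(1)[OF xs] and Z1 = loop_of_zc(2)[OF xs] and Z2 = loop_of_zc(3)[OF xs] and Z3 = loop_of_zc(4)[OF xs]
  have st: "\<And>i. i < n + 1 \<Longrightarrow> xs ! Suc i - xs ! i \<in> dirs" and nb: "\<And>i. i < n \<Longrightarrow> xs ! (i + 2) \<noteq> xs ! i"
    using xs by (auto simp: walks_def)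
  have late: "\<exists>j. i = Suc m + j \<and> j \<le> n" if "m < i" "i < m + n + 2" for i
    using that by (intro exI[of _ "i - Suc m"]) auto
  have lo: "cyc ?l i = A i" "cyc ?l (i+1) = A (Suc i)" if "i \<le> m" for i
    using Z1[of i] Z1[of "Suc i"] that by (simp_all add: zc_cyc[symmetric])
  have hi: "cyc ?l (Suc m + j) = emb (xs ! j)" "cyc ?l (Suc m + j + 1) = emb (xs ! Suc j)" if "j \<le> n" for j
    using Z2[of j] Z2[of "Suc j"] that by (simp_all add: zc_cyc[symmetric])
  have ad: "adj u v \<gamma> (cyc ?l i) (cyc ?l (i+1))" if i: "i < m + n + 2" for i
  proof (cases "i \<le> m")
    case True
    then have "Egam u v \<gamma> (A i) (A (Suc i))" unfolding Egam_arc by blast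
    then show ?thesis unfolding lo[OF True] adj_def by simp
  next
    case False
    then obtain j where "i = Suc m + j" "j \<le> n" using late[of i] i by (meson not_le)
    then show ?thesis using hi[of j] Zedge_emb[OF st[of j]] by (simp add: adj_def)
  qed
  have ndual: "dual p \<Longrightarrow> p \<noteq> emb q" for p q using primal_not_dual emb_primal by metis
  have nbk: "cyc ?l (i+2) \<noteq> cyc ?l i" if i: "i < m + n + 2" for i
  proof -
    have "i < m \<or> i = m \<or> (\<exists>j. i = Suc m + j \<and> j < n) \<or> i = Suc m + n"
    proof (cases "i \<le> m")
      case False
      then obtain j where "i = Suc m + j" "j \<le> n" using late[of i] i by (meson not_le)
      then show ?thesis by (cases "j = n") auto
    qed auto
    then consider "i < m" | "i = m" | j where "i = Suc m + j" "j < n" | "i = Suc m + n" by blast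
    then show ?thesis
    proof cases
      case 1
      have "cyc ?l (i+2) = A (i+2)" using Z1[of "i+2"] 1 by (simp add: zc_cyc[symmetric])
      then show ?thesis using lo(1)[of i] arc_inj[of "i+2" i] 1 by auto
    next
      case 2
      have "cyc ?l (i+2) = emb (xs ! 1)" using hi(2)[of 0] 2 by simp
      then show ?thesis using lo(1)[of i] 2 arc_simps(5) ndual[OF dual_us(2), of "xs ! 1"] by auto
    next
      case (3 j)
      have "cyc ?l (i+2) = emb (xs ! (j+2))" using hi(2)[of "Suc j"] 3 by simp
      then show ?thesis using hi(1)[of j] 3 nb[of j] emb_inj by (metis less_imp_le)
    next
      case 4
      have "cyc ?l (i+2) = us" using Z3 4 by (simp add: zc_cyc[symmetric] add_ac)
      then show ?thesis using hi(1)[of n] 4 ndual[OF dual_us(1), of "xs ! n"] by auto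
    qed
  qed
  have "Defs.closed_path u v \<gamma> ?l"
    unfolding Defs.closed_path_def L using ad nbk by (auto simp: loop_of_def)
  moreover have "{i. i < length ?l \<and> {cyc ?l i, cyc ?l (i + 1)} = {emb u, hd \<gamma>}} = {0}"
  proof (intro set_eqI iffI)
    fix i assume "i \<in> {i. i < length ?l \<and> {cyc ?l i, cyc ?l (i + 1)} = {emb u, hd \<gamma>}}"
    then have i: "i < m + n + 2" and e: "{cyc ?l i, cyc ?l (i + 1)} = {emb u, us}" by (auto simp: L gamma_facts(2))
    show "i \<in> {0}"
    proof (cases "i \<le> m")
      case True
      then have "{A i, A (Suc i)} = {A 0, A 1}" using e arc_simps(1,4) unfolding lo[OF True] by simp
      then have "A i = A 0 \<or> A (Suc i) = A 0" by (auto simp: doubleton_eq_iff)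
      then show ?thesis using arc_inj[of i 0] arc_inj[of "Suc i" 0] True by auto
    next
      case False
      then obtain j where "i = Suc m + j" "j \<le> n" using late[of i] i by (meson not_le)
      then show ?thesis using e hi[of j] ndual[OF dual_us(1), of "xs ! j"] ndual[OF dual_us(1), of "xs ! Suc j"]
        by (auto simp: doubleton_eq_iff)
    qed
  next
    fix i :: nat assume "i \<in> {0}"
    then show "i \<in> {i. i < length ?l \<and> {cyc ?l i, cyc ?l (i + 1)} = {emb u, hd \<gamma>}}"
      using lo[of 0] arc_simps(1,4) by (simp add: L gamma_facts(2))
  qed
  moreover have "{i. i < length ?l \<and> Zedge (cyc ?l i) (cyc ?l (i + 1))} = {Suc m..<m + n + 2}"
  proof (intro set_eqI iffI)
    fix i assume i: "i \<in> {i. i < length ?l \<and> Zedge (cyc ?l i) (cyc ?l (i + 1))}"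
    have "\<not> i \<le> m"
    proof
      assume m: "i \<le> m"
      then have "dual (A i) \<or> dual (A (Suc i))" using arc_dual[of i] arc_dual[of "Suc i"] path_length_pos by (cases i) auto
      then show False using i lo[OF m] primal_not_dual by (auto simp: Zedge_def)
    qed
    then show "i \<in> {Suc m..<m + n + 2}" using i by (simp add: L)
  next
    fix i assume "i \<in> {Suc m..<m + n + 2}"
    then obtain j where "i = Suc m + j" "j \<le> n" using late[of i] by (metis atLeastLessThan_iff Suc_le_eq)
    then show "i \<in> {i. i < length ?l \<and> Zedge (cyc ?l i) (cyc ?l (i + 1))}"
      using hi[of j] Zedge_emb[OF st[of j]] by (simp add: L)
  qed
  ultimately show ?thesis unfolding pre_loops_def by simp
qed

lemma pre_loops_crossing:
  assumes l: "l \<in> pre_loops u v \<gamma> r" and z: "zc l 0 = emb u" "zc l 1 = us"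
    and i: "{zc l i, zc l (i+1)} = {emb u, us}"
  shows "i mod int (length l) = 0"
proof -
  let ?N = "int (length l)"
  have N: "?N > 0" using l by (auto simp: pre_loops_def Defs.closed_path_def)
  have "card {i \<in> {0..<?N}. {zc l i, zc l (i+1)} = {emb u, us}} = 1" using l unfolding pre_loops_zc gamma_facts(2) by blast
  then obtain k where k: "{i \<in> {0..<?N}. {zc l i, zc l (i+1)} = {emb u, us}} = {k}" using card_1_singletonE by blast
  have "0 \<in> {i \<in> {0..<?N}. {zc l i, zc l (i+1)} = {emb u, us}}" using z N by simp
  then have "k = 0" unfolding k by simp
  moreover have "zc l (i mod ?N + 1) = zc l (i + 1)" by (rule zc_cong) (simp add: mod_simps)
  then have "i mod ?N \<in> {i \<in> {0..<?N}. {zc l i, zc l (i+1)} = {emb u, us}}" using i N by (simp add: zc_mod)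
  ultimately show ?thesis unfolding k by simp
qed

lemma us_neq: "emb u \<noteq> us" using primal_not_dual emb_primal dual_us by metis

text \<open>The unique passage through the edge at u pins the index map: a rotation must be trivial,
  and a reversal would traverse that edge in the opposite direction.\<close>

lemma loop_of_unique:
  assumes xs: "xs \<in> walks n v u" and ys: "ys \<in> walks n' v u" and e: "cyc_equiv (loop_of u \<gamma> xs) (loop_of u \<gamma> ys)"
  shows "xs = ys"
proof -
  let ?l = "loop_of u \<gamma> xs" and ?m = "loop_of u \<gamma> ys"
  obtain s k where s: "s \<in> {1,-1}" and z: "\<And>i. zc ?l i = zc ?m (s * i + k)" and len: "length ?l = length ?m"
    using e unfolding cyc_equiv_def by blast
  have zl: "zc ?l 0 = emb u" "zc ?l 1 = us" using loop_of_zc(2)[OF xs, of 0] loop_of_zc(2)[OF xs, of 1] arc_simps(1,4) by auto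
  have zm: "zc ?m 0 = emb u" "zc ?m 1 = us" using loop_of_zc(2)[OF ys, of 0] loop_of_zc(2)[OF ys, of 1] arc_simps(1,4) by auto
  note cr = pre_loops_crossing[OF loop_of_pre_loops[OF ys] zm]
  have "?l = ?m"
  proof (cases "s = 1")
    case True
    have "{zc ?m k, zc ?m (k+1)} = {emb u, us}" using zl z[of 0] z[of 1] True by (simp add: add.commute)
    then have "k mod int (length ?m) = 0" by (rule cr)
    show ?thesis
    proof (rule zc_ext[OF len])
      fix i
      have "(i + k) mod int (length ?m) = i mod int (length ?m)" using \<open>k mod int (length ?m) = 0\<close> by (simp add: mod_add_eq[symmetric])
      then show "zc ?l i = zc ?m i" unfolding z True using zc_cong[of "i + k" ?m i] by simp
    qed
  next
    case False
    then have s1: "s = -1" using s by simp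
    have a: "zc ?m k = emb u" "zc ?m (k - 1) = us" using zl z[of 0] z[of 1] s1 by simp_all
    then have "{zc ?m (k-1), zc ?m (k-1+1)} = {emb u, us}" by auto
    then have "(k - 1) mod int (length ?m) = 0" by (rule cr)
    then have "zc ?m (k - 1) = zc ?m 0" using zc_cong[of "k-1" ?m 0] by simp
    then show ?thesis using a zm us_neq by simp
  qed
  then have "map emb (butlast xs) = map emb (butlast ys)" by (simp add: loop_of_def)
  moreover have "inj emb" using emb_inj by (auto simp: inj_def)
  ultimately have b: "butlast xs = butlast ys" by simp
  have l: "length xs = n + 2" "length ys = n' + 2" "xs ! (n+1) = u" "ys ! (n'+1) = u" using xs ys by (auto simp: walks_def)
  have "xs \<noteq> []" "ys \<noteq> []" using l by auto
  then have "last xs = u" "last ys = u" using l by (auto simp: last_conv_nth)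
  then show ?thesis using b \<open>xs \<noteq> []\<close> \<open>ys \<noteq> []\<close> append_butlast_last_id by metis
qed

text \<open>From us the path is forced along the arc to v. Afterwards it cannot enter the arc again
  before closing up, since that would lead through the edge at u a second time; so all remaining
  steps are lattice edges and end at u.\<close>

lemma pre_loops_normal_form:
  assumes l: "l \<in> pre_loops u v \<gamma> (Suc n)" and z: "zc l 0 = emb u" "zc l 1 = us"
  shows "\<exists>xs\<in>walks n v u. l = loop_of u \<gamma> xs"
proof -
  define N where "N = length l"
  define Z where "Z i = zc l (int i)" for i
  have cl: "Defs.closed_path u v \<gamma> l" using l by (simp add: pre_loops_def)
  then have N0: "N > 0" by (simp add: Defs.closed_path_def N_def)
  have ad: "adj u v \<gamma> (Z i) (Z (Suc i))" and nb: "Z (Suc (Suc i)) \<noteq> Z i" for i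
    using cl unfolding closed_path_zc Z_def by (auto simp: add.commute[of 1] add.commute[of 2])
  have per: "Z (i + N) = Z i" for i unfolding Z_def N_def by (rule zc_cong) simp
  have Z01: "Z 0 = A 0" "Z 1 = A 1" "Z N = Z 0" using z arc_simps(1,4) per[of 0] by (simp_all add: Z_def)
  have cross: "N dvd i" if "{Z i, Z (Suc i)} = {emb u, us}" for i
    using pre_loops_crossing[OF l z, of "int i"] that
    by (simp add: Z_def N_def add.commute mod_eq_0_iff_dvd zmod_int[symmetric])
  have Zs: "Z j = A j \<and> Z (Suc j) = A (Suc j)" if "j \<le> m" for j
    using that
  proof (induction j)
    case (Suc j)
    then have IH: "Z j = A j" "Z (Suc j) = A (Suc j)" by auto
    have "Z (Suc (Suc j)) = A (Suc j - 1) \<or> Z (Suc (Suc j)) = A (Suc (Suc j))"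
      using adj_arc_point[of "Suc j"] Suc.prems ad[of "Suc j"] unfolding IH(2) by auto
    then show ?case using nb[of j] IH by auto
  qed (use Z01 in auto)
  then have ZA: "Z j = A j" if "j \<le> Suc m" for j using that by (cases j) auto
  have Nm: "Suc m < N"
  proof (rule ccontr)
    assume "\<not> Suc m < N"
    then have "A N = A 0" using ZA[of N] Z01 by simp
    then show False using arc_inj[of N 0] N0 \<open>\<not> Suc m < N\<close> by simp
  qed
  \<comment> \<open>Entering the arc at v forces the path back to us and then u, through the edge at
    u in the direction opposite to the first passage.\<close>
  have down: False if j: "Z j = emb v" "Z (Suc j) = vs" for j
  proof -
    have "Z (j + t) = A (Suc m - t) \<and> Z (Suc (j + t)) = A (m - t)" if "t \<le> m" for t
      using that
    proof (induction t)
      case 0 then show ?case using j arc_simps(3,5) by simp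
    next
      case (Suc t)
      then have IH: "Z (j + t) = A (Suc m - t)" "Z (Suc (j + t)) = A (m - t)" by auto
      have "Z (Suc (Suc (j + t))) = A (m - t - 1) \<or> Z (Suc (Suc (j + t))) = A (Suc (m - t))"
        using adj_arc_point[of "m - t"] Suc.prems ad[of "Suc (j + t)"] unfolding IH(2) by auto
      moreover have "Suc (m - t) = Suc m - t" using Suc.prems by simp
      ultimately have "Z (Suc (Suc (j + t))) = A (m - t - 1)" using nb[of "j+t"] IH(1) by auto
      then show ?case using IH(2) by simp
    qed
    from this[of m] have e: "Z (j + m) = us" "Z (Suc (j + m)) = emb u" using arc_simps(1,4) by auto
    then have "N dvd j + m" using cross[of "j + m"] by auto
    then obtain q where "j + m = N * q" by (elim dvdE)
    moreover have "Z (N * q) = Z 0" for q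
    proof (induction q)
      case (Suc q) then show ?case using per[of "N * q"] by (simp add: add.commute)
    qed simp
    ultimately show False using e(1) Z01(1) arc_simps(1) us_neq by simp
  qed
  have step: "primal (Z j) \<Longrightarrow> Zedge (Z j) (Z (Suc j))" if "Suc m \<le> j" "j < N" for j
  proof -
    assume p: "primal (Z j)"
    consider "Zedge (Z j) (Z (Suc j))" | "Z j = emb u" "Z (Suc j) = us" | "Z j = emb v" "Z (Suc j) = vs"
      using adj_primal[OF p ad] by blast
    then show ?thesis
    proof cases
      case 2
      then have "N dvd j" using cross[of j] by simp
      then show ?thesis using that by (auto dest: dvd_imp_le)
    qed (use down in blast)+
  qed
  have prim: "primal (Z (Suc m + k))" if "Suc m + k \<le> N" for k
    using that
  proof (induction k)
    case 0 then show ?case using ZA[of "Suc m"] arc_simps(3) emb_primal by simp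
  next
    case (Suc k)
    then have "Zedge (Z (Suc m + k)) (Z (Suc (Suc m + k)))" by (intro step) auto
    then show ?case by (simp add: Zedge_def)
  qed
  have Zed: "Zedge (Z j) (Z (Suc j))" if "Suc m \<le> j" "j < N" for j
    using step[OF that] prim[of "j - Suc m"] that by simp
  have NZed: "\<not> Zedge (Z j) (Z (Suc j))" if "j \<le> m" for j
  proof
    assume "Zedge (Z j) (Z (Suc j))"
    moreover have "dual (A j) \<or> dual (A (Suc j))" using arc_dual[of j] arc_dual[of "Suc j"] path_length_pos that by (cases j) auto
    ultimately show False using ZA[of j] ZA[of "Suc j"] that primal_not_dual by (auto simp: Zedge_def)
  qed
  have "{i. i < length l \<and> Zedge (cyc l i) (cyc l (i + 1))} = {Suc m..<N}"
  proof (intro set_eqI)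
    fix i
    show "i \<in> {i. i < length l \<and> Zedge (cyc l i) (cyc l (i + 1))} \<longleftrightarrow> i \<in> {Suc m..<N}"
      using Zed[of i] NZed[of i] by (cases "i \<le> m") (auto simp: zc_cyc[symmetric] Z_def N_def add.commute)
  qed
  then have "N - Suc m = Suc n" using l by (simp add: pre_loops_def)
  then have Neq: "N = m + n + 2" using Nm by simp
  define half :: "vertex \<Rightarrow> vertex" where "half p = (fst p div 2, snd p div 2)" for p
  have half: "emb (half p) = p" if "primal p" for p using that by (cases p) (simp add: half_def emb_def primal_def)
  have half': "half (emb p) = p" for p by (cases p) (simp add: half_def emb_def)
  define xs where "xs = map (\<lambda>i. half (Z (Suc m + i))) [0..<n+2]"
  have xs: "xs ! i = half (Z (Suc m + i))" if "i < n + 2" for i using that by (simp add: xs_def del: upt_Suc)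
  have exs: "emb (xs ! i) = Z (Suc m + i)" if "i < n + 2" for i
    using half[OF prim[of i]] xs[OF that] that Neq by simp
  have "xs \<in> walks n v u"
    unfolding walks_def
  proof (intro CollectI conjI allI impI)
    show "length xs = n + 2" by (simp add: xs_def)
    show "xs ! 0 = v" using xs[of 0] ZA[of "Suc m"] arc_simps(3) half' by simp
    show "xs ! (n + 1) = u" using xs[of "n+1"] Neq Z01 arc_simps(1) half' by (simp add: add_ac)
    fix i
    show "xs ! Suc i - xs ! i \<in> dirs" if "i < n + 1"
    proof -
      have "Zedge (emb (xs ! i)) (emb (xs ! Suc i))" using exs[of i] exs[of "Suc i"] Zed[of "Suc m + i"] that Neq by simp
      then have "emb (xs ! Suc i) - emb (xs ! i) \<in> axis2" by (rule Zedge_step)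
      then have "emb (xs ! Suc i - xs ! i) \<in> axis2" by (simp only: emb_diff)
      then show ?thesis by (cases "xs ! Suc i - xs ! i") (auto simp: axis2_def dirs_def emb_def)
    qed
    show "xs ! (i + 2) \<noteq> xs ! i" if "i < n"
      using exs[of i] exs[of "i+2"] nb[of "Suc m + i"] that by auto
  qed
  moreover have "l = loop_of u \<gamma> xs"
  proof (rule nth_equalityI)
    note L = loop_of_zc[OF \<open>xs \<in> walks n v u\<close>]
    show "length l = length (loop_of u \<gamma> xs)" using L(1) Neq by (simp add: N_def)
    fix i assume i: "i < length l"
    have "loop_of u \<gamma> xs ! i = zc (loop_of u \<gamma> xs) (int i)" "l ! i = Z i"
      using i L(1) Neq by (simp_all add: zc_nth Z_def N_def)
    moreover have "zc (loop_of u \<gamma> xs) (int i) = Z i"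
    proof (cases "i \<le> m")
      case True then show ?thesis using L(2)[of i] ZA[of i] by simp
    next
      case False
      then have "i = Suc m + (i - Suc m)" "i - Suc m < n + 2" using i Neq by (auto simp: N_def)
      then show ?thesis using L(3)[of "i - Suc m"] exs[of "i - Suc m"] by simp
    qed
    ultimately show "l ! i = loop_of u \<gamma> xs ! i" by simp
  qed
  ultimately show ?thesis by blast
qed

lemma pre_loops_loop_of:
  assumes l: "l \<in> pre_loops u v \<gamma> (Suc n)"
  shows "\<exists>xs\<in>walks n v u. cyc_equiv (loop_of u \<gamma> xs) l"
proof -
  have ne: "l \<noteq> []" using l by (auto simp: pre_loops_def Defs.closed_path_def)
  let ?N = "int (length l)"
  have N: "?N > 0" using ne by simp
  have "card {i \<in> {0..<?N}. {zc l i, zc l (i+1)} = {emb u, us}} = 1" using l unfolding pre_loops_zc gamma_facts(2) by blast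
  then obtain k where "{i \<in> {0..<?N}. {zc l i, zc l (i+1)} = {emb u, us}} = {k}" using card_1_singletonE by blast
  then have k: "0 \<le> k" "{zc l k, zc l (k+1)} = {emb u, us}" by auto
  then consider "zc l k = emb u" "zc l (k+1) = us" | "zc l k = us" "zc l (k+1) = emb u" by (auto simp: doubleton_eq_iff)
  then obtain l' where l': "cyc_equiv l' l" "zc l' 0 = emb u" "zc l' 1 = us"
  proof cases
    case 1
    have "zc (rotate (nat k) l) 0 = emb u" "zc (rotate (nat k) l) 1 = us"
      unfolding zc_rotate[OF ne] using 1 k(1) by (simp_all add: add.commute)
    then show ?thesis using that cyc_equiv_rotate by blast
  next
    case 2
    define j where "j = nat ((- 2 - k) mod ?N)"
    have j: "int j = (- 2 - k) mod ?N" using N by (simp add: j_def)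
    have ner: "rev l \<noteq> []" using ne by simp
    have zj: "zc (rotate j (rev l)) i = zc l (k + 1 - i)" for i
    proof -
      have "(- 1 - (i + int j)) mod ?N = ((- 1 - i) - (- 2 - k) mod ?N) mod ?N" unfolding j by (simp add: algebra_simps)
      also have "\<dots> = ((- 1 - i) - (- 2 - k)) mod ?N" by (rule mod_diff_right_eq)
      finally show ?thesis unfolding zc_rotate[OF ner] zc_rev[OF ne] by (intro zc_cong) (simp add: algebra_simps)
    qed
    have "cyc_equiv (rotate j (rev l)) l" using cyc_equiv_trans[OF cyc_equiv_rotate cyc_equiv_rev] .
    then show ?thesis using that[of "rotate j (rev l)"] 2 by (simp add: zj)
  qed
  have "l' \<in> pre_loops u v \<gamma> (Suc n)" by (rule pre_loops_equiv[OF l l'(1)])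
  then show ?thesis using pre_loops_normal_form[of l' n] l' by blast
qed

text \<open>The turns of the closed path split into those inside the arc, the turn at v, those of
  the walk and the turn at u. The edges of the arc have weight 1; for those of the walk
  \<open>gamma_sign_eq\<close> gives the signs, and its gauge factors telescope to v and u.\<close>

lemma real_weight_loop_of:
  assumes xs: "xs \<in> walks n v u"
  shows "real_weight \<beta> u v \<gamma> (loop_of u \<gamma> xs) =
    - arc_turning u v \<gamma> * path_cross u \<gamma> * path_cross v \<gamma> *
      (tw (u - xs ! n) (us - emb u) *
       walk_weight (step_weight UNIV (tanh \<beta>) (dual_idx us) (dual_idx vs)) (emb v - vs) n xs)"
proof -
  let ?l = "loop_of u \<gamma> xs"
  let ?W = "step_weight UNIV (tanh \<beta>) (dual_idx us) (dual_idx vs)"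
  note L = loop_of_zc[OF xs]
  have st: "\<And>i. i < n + 1 \<Longrightarrow> xs ! Suc i - xs ! i \<in> dirs" and x0: "xs ! 0 = v" and xl: "xs ! Suc n = u"
    using xs by (auto simp: walks_def)
  have ints: "int i + 1 = int (Suc i)" "int i + 2 = int (Suc (Suc i))" for i by auto
  have len: "length ?l = (m + Suc n) + 1" using L(1) by simp
  define g where "g i = tw (zc ?l (int (Suc i)) - zc ?l (int i)) (zc ?l (int (Suc (Suc i))) - zc ?l (int (Suc i)))" for i
  have Zx: "zc ?l (int (Suc (m + j))) = emb (xs ! j)" if "j \<le> n + 1" for j using L(3)[OF that] by simp
  have g1: "(\<Prod>i<m. g i) = arc_turning u v \<gamma>"
    unfolding arc_turning_def A_def[symmetric] m_def[symmetric]
    by (intro prod.cong refl) (simp only: g_def L(2) lessThan_iff Suc_leI le_SucI less_imp_le_nat)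
  have g2: "g m = tw (emb v - vs) (xs ! 1 - xs ! 0)"
    using L(2)[of m] Zx[of 0] Zx[of 1] arc_simps(5) x0 by (simp add: g_def emb_diff tw_emb)
  have g3: "g (Suc m + j) = tw (xs ! Suc j - xs ! j) (xs ! (j+2) - xs ! Suc j)" if "j < n" for j
    using Zx[of j] Zx[of "Suc j"] Zx[of "j+2"] that by (simp add: g_def emb_diff tw_emb)
  have g4: "g (Suc m + n) = tw (u - xs ! n) (us - emb u)"
    using Zx[of n] Zx[of "Suc n"] L(4) xl by (simp add: g_def emb_diff tw_emb numeral_3_eq_3)
  have "(\<Prod>i\<in>{0..<int (length ?l)}. tw (zc ?l (i+1) - zc ?l i) (zc ?l (i+2) - zc ?l (i+1))) = (\<Prod>i<length ?l. g i)"
    unfolding prod_cyc[symmetric] g_def ints ..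
  also have "\<dots> = (\<Prod>i<Suc m + Suc n. g i)" using len by simp
  also have "\<dots> = ((\<Prod>i<m. g i) * g m) * ((\<Prod>j<n. g (Suc m + j)) * g (Suc m + n))"
    unfolding prod_split_at by simp
  also have "\<dots> = arc_turning u v \<gamma> * tw (emb v - vs) (xs ! 1 - xs ! 0) *
      ((\<Prod>j<n. tw (xs ! Suc j - xs ! j) (xs ! (j+2) - xs ! Suc j)) * tw (u - xs ! n) (us - emb u))"
    unfolding g1 g2 g4 using g3 by simp
  finally have T: "(\<Prod>i\<in>{0..<int (length ?l)}. tw (zc ?l (i+1) - zc ?l i) (zc ?l (i+2) - zc ?l (i+1))) =
     arc_turning u v \<gamma> * tw (emb v - vs) (xs ! 1 - xs ! 0) *
      ((\<Prod>j<n. tw (xs ! Suc j - xs ! j) (xs ! (j+2) - xs ! Suc j)) * tw (u - xs ! n) (us - emb u))" .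
  define h where "h i = xw \<beta> u v \<gamma> (zc ?l (int i)) (zc ?l (int (Suc i)))" for i
  have h1: "h i = 1" if "i < Suc m" for i
  proof -
    have "Egam u v \<gamma> (A i) (A (Suc i))" unfolding Egam_arc using that by (intro exI[of _ i]) simp
    then show ?thesis using L(2)[of i] L(2)[of "Suc i"] that by (simp add: h_def xw_def)
  qed
  have h2: "h (Suc m + j) = ?W (xs ! j) (xs ! Suc j) * (path_cross (xs ! j) \<gamma> * path_cross (xs ! Suc j) \<gamma>)" if j: "j < Suc n" for j
  proof -
    have ze: "Zedge (emb (xs ! j)) (emb (xs ! Suc j))" using Zedge_emb st[of j] j by simp
    have "\<not> Egam u v \<gamma> (emb (xs ! j)) (emb (xs ! Suc j))"
    proof
      assume "Egam u v \<gamma> (emb (xs ! j)) (emb (xs ! Suc j))"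
      then obtain k where k: "k \<le> m" "{emb (xs ! j), emb (xs ! Suc j)} = {A k, A (Suc k)}" unfolding Egam_arc by blast
      have "dual (A k) \<or> dual (A (Suc k))" using arc_dual[of k] arc_dual[of "Suc k"] path_length_pos k(1) by (cases k) auto
      then have "dual (emb (xs ! j)) \<or> dual (emb (xs ! Suc j))" using k(2) by (auto simp: doubleton_eq_iff)
      then show False using emb_primal primal_not_dual by blast
    qed
    then have "xw \<beta> u v \<gamma> (emb (xs ! j)) (emb (xs ! Suc j)) = tanh \<beta> * gamma_sign \<gamma> (xs ! j) (xs ! Suc j)"
      using ze by (simp add: xw_def gamma_sign_def)
    then show ?thesis
      using Zx[of j] Zx[of "Suc j"] j gamma_sign_eq[OF \<gamma> st[of j]] by (simp add: h_def step_weight_def mult.assoc)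
  qed
  have pc2: "path_cross p \<gamma> * path_cross p \<gamma> = 1" for p
    unfolding path_cross_def prod.distrib[symmetric] by (rule prod.neutral) (simp add: up_cross_def)
  have tele: "(\<Prod>j<k. path_cross (xs ! j) \<gamma> * path_cross (xs ! Suc j) \<gamma>) = path_cross (xs ! 0) \<gamma> * path_cross (xs ! k) \<gamma>" for k
  proof (induction k)
    case (Suc k)
    have "a * b * (b * c) = a * (b * b) * c" for a b c :: real by (simp add: mult_ac)
    then show ?case using Suc pc2 by simp
  qed (simp add: pc2)
  have "(\<Prod>i\<in>{0..<int (length ?l)}. xw \<beta> u v \<gamma> (zc ?l i) (zc ?l (i+1))) = (\<Prod>i<length ?l. h i)"
    unfolding prod_cyc[symmetric] h_def ints ..
  also have "\<dots> = (\<Prod>i<Suc m + Suc n. h i)" using len by simp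
  also have "\<dots> = (\<Prod>j<Suc n. ?W (xs ! j) (xs ! Suc j) * (path_cross (xs ! j) \<gamma> * path_cross (xs ! Suc j) \<gamma>))"
    unfolding prod_split_at using h1 h2 by (simp del: prod.lessThan_Suc)
  also have "\<dots> = (\<Prod>j<n+1. ?W (xs ! j) (xs ! Suc j)) * (path_cross v \<gamma> * path_cross u \<gamma>)"
    unfolding prod.distrib[of "\<lambda>j. ?W (xs ! j) (xs ! Suc j)"] tele x0 xl by simp
  finally have X: "(\<Prod>i\<in>{0..<int (length ?l)}. xw \<beta> u v \<gamma> (zc ?l i) (zc ?l (i+1))) =
     (\<Prod>j<n+1. ?W (xs ! j) (xs ! Suc j)) * (path_cross v \<gamma> * path_cross u \<gamma>)" .
  show ?thesis unfolding real_weight_def T X walk_weight_def by (simp add: mult_ac)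
qed

end

section \<open>Lexicographic representatives\<close>

lemma vless_total: "vless p q \<or> p = q \<or> vless q p"
  by (cases p; cases q) (auto simp: vless_def)

lemma lex_le_total: "lex_le xs ys \<or> lex_le ys xs"
  using lexord_linear[of "{(p, q). vless p q}" xs ys] vless_total by (auto simp: lex_le_def)

lemma lex_le_trans: "lex_le xs ys \<Longrightarrow> lex_le ys zs \<Longrightarrow> lex_le xs zs"
proof -
  have "trans {(p, q). vless p q}" by (auto simp: trans_def vless_def)
  then show "lex_le xs ys \<Longrightarrow> lex_le ys zs \<Longrightarrow> lex_le xs zs"
    unfolding lex_le_def using lexord_trans by blast
qed

lemma lex_le_antisym: "lex_le xs ys \<Longrightarrow> lex_le ys xs \<Longrightarrow> xs = ys"
proof -
  have "asym {(p, q). vless p q}" by (auto simp: asym_iff vless_def)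
  then have "asym (lexord {(p, q). vless p q})" by (rule lexord_asym)
  then show "lex_le xs ys \<Longrightarrow> lex_le ys xs \<Longrightarrow> xs = ys"
    unfolding lex_le_def asym_iff by blast
qed

lemma finite_lex_min:
  "finite S \<Longrightarrow> S \<noteq> {} \<Longrightarrow> \<exists>m\<in>S. \<forall>x\<in>S. lex_le m x"
proof (induction S rule: finite_ne_induct)
  case (singleton x) then show ?case by (simp add: lex_le_def)
next
  case (insert x S)
  then obtain m where m: "m \<in> S" "\<forall>y\<in>S. lex_le m y" by blast
  show ?case
  proof (cases "lex_le m x")
    case True then show ?thesis using m by blast
  next
    case False
    then have "lex_le x m" using lex_le_total by blast
    then have "\<forall>y\<in>insert x S. lex_le x y" using m lex_le_trans by (auto simp: lex_le_def[of x x])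
    then show ?thesis by blast
  qed
qed

text \<open>Rotations of l and of its reversal exhaust its class, so the lexicographic condition
  selects one canonical representative per class.\<close>

lemma loops_r_iff:
  "l \<in> loops_r u v \<gamma> r \<longleftrightarrow> l \<in> pre_loops u v \<gamma> r \<and> (\<forall>m. cyc_equiv m l \<longrightarrow> lex_le l m)"
proof -
  have "(\<forall>k<length l. lex_le l (rotate k l) \<and> lex_le l (rotate k (rev l))) \<longleftrightarrow> (\<forall>m. cyc_equiv m l \<longrightarrow> lex_le l m)"
    if "l \<noteq> []"
  proof (intro iffI allI impI)
    fix m assume "\<forall>k<length l. lex_le l (rotate k l) \<and> lex_le l (rotate k (rev l))" "cyc_equiv m l"
    then show "lex_le l m" using cyc_equiv_cases[OF _ that] by blast
  next
    fix k assume "\<forall>m. cyc_equiv m l \<longrightarrow> lex_le l m"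
    then show "lex_le l (rotate k l) \<and> lex_le l (rotate k (rev l))"
      using cyc_equiv_rotate[of k l] cyc_equiv_trans[OF cyc_equiv_rotate[of k "rev l"] cyc_equiv_rev] by blast
  qed
  then show ?thesis unfolding loops_r_def is_loop_def pre_loops_def Defs.closed_path_def by blast
qed

lemma ex_loops_r:
  assumes l: "l \<in> pre_loops u v \<gamma> r"
  shows "\<exists>m\<in>loops_r u v \<gamma> r. cyc_equiv m l"
proof -
  have ne: "l \<noteq> []" using l by (simp add: pre_loops_def Defs.closed_path_def)
  have "{m. cyc_equiv m l} \<subseteq> (\<lambda>k. rotate k l) ` {..<length l} \<union> (\<lambda>k. rotate k (rev l)) ` {..<length l}"
    using cyc_equiv_cases[OF _ ne] by fastforce
  then have "finite {m. cyc_equiv m l}" by (rule finite_subset) auto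
  then obtain m where m: "cyc_equiv m l" "\<forall>x. cyc_equiv x l \<longrightarrow> lex_le m x"
    using finite_lex_min[of "{m. cyc_equiv m l}"] cyc_equiv_refl[of l] by blast
  have "\<forall>x. cyc_equiv x m \<longrightarrow> lex_le m x" using m cyc_equiv_trans by blast
  then have "m \<in> loops_r u v \<gamma> r" using pre_loops_equiv[OF l m(1)] unfolding loops_r_iff by blast
  then show ?thesis using m(1) by blast
qed

lemma loops_r_unique:
  assumes "l \<in> loops_r u v \<gamma> r" "m \<in> loops_r u v \<gamma> r" "cyc_equiv l m"
  shows "l = m"
  using assms cyc_equiv_sym lex_le_antisym unfolding loops_r_iff by blast

text \<open>Every class of admissible closed paths contains one lexicographic representative and one
  path of the form \<open>loop_of\<close>, which matches the loops with n + 1 lattice steps with the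
  walks of n + 1 steps. The contribution of the arc is the same for all of them and equals
  \<open>side_sign\<close>.\<close>

theorem f_r_walk_sum:
  assumes uv: "u \<noteq> v" and u: "dual_nbr u us" and v: "dual_nbr v vs" and \<gamma>: "dual_saw \<gamma> us vs"
  shows "f_r \<beta> u v \<gamma> (Suc n) = complex_of_real (side_sign v (dual_idx vs) u (fst (dual_idx us)) *
    (\<Sum>d\<in>dirs. tw d (us - emb u) *
      walk_sum (step_weight UNIV (tanh \<beta>) (dual_idx us) (dual_idx vs)) v (emb v - vs) n u d))"
proof -
  note geom = uv u v \<gamma>
  let ?L = "loops_r u v \<gamma> (Suc n)" and ?lo = "loop_of u \<gamma>"
  have "f_r \<beta> u v \<gamma> (Suc n) = (\<Sum>l\<in>?L. complex_of_real (real_weight \<beta> u v \<gamma> l))"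
    unfolding f_r_def by (intro sum.cong refl loop_weight_real[OF geom, where r = "Suc n"]) (simp add: loops_r_iff)
  also have "\<dots> = (\<Sum>xs\<in>walks n v u. complex_of_real (real_weight \<beta> u v \<gamma> (?lo xs)))"
  proof (rule sum.reindex_bij_witness[where j = "\<lambda>l. SOME xs. xs \<in> walks n v u \<and> cyc_equiv (?lo xs) l"
        and i = "\<lambda>xs. SOME l. l \<in> ?L \<and> cyc_equiv l (?lo xs)"])
    fix l assume l: "l \<in> ?L"
    define ys where "ys = (SOME xs. xs \<in> walks n v u \<and> cyc_equiv (?lo xs) l)"
    have "\<exists>xs. xs \<in> walks n v u \<and> cyc_equiv (?lo xs) l"
      using pre_loops_loop_of[OF geom, of l n] l unfolding loops_r_iff by blast
    then have ys: "ys \<in> walks n v u" "cyc_equiv (?lo ys) l" unfolding ys_def by (metis (mono_tags, lifting) someI_ex)+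
    show "(SOME xs. xs \<in> walks n v u \<and> cyc_equiv (?lo xs) l) \<in> walks n v u" using ys by (simp add: ys_def)
    have "(SOME l'. l' \<in> ?L \<and> cyc_equiv l' (?lo ys)) = l"
      using l ys cyc_equiv_sym[OF ys(2)] loops_r_unique cyc_equiv_trans[OF _ ys(2)] by (intro some_equality) blast+
    then show "(SOME l'. l' \<in> ?L \<and> cyc_equiv l' (?lo (SOME xs. xs \<in> walks n v u \<and> cyc_equiv (?lo xs) l))) = l"
      by (simp add: ys_def)
    have "Defs.closed_path u v \<gamma> l" using l by (simp add: loops_r_def is_loop_def)
    then show "complex_of_real (real_weight \<beta> u v \<gamma> (?lo (SOME xs. xs \<in> walks n v u \<and> cyc_equiv (?lo xs) l))) =
      complex_of_real (real_weight \<beta> u v \<gamma> l)"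
      using real_weight_equiv[OF geom _ ys(2)] by (simp add: ys_def)
  next
    fix xs assume xs: "xs \<in> walks n v u"
    define l where "l = (SOME l. l \<in> ?L \<and> cyc_equiv l (?lo xs))"
    have "\<exists>l. l \<in> ?L \<and> cyc_equiv l (?lo xs)"
      using ex_loops_r[OF loop_of_pre_loops[OF geom xs]] by blast
    then have l: "l \<in> ?L" "cyc_equiv l (?lo xs)" unfolding l_def by (metis (mono_tags, lifting) someI_ex)+
    show "(SOME l. l \<in> ?L \<and> cyc_equiv l (?lo xs)) \<in> ?L" using l by (simp add: l_def)
    have "(SOME ys. ys \<in> walks n v u \<and> cyc_equiv (?lo ys) l) = xs"
      using xs l cyc_equiv_sym[OF l(2)] cyc_equiv_trans[OF _ l(2)] loop_of_unique[OF geom _ xs]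
      by (intro some_equality) blast+
    then show "(SOME ys. ys \<in> walks n v u \<and> cyc_equiv (?lo ys) (SOME l. l \<in> ?L \<and> cyc_equiv l (?lo xs))) = xs"
      by (simp add: l_def)
  qed
  also have "\<dots> = (\<Sum>xs\<in>walks n v u. complex_of_real (side_sign v (dual_idx vs) u (fst (dual_idx us)) *
      (tw (u - xs ! n) (us - emb u) *
       walk_weight (step_weight UNIV (tanh \<beta>) (dual_idx us) (dual_idx vs)) (emb v - vs) n xs)))"
    by (intro sum.cong refl) (simp add: real_weight_loop_of[OF geom] side_sign_arc_turning[OF geom])
  finally show ?thesis
    unfolding sum_walk_sum_walks by (simp add: sum_distrib_left)
qed

section \<open>Kramers-Wannier duality\<close>

lemma mem_rect: "(i,j) \<in> rect (a,b,c,d) \<longleftrightarrow> a \<le> i \<and> i \<le> b \<and> c \<le> j \<and> j \<le> d"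
  by (simp add: rect_def)

definition edge_sign :: "(vertex \<times> vertex) set \<Rightarrow> vertex \<times> vertex \<Rightarrow> real" where
  "edge_sign F e = (if e \<in> F then -1 else 1)"

text \<open>The parity of the degree of p in F, as a sign.\<close>

definition degree_sign :: "(vertex \<times> vertex) set \<Rightarrow> vertex \<Rightarrow> real" where
  "degree_sign F p = (\<Prod>e\<in>F. (if fst e = p then -1 else 1) * (if snd e = p then -1 else 1))"

text \<open>The low-temperature spin of a face whose contours are F: the parity of the edges of F
  met by the line going down from f to infinity.\<close>

definition face_spin :: "(vertex \<times> vertex) set \<Rightarrow> vertex \<Rightarrow> real" where
  "face_spin F f = (\<Prod>(p,q)\<in>F. column_sign f p q)"

definition even_sets :: "vertex set \<Rightarrow> (vertex \<times> vertex) set set" where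
  "even_sets V = {F. F \<subseteq> nn_edges V \<and> (\<forall>p\<in>V. degree_sign F p = 1)}"

lemma degree_sign_pm: "finite F \<Longrightarrow> degree_sign F p = 1 \<or> degree_sign F p = -1"
  unfolding degree_sign_def by (induction F rule: finite_induct) auto

lemma prod_spins_degree:
  assumes V: "finite V" and F: "F \<subseteq> nn_edges V" and \<sigma>: "\<sigma> \<in> configs V {}"
  shows "(\<Prod>(a,b)\<in>F. \<sigma> a * \<sigma> b) = (\<Prod>p\<in>V. if \<sigma> p = 1 then 1 else degree_sign F p)"
proof -
  have "(\<Prod>(a,b)\<in>F. \<sigma> a * \<sigma> b) = (\<Prod>e\<in>F. \<Prod>p\<in>V. (if fst e = p then \<sigma> p else 1) * (if snd e = p then \<sigma> p else 1))"
  proof (intro prod.cong refl, clarify)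
    fix a a' b b' assume "((a,a'),(b,b')) \<in> F"
    then have "(a,a') \<in> V" "(b,b') \<in> V" using F by (auto simp: nn_edges_def)
    then show "\<sigma> (a,a') * \<sigma> (b,b') = (\<Prod>p\<in>V. (if fst ((a,a'),(b,b')) = p then \<sigma> p else 1) * (if snd ((a,a'),(b,b')) = p then \<sigma> p else 1))"
      using V unfolding prod.distrib by (simp add: prod.delta')
  qed
  also have "\<dots> = (\<Prod>p\<in>V. \<Prod>e\<in>F. (if fst e = p then \<sigma> p else 1) * (if snd e = p then \<sigma> p else 1))"
    by (rule prod.swap)
  also have "\<dots> = (\<Prod>p\<in>V. if \<sigma> p = 1 then 1 else degree_sign F p)"
  proof (intro prod.cong refl)
    fix p
    show "(\<Prod>e\<in>F. (if fst e = p then \<sigma> p else 1) * (if snd e = p then \<sigma> p else 1)) = (if \<sigma> p = 1 then 1 else degree_sign F p)"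
      using configs_val[OF \<sigma>, of p] by (elim disjE; simp add: degree_sign_def cong: if_cong)
  qed
  finally show ?thesis .
qed

text \<open>Flipping the spin at a vertex of odd degree in F negates the sum; if there is none,
  every summand is 1.\<close>

lemma sum_prod_spins:
  assumes V: "finite V" and F: "F \<subseteq> nn_edges V"
  shows "(\<Sum>\<sigma>\<in>configs V {}. \<Prod>(a,b)\<in>F. \<sigma> a * \<sigma> b) = (if F \<in> even_sets V then real (card (configs V {})) else 0)"
proof (cases "F \<in> even_sets V")
  case True
  then have "(\<Prod>(a,b)\<in>F. \<sigma> a * \<sigma> b) = 1" if "\<sigma> \<in> configs V {}" for \<sigma>
    unfolding prod_spins_degree[OF V F that] by (intro prod.neutral) (auto simp: even_sets_def)
  then show ?thesis using True by simp
next
  case False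
  then obtain p where p: "p \<in> V" "degree_sign F p \<noteq> 1" using F by (auto simp: even_sets_def)
  have fF: "finite F" using F finite_nn_edges[OF V] finite_subset by blast
  then have dp: "degree_sign F p = -1" using p degree_sign_pm by blast
  define g :: "vertex \<Rightarrow> real" where "g a = (if a = p then -1 else 1)" for a
  have g: "g \<in> configs V {}" using p by (auto simp: configs_def g_def)
  have gg: "(\<Prod>(a,b)\<in>F. g a * g b) = -1"
    using dp by (simp add: degree_sign_def g_def case_prod_beta)
  let ?S = "\<Sum>\<sigma>\<in>configs V {}. \<Prod>(a,b)\<in>F. \<sigma> a * \<sigma> b"
  have "?S = (\<Sum>\<sigma>\<in>configs V {}. \<Prod>(a,b)\<in>F. \<sigma> a * g a * (\<sigma> b * g b))"
    by (rule sum_configs_shift[OF g])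
  also have "\<dots> = (\<Sum>\<sigma>\<in>configs V {}. (\<Prod>(a,b)\<in>F. \<sigma> a * \<sigma> b) * (\<Prod>(a,b)\<in>F. g a * g b))"
    unfolding prod.distrib[symmetric] by (intro sum.cong prod.cong refl) (auto simp: mult_ac)
  also have "\<dots> = - ?S" by (simp add: gg sum_negf)
  finally show ?thesis using False by simp
qed

lemma spin_sum_high_temperature:
  fixes w :: "vertex \<Rightarrow> vertex \<Rightarrow> real"
  assumes V: "finite V" and v: "v \<in> V"
  shows "spin_sum V w v v = card (configs V {}) * (\<Sum>F\<in>even_sets V. \<Prod>(a,b)\<in>F. w a b)"
proof -
  let ?E = "nn_edges V"
  have fE: "finite ?E" using V by simp
  have "spin_sum V w v v = (\<Sum>\<sigma>\<in>configs V {}. \<Prod>e\<in>?E. (case e of (a,b) \<Rightarrow> w a b * (\<sigma> a * \<sigma> b)) + 1)"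
    unfolding spin_sum_def
    by (intro sum.cong refl) (simp add: configs_sq case_prod_beta add.commute)
  also have "\<dots> = (\<Sum>\<sigma>\<in>configs V {}. \<Sum>F\<in>Pow ?E. (\<Prod>(a,b)\<in>F. w a b) * (\<Prod>(a,b)\<in>F. \<sigma> a * \<sigma> b))"
    unfolding prod_add[OF fE] by (intro sum.cong refl) (simp add: case_prod_beta prod.distrib[symmetric])
  also have "\<dots> = (\<Sum>F\<in>Pow ?E. (\<Prod>(a,b)\<in>F. w a b) * (\<Sum>\<sigma>\<in>configs V {}. \<Prod>(a,b)\<in>F. \<sigma> a * \<sigma> b))"
    by (subst sum.swap) (simp add: sum_distrib_left)
  also have "\<dots> = (\<Sum>F\<in>Pow ?E. if F \<in> even_sets V then (\<Prod>(a,b)\<in>F. w a b) * real (card (configs V {})) else 0)"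
    by (intro sum.cong refl) (simp add: sum_prod_spins[OF V])
  also have "\<dots> = (\<Sum>F\<in>even_sets V. (\<Prod>(a,b)\<in>F. w a b) * real (card (configs V {})))"
    by (rule sum.mono_neutral_cong_right) (auto simp: fE even_sets_def)
  finally show ?thesis by (simp add: sum_distrib_left mult.commute)
qed

lemma degree_sign_local:
  assumes F: "F \<subseteq> nn_edges V" and fF: "finite F"
  shows "degree_sign F (i,j) = edge_sign F ((i,j),(i+1,j)) * edge_sign F ((i-1,j),(i,j)) *
     edge_sign F ((i,j),(i,j+1)) * edge_sign F ((i,j-1),(i,j))"
proof -
  let ?Q = "{((i,j),(i+1,j)), ((i-1,j),(i,j)), ((i,j),(i,j+1)), ((i,j-1),(i,j))}"
  have "degree_sign F (i,j) = (\<Prod>e\<in>F. if e \<in> ?Q then -1 else 1)"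
    unfolding degree_sign_def
  proof (intro prod.cong refl)
    fix e assume "e \<in> F"
    then have e: "snd e = (fst (fst e) + 1, snd (fst e)) \<or> snd e = (fst (fst e), snd (fst e) + 1)"
      using F by (cases e) (auto simp: nn_edges_def)
    obtain p q p' q' where "e = ((p,q),(p',q'))" by (metis surj_pair)
    with e show "(if fst e = (i,j) then -1 else 1) * (if snd e = (i,j) then -1 else 1) = (if e \<in> ?Q then -1 else (1::real))"
      by auto
  qed
  also have "\<dots> = (\<Prod>e\<in>?Q. edge_sign F e)"
    unfolding edge_sign_def
    by (subst (1 2) prod.inter_restrict[symmetric]) (use fF in \<open>auto simp: Int_commute\<close>)
  also have "\<dots> = edge_sign F ((i,j),(i+1,j)) * edge_sign F ((i-1,j),(i,j)) *
     edge_sign F ((i,j),(i,j+1)) * edge_sign F ((i,j-1),(i,j))"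
    by (simp add: mult.assoc)
  finally show ?thesis .
qed

lemma face_spin_rec:
  assumes F: "F \<subseteq> nn_edges V" and fF: "finite F"
  shows "face_spin F (i,j) = face_spin F (i,j-1) * edge_sign F ((i,j),(i+1,j))"
proof -
  have "face_spin F (i,j) = (\<Prod>e\<in>F. column_sign (i,j-1) (fst e) (snd e) * (if e = ((i,j),(i+1,j)) then -1 else 1))"
    unfolding face_spin_def case_prod_beta
  proof (intro prod.cong refl)
    fix e assume "e \<in> F"
    then have e: "snd e = (fst (fst e) + 1, snd (fst e)) \<or> snd e = (fst (fst e), snd (fst e) + 1)"
      using F by (cases e) (auto simp: nn_edges_def)
    obtain p q p' q' where "e = ((p,q),(p',q'))" by (metis surj_pair)
    with e show "column_sign (i,j) (fst e) (snd e) = column_sign (i,j-1) (fst e) (snd e) * (if e = ((i,j),(i+1,j)) then -1 else 1)"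
      by (auto simp: column_sign_def)
  qed
  also have "\<dots> = face_spin F (i,j-1) * edge_sign F ((i,j),(i+1,j))"
    unfolding prod.distrib face_spin_def case_prod_beta edge_sign_def using fF by (simp add: prod.delta)
  finally show ?thesis .
qed

text \<open>The edge e separates this face from the face \<open>fst e\<close>, faces being named by
  their lower left vertex; for a horizontal edge it is the face below. The pair is the dual edge in
  the orientation of \<open>nn_edges\<close>.\<close>

definition left_face :: "vertex \<times> vertex \<Rightarrow> vertex" where
  "left_face e = (if snd (fst e) = snd (snd e) then (fst (fst e), snd (fst e) - 1) else (fst (fst e) - 1, snd (fst e)))"

definition domain_walls :: "vertex set \<Rightarrow> (vertex \<Rightarrow> real) \<Rightarrow> (vertex \<times> vertex) set" where
  "domain_walls V \<tau> = {e \<in> nn_edges V. \<tau> (left_face e) \<noteq> \<tau> (fst e)}"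

lemma nn_edges_cases:
  assumes "e \<in> nn_edges V"
  obtains i j where "e = ((i,j),(i+1,j))" "(i,j) \<in> V" "(i+1,j) \<in> V" | i j where "e = ((i,j),(i,j+1))" "(i,j) \<in> V" "(i,j+1) \<in> V"
  using assms by (cases e) (auto simp: nn_edges_def)

text \<open>V' consists of all faces touching V, which in the lower left naming adds a column on the
  left and a row below. The unit squares inside the rectangle are V' - B, and B consists of the
  faces around it, whose spins are fixed.\<close>

context
  fixes a b c d :: int and V V' B :: "vertex set"
  assumes ab: "a \<le> b" and cd: "c \<le> d"
  defines "V \<equiv> rect (a,b,c,d)" and "V' \<equiv> rect (a-1,b,c-1,d)" and "B \<equiv> bdry (rect (a-1,b,c-1,d))"
begin

lemma V_iff: "(i,j) \<in> V \<longleftrightarrow> a \<le> i \<and> i \<le> b \<and> c \<le> j \<and> j \<le> d"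
  and V'_iff: "(i,j) \<in> V' \<longleftrightarrow> a - 1 \<le> i \<and> i \<le> b \<and> c - 1 \<le> j \<and> j \<le> d"
  by (simp_all add: V_def V'_def mem_rect)

lemma inner_iff: "(i,j) \<in> V' - B \<longleftrightarrow> a \<le> i \<and> i < b \<and> c \<le> j \<and> j < d"
proof
  assume h: "(i,j) \<in> V' - B"
  then have n: "(k,l) \<in> V'" if "nn (i,j) (k,l)" for k l using that unfolding B_def V'_def bdry_def by blast
  show "a \<le> i \<and> i < b \<and> c \<le> j \<and> j < d"
    using n[of "i-1" j] n[of "i+1" j] n[of i "j-1"] n[of i "j+1"] by (auto simp: nn_def V'_iff)
next
  assume h: "a \<le> i \<and> i < b \<and> c \<le> j \<and> j < d"
  have "(k,l) \<in> V'" if "nn (i,j) (k,l)" for k l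
    using that h by (auto simp: nn_def V'_iff)
  moreover have "(i,j) \<in> V'" using h by (auto simp: V'_iff)
  ultimately show "(i,j) \<in> V' - B" unfolding B_def V'_def bdry_def by auto
qed

lemma finV: "finite V" "finite V'" by (simp_all add: V_def V'_def)

lemma bdry_spin: "\<tau> \<in> configs V' B \<Longrightarrow> \<not> (a \<le> i \<and> i < b \<and> c \<le> j \<and> j < d) \<Longrightarrow> \<tau> (i,j) = 1"
  using inner_iff unfolding configs_def by blast

lemma edge_E: "((i,j),(i+1,j)) \<in> nn_edges V \<longleftrightarrow> a \<le> i \<and> i < b \<and> c \<le> j \<and> j \<le> d"
  "((i,j),(i,j+1)) \<in> nn_edges V \<longleftrightarrow> a \<le> i \<and> i \<le> b \<and> c \<le> j \<and> j < d"
  by (auto simp: nn_edges_def V_iff)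

lemma fin_sub: "F \<subseteq> nn_edges V \<Longrightarrow> finite F"
  using finite_nn_edges[OF finV(1)] finite_subset by blast

lemma face_spin_outside:
  assumes F: "F \<subseteq> nn_edges V" and out: "i < a \<or> b \<le> i \<or> j < c"
  shows "face_spin F (i,j) = 1"
  unfolding face_spin_def
proof (rule prod.neutral, rule ballI)
  fix e assume "e \<in> F"
  then have "e \<in> nn_edges V" using F by blast
  then show "(case e of (p,q) \<Rightarrow> column_sign (i,j) p q) = 1"
    by (rule nn_edges_cases) (use out in \<open>auto simp: V_iff column_sign_def\<close>)
qed

text \<open>Going up by one, the two face spins change by the horizontal edges at (i,j+1), and
  evenness of the degree there trades these for the two vertical edges.\<close>

lemma face_spin_across:
  assumes F: "F \<in> even_sets V" and i: "a \<le> i" "i \<le> b" and j: "c - 1 \<le> j" "j \<le> d"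
  shows "face_spin F (i-1,j) * face_spin F (i,j) = edge_sign F ((i,j),(i,j+1))"
  using j
proof (induction j rule: int_ge_induct)
  case base
  have "((i,c-1),(i,c)) \<notin> nn_edges V" using edge_E(2)[of i "c-1"] by simp
  then show ?case using F face_spin_outside[of F _ "c-1"] by (auto simp: even_sets_def edge_sign_def)
next
  case (step j)
  have sub: "F \<subseteq> nn_edges V" using F by (simp add: even_sets_def)
  note fin = fin_sub[OF sub]
  have "degree_sign F (i,j+1) = 1" using F i step by (auto simp: even_sets_def V_iff)
  then have deg: "edge_sign F ((i,j+1),(i+1,j+1)) * edge_sign F ((i-1,j+1),(i,j+1)) *
     edge_sign F ((i,j+1),(i,j+1+1)) * edge_sign F ((i,j),(i,j+1)) = 1"
    unfolding degree_sign_local[OF sub fin] by simp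
  have IH: "face_spin F (i-1,j) * face_spin F (i,j) = edge_sign F ((i,j),(i,j+1))" using step by simp
  have "face_spin F (i-1,j+1) * face_spin F (i,j+1) =
    (face_spin F (i-1,j) * face_spin F (i,j)) * (edge_sign F ((i-1,j+1),(i,j+1)) * edge_sign F ((i,j+1),(i+1,j+1)))"
    using face_spin_rec[OF sub fin, of "i-1" "j+1"] face_spin_rec[OF sub fin, of i "j+1"] by (simp add: mult_ac)
  also have "\<dots> = edge_sign F ((i,j+1),(i,j+1+1))"
    unfolding IH using deg by (auto simp: edge_sign_def split: if_splits)
  finally show ?case .
qed

text \<open>No edge leaves the top row upwards, so the faces above the rectangle all have the spin
  of the leftmost one, which is 1.\<close>

lemma face_spin_top:
  assumes F: "F \<in> even_sets V" and i: "a - 1 \<le> i" "i \<le> b"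
  shows "face_spin F (i,d) = 1"
  using i
proof (induction i rule: int_ge_induct)
  case base show ?case using F face_spin_outside by (auto simp: even_sets_def)
next
  case (step i)
  have "((i+1,d),(i+1,d+1)) \<notin> nn_edges V" by (simp add: edge_E)
  then have "edge_sign F ((i+1,d),(i+1,d+1)) = 1" using F by (auto simp: even_sets_def edge_sign_def)
  then have "face_spin F (i,d) * face_spin F (i+1,d) = 1"
    using face_spin_across[OF F, of "i+1" d] step cd by simp
  then show ?case using step by simp
qed

definition spins_of :: "(vertex \<times> vertex) set \<Rightarrow> vertex \<Rightarrow> real" where
  "spins_of F f = (if f \<in> V' - B then face_spin F f else 1)"

lemma spins_of_eq:
  assumes F: "F \<in> even_sets V" and f: "f \<in> V'"
  shows "spins_of F f = face_spin F f"
proof -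
  obtain i j where ij: "f = (i,j)" by (cases f)
  have sub: "F \<subseteq> nn_edges V" using F by (simp add: even_sets_def)
  have f': "a - 1 \<le> i" "i \<le> b" "j \<le> d" using f by (auto simp: ij V'_iff)
  then consider "a \<le> i \<and> i < b \<and> c \<le> j \<and> j < d" | "i < a \<or> b \<le> i \<or> j < c" | "j = d" "a - 1 \<le> i" "i \<le> b"
    by linarith
  then show ?thesis
  proof cases
    case 2 then show ?thesis using face_spin_outside[OF sub 2] by (simp add: spins_of_def ij)
  next
    case 3 then show ?thesis using face_spin_top[OF F 3(2,3)] by (simp add: spins_of_def ij)
  next
    case 1 then show ?thesis unfolding spins_of_def ij inner_iff by simp
  qed
qed

lemma spins_of_configs: "F \<in> even_sets V \<Longrightarrow> spins_of F \<in> configs V' B"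
proof -
  assume F: "F \<in> even_sets V"
  have "face_spin F f = 1 \<or> face_spin F f = -1" for f
  proof -
    have "finite F" using F fin_sub by (auto simp: even_sets_def)
    moreover have "column_sign f p q = 1 \<or> column_sign f p q = -1" for p q by (simp add: column_sign_def)
    ultimately show ?thesis unfolding face_spin_def
      by (induction F rule: finite_induct) (simp, fastforce)
  qed
  then show ?thesis by (auto simp: configs_def spins_of_def)
qed

lemma left_face_simps: "left_face ((i,j),(i+1,j)) = (i,j-1)" "left_face ((i,j),(i,j+1)) = (i-1,j)"
  by (simp_all add: left_face_def)

lemma domain_walls_spins_of:
  assumes F: "F \<in> even_sets V" shows "domain_walls V (spins_of F) = F"
proof -
  have sub: "F \<subseteq> nn_edges V" using F by (simp add: even_sets_def)
  have pm: "spins_of F f = 1 \<or> spins_of F f = -1" for f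
    using configs_val[OF spins_of_configs[OF F]] .
  have "spins_of F (left_face e) \<noteq> spins_of F (fst e) \<longleftrightarrow> e \<in> F" if e: "e \<in> nn_edges V" for e
  proof -
    have "spins_of F (left_face e) * spins_of F (fst e) = edge_sign F e"
      using e
    proof (rule nn_edges_cases)
      fix i j assume *: "e = ((i,j),(i+1,j))" "(i,j) \<in> V" "(i+1,j) \<in> V"
      then have "(i,j-1) \<in> V'" "(i,j) \<in> V'" by (auto simp: V_iff V'_iff)
      then have "spins_of F (left_face e) * spins_of F (fst e) = face_spin F (i,j-1) * face_spin F (i,j)"
        by (simp add: * left_face_simps spins_of_eq[OF F])
      also have "\<dots> = (face_spin F (i,j-1) * face_spin F (i,j-1)) * edge_sign F e"
        using face_spin_rec[OF sub fin_sub[OF sub], of i j] by (simp add: *)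
      also have "face_spin F (i,j-1) * face_spin F (i,j-1) = 1"
        unfolding face_spin_def prod.distrib[symmetric] by (rule prod.neutral) auto
      finally show ?thesis by simp
    next
      fix i j assume *: "e = ((i,j),(i,j+1))" "(i,j) \<in> V" "(i,j+1) \<in> V"
      then have "(i-1,j) \<in> V'" "(i,j) \<in> V'" by (auto simp: V_iff V'_iff)
      then show ?thesis using face_spin_across[OF F, of i j] *
        by (simp add: left_face_simps spins_of_eq[OF F] V_iff)
    qed
    then show ?thesis using pm[of "left_face e"] pm[of "fst e"] by (auto simp: edge_sign_def split: if_splits)
  qed
  then show ?thesis using sub unfolding domain_walls_def by blast
qed

lemma edge_sign_domain_walls:
  assumes \<tau>: "\<tau> \<in> configs V' B"
  shows "edge_sign (domain_walls V \<tau>) ((i,j),(i+1,j)) = (if c \<le> j \<and> j \<le> d then \<tau> (i,j-1) * \<tau> (i,j) else 1)"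
    and "edge_sign (domain_walls V \<tau>) ((i,j),(i,j+1)) = (if a \<le> i \<and> i \<le> b then \<tau> (i-1,j) * \<tau> (i,j) else 1)"
proof -
  note pm = configs_val[OF \<tau>]
  show "edge_sign (domain_walls V \<tau>) ((i,j),(i+1,j)) = (if c \<le> j \<and> j \<le> d then \<tau> (i,j-1) * \<tau> (i,j) else 1)"
    using pm[of "(i,j-1)"] pm[of "(i,j)"] bdry_spin[OF \<tau>, of i j] bdry_spin[OF \<tau>, of i "j-1"]
    by (auto simp: edge_sign_def domain_walls_def left_face_simps edge_E)
  show "edge_sign (domain_walls V \<tau>) ((i,j),(i,j+1)) = (if a \<le> i \<and> i \<le> b then \<tau> (i-1,j) * \<tau> (i,j) else 1)"
    using pm[of "(i-1,j)"] pm[of "(i,j)"] bdry_spin[OF \<tau>, of i j] bdry_spin[OF \<tau>, of "i-1" j]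
    by (auto simp: edge_sign_def domain_walls_def left_face_simps edge_E)
qed

lemma domain_walls_even:
  assumes \<tau>: "\<tau> \<in> configs V' B" shows "domain_walls V \<tau> \<in> even_sets V"
proof -
  have sub: "domain_walls V \<tau> \<subseteq> nn_edges V" by (auto simp: domain_walls_def)
  have "degree_sign (domain_walls V \<tau>) (i,j) = 1" if "(i,j) \<in> V" for i j
  proof -
    note pm = configs_val[OF \<tau>]
    have "degree_sign (domain_walls V \<tau>) (i,j) = (\<tau> (i,j-1) * \<tau> (i,j)) * (\<tau> (i-1,j-1) * \<tau> (i-1,j)) *
      (\<tau> (i-1,j) * \<tau> (i,j)) * (\<tau> (i-1,j-1) * \<tau> (i,j-1))"
      unfolding degree_sign_local[OF sub fin_sub[OF sub]]
      using edge_sign_domain_walls(1)[OF \<tau>, of i j] edge_sign_domain_walls(1)[OF \<tau>, of "i-1" j]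
        edge_sign_domain_walls(2)[OF \<tau>, of i j] edge_sign_domain_walls(2)[OF \<tau>, of i "j-1"] that
      by (simp add: V_iff)
    then show ?thesis
      using pm[of "(i,j)"] pm[of "(i-1,j)"] pm[of "(i,j-1)"] pm[of "(i-1,j-1)"] by auto
  qed
  then show ?thesis using sub by (auto simp: even_sets_def)
qed

lemma spins_of_domain_walls:
  assumes \<tau>: "\<tau> \<in> configs V' B" shows "spins_of (domain_walls V \<tau>) = \<tau>"
proof
  fix f :: "vertex"
  obtain i j where ij: "f = (i,j)" by (cases f)
  let ?F = "domain_walls V \<tau>"
  have sub: "?F \<subseteq> nn_edges V" by (auto simp: domain_walls_def)
  note pm = configs_val[OF \<tau>]
  show "spins_of ?F f = \<tau> f"
  proof (cases "f \<in> V' - B")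
    case True
    have "face_spin ?F (i,j) = \<tau> (i,j)" if "c - 1 \<le> j" "j \<le> d" for j
      using that
    proof (induction j rule: int_ge_induct)
      case base
      show ?case using face_spin_outside[OF sub, of i "c-1"] bdry_spin[OF \<tau>, of i "c-1"] by simp
    next
      case (step j)
      then show ?case
        using face_spin_rec[OF sub fin_sub[OF sub], of i "j+1"] edge_sign_domain_walls(1)[OF \<tau>, of i "j+1"] pm[of "(i,j)"]
        by auto
    qed
    then show ?thesis using True inner_iff[of i j] by (simp add: spins_of_def ij)
  next
    case False
    then have "\<tau> f = 1" using \<tau> unfolding configs_def by blast
    then show ?thesis by (simp only: spins_of_def False if_False)
  qed
qed

text \<open>Dual edges with different end spins are those crossed by domain walls, and each of them
  costs exp (- 2 beta). A dual edge that crosses no edge of V joins two fixed spins and never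
  contributes.\<close>

lemma ising_weight_domain_walls:
  assumes \<tau>: "\<tau> \<in> configs V' B"
  shows "ising_weight \<beta> V' \<tau> = exp (\<beta> * card (nn_edges V')) * exp (- 2 * \<beta>) ^ card (domain_walls V \<tau>)"
proof -
  let ?D = "{e \<in> nn_edges V'. \<tau> (fst e) \<noteq> \<tau> (snd e)}"
  note pm = configs_val[OF \<tau>]
  have "bij_betw (\<lambda>e. (left_face e, fst e)) (domain_walls V \<tau>) ?D"
  proof (rule bij_betw_imageI)
    show "inj_on (\<lambda>e. (left_face e, fst e)) (domain_walls V \<tau>)"
    proof (rule inj_onI)
      fix e e' assume e: "e \<in> domain_walls V \<tau>" "e' \<in> domain_walls V \<tau>"
        and eq: "(left_face e, fst e) = (left_face e', fst e')"
      have "e \<in> nn_edges V" "e' \<in> nn_edges V" using e by (auto simp: domain_walls_def)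
      then show "e = e'" using eq
        by (elim nn_edges_cases) (auto simp: left_face_simps)
    qed
    show "(\<lambda>e. (left_face e, fst e)) ` domain_walls V \<tau> = ?D"
    proof (intro set_eqI iffI)
      fix e' assume "e' \<in> (\<lambda>e. (left_face e, fst e)) ` domain_walls V \<tau>"
      then obtain e where e: "e \<in> nn_edges V" "\<tau> (left_face e) \<noteq> \<tau> (fst e)" "e' = (left_face e, fst e)"
        by (auto simp: domain_walls_def)
      from e(1) have "(left_face e, fst e) \<in> nn_edges V'"
        by (rule nn_edges_cases) (auto simp: left_face_simps nn_edges_def V_iff V'_iff)
      then show "e' \<in> ?D" using e by simp
    next
      fix e' assume h: "e' \<in> ?D"
      then have "e' \<in> nn_edges V'" by simp
      then show "e' \<in> (\<lambda>e. (left_face e, fst e)) ` domain_walls V \<tau>"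
      proof (rule nn_edges_cases)
        fix i j assume *: "e' = ((i,j),(i+1,j))" "(i,j) \<in> V'" "(i+1,j) \<in> V'"
        have "\<tau> (i,j) \<noteq> 1 \<or> \<tau> (i+1,j) \<noteq> 1" using h * by auto
        then have "(a \<le> i \<and> i < b \<and> c \<le> j \<and> j < d) \<or> (a \<le> i+1 \<and> i+1 < b \<and> c \<le> j \<and> j < d)"
          using bdry_spin[OF \<tau>] by blast
        then have "((i+1,j),(i+1,j+1)) \<in> nn_edges V"
          unfolding edge_E using * by (auto simp: V'_iff)
        then have "((i+1,j),(i+1,j+1)) \<in> domain_walls V \<tau>"
          using h * left_face_simps(2)[of "i+1" j] by (simp add: domain_walls_def)
        then show ?thesis by (rule rev_image_eqI) (use left_face_simps(2)[of "i+1" j] in \<open>simp add: *\<close>)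
      next
        fix i j assume *: "e' = ((i,j),(i,j+1))" "(i,j) \<in> V'" "(i,j+1) \<in> V'"
        have "\<tau> (i,j) \<noteq> 1 \<or> \<tau> (i,j+1) \<noteq> 1" using h * by auto
        then have "(a \<le> i \<and> i < b \<and> c \<le> j \<and> j < d) \<or> (a \<le> i \<and> i < b \<and> c \<le> j+1 \<and> j+1 < d)"
          using bdry_spin[OF \<tau>] by blast
        then have "((i,j+1),(i+1,j+1)) \<in> nn_edges V"
          unfolding edge_E using * by (auto simp: V'_iff)
        then have "((i,j+1),(i+1,j+1)) \<in> domain_walls V \<tau>"
          using h * left_face_simps(1)[of i "j+1"] by (simp add: domain_walls_def)
        then show ?thesis by (rule rev_image_eqI) (use left_face_simps(1)[of i "j+1"] in \<open>simp add: *\<close>)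
      qed
    qed
  qed
  then have card: "card (domain_walls V \<tau>) = card ?D" by (rule bij_betw_same_card)
  have "(\<Sum>(p,q)\<in>nn_edges V'. \<tau> p * \<tau> q) = (\<Sum>e\<in>nn_edges V'. 1 - (if \<tau> (fst e) \<noteq> \<tau> (snd e) then 2 else 0))"
    unfolding case_prod_beta
  proof (intro sum.cong refl)
    fix e
    show "\<tau> (fst e) * \<tau> (snd e) = 1 - (if \<tau> (fst e) \<noteq> \<tau> (snd e) then 2 else 0)"
      using pm[of "fst e"] pm[of "snd e"] by auto
  qed
  also have "\<dots> = real (card (nn_edges V')) - 2 * real (card ?D)"
    using finV by (simp add: sum_subtractf sum.inter_filter[symmetric])
  finally have S: "(\<Sum>(p,q)\<in>nn_edges V'. \<tau> p * \<tau> q) = real (card (nn_edges V')) - 2 * real (card ?D)" .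
  show ?thesis
    unfolding ising_weight_def card S by (simp add: exp_add[symmetric] exp_of_nat_mult[symmetric] algebra_simps)
qed

text \<open>The low-temperature expansion on V' and the high-temperature expansion on V run over the
  same even edge sets; \<open>column_sign\<close> at f, multiplied over such a set, is the face spin
  at f.\<close>

lemma kramers_wannier:
  assumes f: "f \<in> V'" "f' \<in> V'" and v: "v \<in> V" and x: "exp (- 2 * \<beta>) = x"
  shows "plus_corr \<beta> (a-1,b,c-1,d) f f' =
    spin_sum V (\<lambda>p q. x * column_sign f p q * column_sign f' p q) v v / spin_sum V (\<lambda>p q. x) v v"
proof -
  have wall: "(\<Sum>\<tau>\<in>configs V' B. \<tau> f * \<tau> f' * ising_weight \<beta> V' \<tau>) =
     exp (\<beta> * card (nn_edges V')) * (\<Sum>F\<in>even_sets V. face_spin F f * face_spin F f' * x ^ card F)"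
    if f: "f \<in> V'" "f' \<in> V'" for f f'
    unfolding sum_distrib_left
  proof (rule sum.reindex_bij_witness[where i = spins_of and j = "domain_walls V"])
    fix \<tau> assume \<tau>: "\<tau> \<in> configs V' B"
    show "spins_of (domain_walls V \<tau>) = \<tau>" "domain_walls V \<tau> \<in> even_sets V"
      using spins_of_domain_walls[OF \<tau>] domain_walls_even[OF \<tau>] by auto
    then have "face_spin (domain_walls V \<tau>) f = \<tau> f" "face_spin (domain_walls V \<tau>) f' = \<tau> f'"
      using spins_of_eq f by metis+
    then show "exp (\<beta> * card (nn_edges V')) * (face_spin (domain_walls V \<tau>) f * face_spin (domain_walls V \<tau>) f' * x ^ card (domain_walls V \<tau>))
       = \<tau> f * \<tau> f' * ising_weight \<beta> V' \<tau>"
      by (simp only: ising_weight_domain_walls[OF \<tau>] x) (simp add: mult_ac)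
  next
    fix F assume F: "F \<in> even_sets V"
    show "domain_walls V (spins_of F) = F" "spins_of F \<in> configs V' B"
      using domain_walls_spins_of[OF F] spins_of_configs[OF F] by auto
  qed
  have hi: "spin_sum V (\<lambda>p q. x * column_sign f p q * column_sign f' p q) v v =
    card (configs V {}) * (\<Sum>F\<in>even_sets V. face_spin F f * face_spin F f' * x ^ card F)" for f f'
    unfolding spin_sum_high_temperature[OF finV(1) v]
    by (intro arg_cong2[where f="(*)"] sum.cong refl) (simp add: face_spin_def case_prod_beta prod.distrib)
  \<comment> \<open>The spin of this outer corner face is always 1, so \<open>wall\<close> with both
    faces equal to it yields the partition function.\<close>
  let ?o = "(a-1,c-1)"
  have o: "?o \<in> V'" using ab cd by (simp add: V'_iff)
  have o1: "face_spin F ?o = 1" if "F \<in> even_sets V" for F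
    using that face_spin_outside[of F "a-1" "c-1"] by (simp add: even_sets_def)
  have one: "\<tau> ?o = 1" if "\<tau> \<in> configs V' B" for \<tau> using bdry_spin[OF that, of "a-1" "c-1"] by simp
  have w1: "(\<Sum>\<tau>\<in>configs V' B. ising_weight \<beta> V' \<tau>) = exp (\<beta> * card (nn_edges V')) * (\<Sum>F\<in>even_sets V. x ^ card F)"
    using wall[OF o o] by (simp add: o1 one)
  have h1: "spin_sum V (\<lambda>p q. x) v v = card (configs V {}) * (\<Sum>F\<in>even_sets V. x ^ card F)"
    unfolding spin_sum_high_temperature[OF finV(1) v] by (simp add: case_prod_beta)
  have M: "card (configs V {}) > 0" using ones_in_configs[of V "{}"] finV by (auto simp: card_gt_0_iff)
  have B: "bdry V' = B" by (simp add: B_def V'_def)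
  show ?thesis
    unfolding plus_corr_def V'_def[symmetric] B ising_corr_def wall[OF f] w1 hi h1
    using M by simp
qed

end

section \<open>Griffiths inequalities and the plus limit\<close>

definition big_rects :: "nat \<Rightarrow> (int \<times> int \<times> int \<times> int) set" where
  "big_rects N = {(a,b,c,d). a \<le> - int N \<and> int N \<le> b \<and> c \<le> - int N \<and> int N \<le> d}"

lemma eventually_rect_filter:
  "eventually P rect_filter \<longleftrightarrow> (\<exists>N. \<forall>R\<in>big_rects N. P R)"
proof -
  have "eventually P rect_filter \<longleftrightarrow> (\<exists>N\<in>UNIV. eventually P (principal (big_rects N)))"
    unfolding rect_filter_def big_rects_def[symmetric]
  proof (rule eventually_INF_base)
    fix m n :: nat
    show "\<exists>k\<in>UNIV. principal (big_rects k) \<le> inf (principal (big_rects m)) (principal (big_rects n))"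
      by (rule bexI[of _ "max m n"]) (auto simp: big_rects_def)
  qed auto
  then show ?thesis by (simp add: eventually_principal)
qed

lemma rect_filter_neq_bot: "rect_filter \<noteq> bot"
proof
  assume "rect_filter = bot"
  then have "eventually (\<lambda>_. False) rect_filter" by simp
  then obtain N where "\<forall>R\<in>big_rects N. False" by (auto simp: eventually_rect_filter)
  moreover have "(- int N, int N, - int N, int N) \<in> big_rects N" by (simp add: big_rects_def)
  ultimately show False by blast
qed

lemma prod_list_mult: "prod_list (map (\<lambda>x. f x * g x :: real) l) = prod_list (map f l) * prod_list (map g l)"
  by (induction l) auto

lemma prod_list_spin:
  assumes "\<sigma> \<in> configs V F" shows "prod_list (map \<sigma> l) = 1 \<or> prod_list (map \<sigma> l) = -1"
  using configs_val[OF assms] by (induction l) (simp, fastforce)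

text \<open>Expanding the product gives spin monomials with nonnegative coefficients. A monomial
  that takes the value -1 sums to 0 after multiplication by such a configuration, and any other is
  constantly 1. Lists allow repeated spins in a monomial.\<close>

lemma griffiths_first:
  assumes V: "finite V" and E: "finite E" and pos: "\<And>e. e \<in> E \<Longrightarrow> c e \<ge> 0 \<and> s e \<ge> (0::real)"
  shows "(\<Sum>\<sigma>\<in>configs V F. prod_list (map \<sigma> l) * (\<Prod>e\<in>E. c e + s e * (\<sigma> (fst e) * \<sigma> (snd e)))) \<ge> 0"
  using E pos
proof (induction E arbitrary: l rule: finite_induct)
  case empty
  show ?case
  proof (cases "\<exists>g\<in>configs V F. prod_list (map g l) = -1")
    case True
    then obtain g where g: "g \<in> configs V F" "prod_list (map g l) = -1" by blast
    have "(\<Sum>\<sigma>\<in>configs V F. prod_list (map \<sigma> l)) = - (\<Sum>\<sigma>\<in>configs V F. prod_list (map \<sigma> l))"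
      by (subst sum_configs_shift[OF g(1)]) (simp add: prod_list_mult g(2) sum_negf)
    then show ?thesis by simp
  next
    case False
    then have "prod_list (map \<sigma> l) = 1" if "\<sigma> \<in> configs V F" for \<sigma>
      using prod_list_spin[OF that] that by blast
    then show ?thesis by (simp add: sum_nonneg)
  qed
next
  case (insert e E)
  let ?R = "\<lambda>\<sigma>. \<Prod>e\<in>E. c e + s e * (\<sigma> (fst e) * \<sigma> (snd e))"
  have "(\<Sum>\<sigma>\<in>configs V F. prod_list (map \<sigma> l) * (\<Prod>e\<in>insert e E. c e + s e * (\<sigma> (fst e) * \<sigma> (snd e)))) =
    (\<Sum>\<sigma>\<in>configs V F. c e * (prod_list (map \<sigma> l) * ?R \<sigma>) + s e * (prod_list (map \<sigma> (fst e # snd e # l)) * ?R \<sigma>))"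
    using insert.hyps by (intro sum.cong refl) (simp add: algebra_simps)
  also have "\<dots> = c e * (\<Sum>\<sigma>\<in>configs V F. prod_list (map \<sigma> l) * ?R \<sigma>)
     + s e * (\<Sum>\<sigma>\<in>configs V F. prod_list (map \<sigma> (fst e # snd e # l)) * ?R \<sigma>)"
    by (simp only: sum.distrib sum_distrib_left)
  also have "\<dots> \<ge> 0" using insert.prems by (intro add_nonneg_nonneg mult_nonneg_nonneg insert.IH) auto
  finally show ?case .
qed

lemma exp_spin:
  assumes "s = 1 \<or> s = (-1::real)" shows "exp (b * s) = cosh b + sinh b * s"
  using assms by (auto simp: cosh_plus_sinh cosh_minus_sinh)

lemma griffiths_first_exp:
  assumes V: "finite V" and E: "finite E" and pos: "\<And>e. e \<in> E \<Longrightarrow> b e \<ge> (0::real)"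
  shows "(\<Sum>\<sigma>\<in>configs V F. prod_list (map \<sigma> l) * (\<Prod>e\<in>E. exp (b e * (\<sigma> (fst e) * \<sigma> (snd e))))) \<ge> 0"
proof -
  have "(\<Sum>\<sigma>\<in>configs V F. prod_list (map \<sigma> l) * (\<Prod>e\<in>E. exp (b e * (\<sigma> (fst e) * \<sigma> (snd e))))) =
    (\<Sum>\<sigma>\<in>configs V F. prod_list (map \<sigma> l) * (\<Prod>e\<in>E. cosh (b e) + sinh (b e) * (\<sigma> (fst e) * \<sigma> (snd e))))"
  proof (intro sum.cong refl arg_cong2[where f="(*)"] prod.cong)
    fix \<sigma> e assume "\<sigma> \<in> configs V F"
    then show "exp (b e * (\<sigma> (fst e) * \<sigma> (snd e))) = cosh (b e) + sinh (b e) * (\<sigma> (fst e) * \<sigma> (snd e))"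
      using configs_val[of \<sigma> V F "fst e"] configs_val[of \<sigma> V F "snd e"] by (intro exp_spin) auto
  qed
  also have "\<dots> \<ge> 0" using pos by (intro griffiths_first V E) (auto simp: cosh_real_nonneg)
  finally show ?thesis .
qed

lemma ising_weight_prod:
  assumes "finite V"
  shows "ising_weight \<beta> V \<sigma> = (\<Prod>e\<in>nn_edges V. exp (\<beta> * (\<sigma> (fst e) * \<sigma> (snd e))))"
  using assms by (simp add: ising_weight_def sum_distrib_left exp_sum case_prod_beta)

lemma ising_weight_pos: "ising_weight \<beta> V \<sigma> > 0"
  by (simp add: ising_weight_def)

lemma ising_partition_pos: "finite V \<Longrightarrow> (\<Sum>\<sigma>\<in>configs V F. ising_weight \<beta> V \<sigma>) > 0"
  using ones_in_configs[of V F] by (intro sum_pos ising_weight_pos) auto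

text \<open>Ginibre's duplication of variables, with the second copy written as the product of the first with a third.\<close>

lemma griffiths_second:
  fixes \<beta> :: real and F :: "vertex set"
  assumes V: "finite V" and \<beta>: "\<beta> \<ge> 0"
  defines "Z \<equiv> \<lambda>h. \<Sum>\<sigma>\<in>configs V F. h \<sigma> * ising_weight \<beta> V \<sigma>"
  shows "Z (\<lambda>\<sigma>. prod_list (map \<sigma> k)) * Z (\<lambda>\<sigma>. prod_list (map \<sigma> l)) \<le>
    Z (\<lambda>\<sigma>. prod_list (map \<sigma> k) * prod_list (map \<sigma> l)) * Z (\<lambda>_. 1)"
proof -
  let ?C = "configs V F" and ?W = "ising_weight \<beta> V"
  let ?k = "\<lambda>\<sigma>. prod_list (map \<sigma> k)" and ?l = "\<lambda>\<sigma>. prod_list (map \<sigma> l)"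
  have "Z (\<lambda>\<sigma>. ?k \<sigma> * ?l \<sigma>) * Z (\<lambda>_. 1) - Z ?k * Z ?l =
    (\<Sum>\<sigma>\<in>?C. \<Sum>\<tau>\<in>?C. ?k \<sigma> * (?l \<sigma> - ?l \<tau>) * ?W \<sigma> * ?W \<tau>)"
    unfolding Z_def sum_product sum_subtractf[symmetric] by (intro sum.cong refl) (simp add: algebra_simps)
  also have "\<dots> = (\<Sum>\<sigma>\<in>?C. \<Sum>\<tau>\<in>?C. ?k \<sigma> * (?l \<sigma> - ?l (\<lambda>x. \<tau> x * \<sigma> x)) * ?W \<sigma> * ?W (\<lambda>x. \<tau> x * \<sigma> x))"
    by (intro sum.cong refl sum_configs_shift)
  also have "\<dots> = (\<Sum>\<tau>\<in>?C. \<Sum>\<sigma>\<in>?C. ?k \<sigma> * (?l \<sigma> - ?l (\<lambda>x. \<tau> x * \<sigma> x)) * ?W \<sigma> * ?W (\<lambda>x. \<tau> x * \<sigma> x))"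
    by (rule sum.swap)
  \<comment> \<open>For fixed \<tau> the two copies merge into one Ising weight in \<sigma>, whose
    coupling on an edge is \<beta> times 1 plus the product of the two spins of \<tau>. It is
    nonnegative, so the first inequality applies to the inner sum.\<close>
  also have "\<dots> = (\<Sum>\<tau>\<in>?C. (1 - ?l \<tau>) * (\<Sum>\<sigma>\<in>?C. prod_list (map \<sigma> (k @ l)) *
      (\<Prod>e\<in>nn_edges V. exp (\<beta> * (1 + \<tau> (fst e) * \<tau> (snd e)) * (\<sigma> (fst e) * \<sigma> (snd e))))))"
  proof (intro sum.cong refl)
    fix \<tau> assume "\<tau> \<in> ?C"
    have "?W \<sigma> * ?W (\<lambda>x. \<tau> x * \<sigma> x) =
      (\<Prod>e\<in>nn_edges V. exp (\<beta> * (1 + \<tau> (fst e) * \<tau> (snd e)) * (\<sigma> (fst e) * \<sigma> (snd e))))" for \<sigma>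
      unfolding ising_weight_prod[OF V] prod.distrib[symmetric] exp_add[symmetric]
      by (simp add: algebra_simps)
    then show "(\<Sum>\<sigma>\<in>?C. ?k \<sigma> * (?l \<sigma> - ?l (\<lambda>x. \<tau> x * \<sigma> x)) * ?W \<sigma> * ?W (\<lambda>x. \<tau> x * \<sigma> x)) =
      (1 - ?l \<tau>) * (\<Sum>\<sigma>\<in>?C. prod_list (map \<sigma> (k @ l)) *
      (\<Prod>e\<in>nn_edges V. exp (\<beta> * (1 + \<tau> (fst e) * \<tau> (snd e)) * (\<sigma> (fst e) * \<sigma> (snd e)))))"
      unfolding sum_distrib_left by (intro sum.cong refl) (simp add: prod_list_mult mult.assoc, simp add: algebra_simps)
  qed
  also have "\<dots> \<ge> 0"
  proof (rule sum_nonneg, rule mult_nonneg_nonneg)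
    fix \<tau> assume \<tau>: "\<tau> \<in> ?C"
    show "0 \<le> 1 - ?l \<tau>" using prod_list_spin[OF \<tau>, of l] by auto
    have "0 \<le> \<beta> * (1 + \<tau> (fst e) * \<tau> (snd e))" for e
      using configs_val[OF \<tau>, of "fst e"] configs_val[OF \<tau>, of "snd e"] \<beta> by auto
    then show "0 \<le> (\<Sum>\<sigma>\<in>?C. prod_list (map \<sigma> (k @ l)) *
      (\<Prod>e\<in>nn_edges V. exp (\<beta> * (1 + \<tau> (fst e) * \<tau> (snd e)) * (\<sigma> (fst e) * \<sigma> (snd e)))))"
      by (intro griffiths_first_exp V finite_nn_edges)
  qed
  finally show ?thesis by simp
qed

text \<open>Fixing the spin at w to 1 inserts (1 + \<sigma> w) / 2 into numerator and denominator,
  and by the second inequality this cannot lower the quotient.\<close>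

lemma ising_corr_insert:
  assumes V: "finite V" and \<beta>: "\<beta> \<ge> 0"
  shows "ising_corr \<beta> V F x y \<le> ising_corr \<beta> V (insert w F) x y"
proof (cases "w \<in> V - F")
  case False
  then have "V - insert w F = V - F" by auto
  then have "configs V (insert w F) = configs V F" by (simp only: configs_def)
  then show ?thesis by (simp add: ising_corr_def)
next
  case True
  define Z where "Z h = (\<Sum>\<sigma>\<in>configs V F. h \<sigma> * ising_weight \<beta> V \<sigma>)" for h
  define A where "A = Z (\<lambda>\<sigma>. \<sigma> x * \<sigma> y)"
  have half: "(\<Sum>\<sigma>\<in>configs V (insert w F). h \<sigma> * ising_weight \<beta> V \<sigma>) = (Z h + Z (\<lambda>\<sigma>. h \<sigma> * \<sigma> w)) / 2" for h
  proof -
    have eq: "configs V (insert w F) = {\<sigma> \<in> configs V F. \<sigma> w = 1}"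
    proof (intro set_eqI iffI)
      fix \<sigma> assume h: "\<sigma> \<in> configs V (insert w F)"
      have "\<sigma> z \<in> {-1, 1}" for z using configs_val[OF h, of z] by auto
      moreover have "\<sigma> z = 1" if "z = w \<or> z \<notin> V - F" for z
        using h that unfolding configs_def by blast
      ultimately show "\<sigma> \<in> {\<sigma> \<in> configs V F. \<sigma> w = 1}" unfolding configs_def by blast
    next
      fix \<sigma> assume "\<sigma> \<in> {\<sigma> \<in> configs V F. \<sigma> w = 1}"
      then have h: "\<sigma> \<in> configs V F" "\<sigma> w = 1" by auto
      have "\<sigma> z = 1" if "z \<notin> V - insert w F" for z
        using h that unfolding configs_def by (cases "z = w") blast+
      moreover have "\<sigma> z \<in> {-1, 1}" for z using configs_val[OF h(1), of z] by auto
      ultimately show "\<sigma> \<in> configs V (insert w F)" unfolding configs_def by blast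
    qed
    have "Z h + Z (\<lambda>\<sigma>. h \<sigma> * \<sigma> w) = (\<Sum>\<sigma>\<in>configs V F. if \<sigma> w = 1 then 2 * (h \<sigma> * ising_weight \<beta> V \<sigma>) else 0)"
      unfolding Z_def sum.distrib[symmetric]
    proof (intro sum.cong refl)
      fix \<sigma> assume "\<sigma> \<in> configs V F"
      then show "h \<sigma> * ising_weight \<beta> V \<sigma> + h \<sigma> * \<sigma> w * ising_weight \<beta> V \<sigma> =
        (if \<sigma> w = 1 then 2 * (h \<sigma> * ising_weight \<beta> V \<sigma>) else 0)"
        using configs_val[of \<sigma> V F w] by auto
    qed
    also have "\<dots> = 2 * (\<Sum>\<sigma>\<in>configs V (insert w F). h \<sigma> * ising_weight \<beta> V \<sigma>)"
      unfolding eq by (simp add: sum.inter_filter V sum_distrib_left if_distrib cong: if_cong)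
    finally show ?thesis by simp
  qed
  have N: "Z (\<lambda>_. 1) > 0" using ising_partition_pos[OF V] by (simp add: Z_def)
  have N2: "Z (\<lambda>_. 1) + Z (\<lambda>\<sigma>. \<sigma> w) > 0"
    using half[of "\<lambda>_. 1"] ising_partition_pos[OF V, of \<beta> "insert w F"] by simp
  have g: "A * Z (\<lambda>\<sigma>. \<sigma> w) \<le> Z (\<lambda>\<sigma>. \<sigma> x * \<sigma> y * \<sigma> w) * Z (\<lambda>_. 1)"
    using griffiths_second[OF V \<beta>, where F = F and k = "[x,y]" and l = "[w]"] by (simp add: Z_def A_def mult.assoc)
  have "ising_corr \<beta> V F x y = A / Z (\<lambda>_. 1)" by (simp add: ising_corr_def Z_def A_def)
  also have "\<dots> \<le> (A + Z (\<lambda>\<sigma>. \<sigma> x * \<sigma> y * \<sigma> w)) / (Z (\<lambda>_. 1) + Z (\<lambda>\<sigma>. \<sigma> w))"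
    using N N2 g by (simp add: divide_simps) (simp add: algebra_simps)
  also have "\<dots> = ising_corr \<beta> V (insert w F) x y"
  proof -
    have h: "(\<Sum>\<sigma>\<in>configs V (insert w F). \<sigma> x * \<sigma> y * ising_weight \<beta> V \<sigma>) = (A + Z (\<lambda>\<sigma>. \<sigma> x * \<sigma> y * \<sigma> w)) / 2"
      "(\<Sum>\<sigma>\<in>configs V (insert w F). ising_weight \<beta> V \<sigma>) = (Z (\<lambda>_. 1) + Z (\<lambda>\<sigma>. \<sigma> w)) / 2"
      using half[of "\<lambda>\<sigma>. \<sigma> x * \<sigma> y"] half[of "\<lambda>_. 1"] unfolding A_def by simp_all
    have "(s / 2) / (t / 2) = s / t" for s t :: real by simp
    then show ?thesis unfolding ising_corr_def h by (simp only:)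
  qed
  finally show ?thesis .
qed

lemma ising_corr_mono:
  assumes V: "finite V" and \<beta>: "\<beta> \<ge> 0" and W: "finite W"
  shows "ising_corr \<beta> V F x y \<le> ising_corr \<beta> V (W \<union> F) x y"
  using W
proof (induction W rule: finite_induct)
  case (insert w W)
  then show ?case using ising_corr_insert[OF V \<beta>, of "W \<union> F" x y w] by simp
qed simp

lemma ising_corr_nonneg:
  assumes V: "finite V" and \<beta>: "\<beta> \<ge> 0"
  shows "ising_corr \<beta> V F x y \<ge> 0"
proof -
  have "(\<Sum>\<sigma>\<in>configs V F. prod_list (map \<sigma> [x,y]) * (\<Prod>e\<in>nn_edges V. exp (\<beta> * (\<sigma> (fst e) * \<sigma> (snd e))))) \<ge> 0"
    by (rule griffiths_first_exp) (use V \<beta> in auto)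
  then have "(\<Sum>\<sigma>\<in>configs V F. \<sigma> x * \<sigma> y * ising_weight \<beta> V \<sigma>) \<ge> 0"
    by (simp add: ising_weight_prod[OF V] mult.assoc)
  then show ?thesis using ising_partition_pos[OF V, of \<beta> F] by (simp add: ising_corr_def)
qed

section \<open>Monotonicity and limit of the plus correlation\<close>

lemma nn_edges_nn: "(p,q) \<in> nn_edges V \<Longrightarrow> nn p q \<and> nn q p"
  by (auto simp: nn_edges_def nn_def)

text \<open>Fixing all spins of the larger rectangle outside the interior of the smaller one gives
  back the smaller plus model, as the extra edges then contribute a constant factor; and fixing
  spins to 1 cannot lower the correlation.\<close>

lemma plus_corr_antimono:
  assumes \<beta>: "\<beta> \<ge> 0" and sub: "rect R \<subseteq> rect R'"
  shows "plus_corr \<beta> R' x y \<le> plus_corr \<beta> R x y"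
proof -
  let ?V = "rect R" and ?V' = "rect R'"
  define W where "W = ?V' - (?V - bdry ?V)"
  have "?V' - (W \<union> bdry ?V') = ?V - bdry ?V"
    using sub by (auto simp: W_def bdry_def)
  then have C: "configs ?V' (W \<union> bdry ?V') = configs ?V (bdry ?V)" by (simp only: configs_def)
  define n where "n = card (nn_edges ?V' - nn_edges ?V)"
  have w: "ising_weight \<beta> ?V' \<sigma> = exp (\<beta> * n) * ising_weight \<beta> ?V \<sigma>" if \<sigma>: "\<sigma> \<in> configs ?V (bdry ?V)" for \<sigma>
  proof -
    have sub': "nn_edges ?V \<subseteq> nn_edges ?V'" using sub by (auto simp: nn_edges_def)
    have one: "\<sigma> p = 1" if "p \<notin> ?V - bdry ?V" for p using \<sigma> that unfolding configs_def by blast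
    have "(\<Sum>(p,q)\<in>nn_edges ?V' - nn_edges ?V. \<sigma> p * \<sigma> q) = (\<Sum>e\<in>nn_edges ?V' - nn_edges ?V. 1)"
    proof (intro sum.cong refl, clarify)
      fix p p' q q' assume e: "((p,p'),(q,q')) \<in> nn_edges ?V'" "((p,p'),(q,q')) \<notin> nn_edges ?V"
      then have "(p,p') \<notin> ?V \<or> (q,q') \<notin> ?V" by (auto simp: nn_edges_def)
      with nn_edges_nn[OF e(1)] have "(p,p') \<notin> ?V - bdry ?V" "(q,q') \<notin> ?V - bdry ?V" by (auto simp: bdry_def)
      then show "\<sigma> (p,p') * \<sigma> (q,q') = 1" by (simp add: one)
    qed
    then have "(\<Sum>(p,q)\<in>nn_edges ?V'. \<sigma> p * \<sigma> q) = n + (\<Sum>(p,q)\<in>nn_edges ?V. \<sigma> p * \<sigma> q)"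
      using sum.subset_diff[OF sub', of "\<lambda>(p,q). \<sigma> p * \<sigma> q"] by (simp add: n_def)
    then show ?thesis by (simp add: ising_weight_def distrib_left exp_add)
  qed
  have "ising_corr \<beta> ?V' (W \<union> bdry ?V') x y = plus_corr \<beta> R x y"
  proof -
    have "(\<Sum>\<sigma>\<in>configs ?V (bdry ?V). h \<sigma> * ising_weight \<beta> ?V' \<sigma>) = exp (\<beta> * n) * (\<Sum>\<sigma>\<in>configs ?V (bdry ?V). h \<sigma> * ising_weight \<beta> ?V \<sigma>)" for h
      unfolding sum_distrib_left by (intro sum.cong refl) (simp add: w)
    from this this[of "\<lambda>_. 1"] show ?thesis by (simp add: plus_corr_def ising_corr_def C)
  qed
  moreover have "plus_corr \<beta> R' x y \<le> ising_corr \<beta> ?V' (W \<union> bdry ?V') x y"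
    unfolding plus_corr_def by (rule ising_corr_mono) (auto simp: \<beta> W_def)
  ultimately show ?thesis by simp
qed

text \<open>The correlation is antitone in the rectangle and bounded below by 0, and centred squares
  are cofinal, so the limit is the infimum along them.\<close>

lemma plus_corr_tendsto:
  assumes \<beta>: "\<beta> \<ge> 0"
  shows "((\<lambda>R. plus_corr \<beta> R x y) \<longlongrightarrow> Lim rect_filter (\<lambda>R. plus_corr \<beta> R x y)) rect_filter"
proof -
  let ?g = "\<lambda>R. plus_corr \<beta> R x y"
  let ?b = "\<lambda>N. (- int N, int N, - int N, int N)"
  define L where "L = (INF N. ?g (?b N))"
  have bdd: "bdd_below (range (\<lambda>N. ?g (?b N)))"
    by (rule bdd_belowI[of _ 0]) (auto simp: plus_corr_def intro: ising_corr_nonneg \<beta>)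
  have "(?g \<longlongrightarrow> L) rect_filter"
  proof (rule tendstoI)
    fix e :: real assume e: "e > 0"
    then obtain N where N: "?g (?b N) < L + e"
      using cINF_less_iff[OF _ bdd, of "L + e"] by (auto simp: L_def)
    have "dist (?g R) L < e" if R: "R \<in> big_rects N" for R
    proof -
      obtain a b c d where R': "R = (a,b,c,d)" by (cases R)
      have "?g R \<le> ?g (?b N)"
        using R by (intro plus_corr_antimono \<beta>) (auto simp: R' rect_def big_rects_def)
      define M where "M = nat (\<bar>a\<bar> + \<bar>b\<bar> + \<bar>c\<bar> + \<bar>d\<bar>)"
      have "?g (?b M) \<le> ?g R"
        by (intro plus_corr_antimono \<beta>) (auto simp: R' rect_def M_def)
      moreover have "L \<le> ?g (?b M)" unfolding L_def by (rule cINF_lower[OF bdd]) auto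
      ultimately show ?thesis using \<open>?g R \<le> ?g (?b N)\<close> N by (simp add: dist_real_def)
    qed
    then show "eventually (\<lambda>R. dist (?g R) L < e) rect_filter" unfolding eventually_rect_filter by blast
  qed
  then show ?thesis using tendsto_Lim[OF rect_filter_neq_bot] by metis
qed

section \<open>Convergence\<close>

lemma free_corr_spin_sum:
  assumes v: "v \<in> rect R"
  shows "free_corr \<beta> R u v = spin_sum (rect R) (\<lambda>a b. tanh \<beta>) u v / spin_sum (rect R) (\<lambda>a b. tanh \<beta>) v v"
proof -
  let ?V = "rect R"
  define K where "K = (\<Prod>e\<in>nn_edges ?V. cosh \<beta>)"
  have K: "K > 0" unfolding K_def by (intro prod_pos) (simp add: cosh_real_pos)
  have w: "ising_weight \<beta> ?V \<sigma> = K * (\<Prod>(a,b)\<in>nn_edges ?V. 1 + tanh \<beta> * (\<sigma> a * \<sigma> b))" if \<sigma>: "\<sigma> \<in> configs ?V {}" for \<sigma>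
    unfolding ising_weight_prod[OF finite_rect] K_def prod.distrib[symmetric] case_prod_beta
  proof (intro prod.cong refl)
    fix e
    have "\<sigma> (fst e) * \<sigma> (snd e) = 1 \<or> \<sigma> (fst e) * \<sigma> (snd e) = -1"
      using configs_val[OF \<sigma>, of "fst e"] configs_val[OF \<sigma>, of "snd e"] by auto
    then have "exp (\<beta> * (\<sigma> (fst e) * \<sigma> (snd e))) = cosh \<beta> + sinh \<beta> * (\<sigma> (fst e) * \<sigma> (snd e))"
      by (rule exp_spin)
    also have "\<dots> = cosh \<beta> * (1 + tanh \<beta> * (\<sigma> (fst e) * \<sigma> (snd e)))"
      using cosh_real_pos[of \<beta>] by (simp add: tanh_def field_simps)
    finally show "exp (\<beta> * (\<sigma> (fst e) * \<sigma> (snd e))) = cosh \<beta> * (1 + tanh \<beta> * (\<sigma> (fst e) * \<sigma> (snd e)))" .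
  qed
  have "(\<Sum>\<sigma>\<in>configs ?V {}. \<sigma> u * \<sigma> v * ising_weight \<beta> ?V \<sigma>) = K * spin_sum ?V (\<lambda>a b. tanh \<beta>) u v"
    unfolding spin_sum_def sum_distrib_left by (intro sum.cong refl) (simp add: w)
  moreover have "(\<Sum>\<sigma>\<in>configs ?V {}. ising_weight \<beta> ?V \<sigma>) = K * spin_sum ?V (\<lambda>a b. tanh \<beta>) v v"
    unfolding spin_sum_def sum_distrib_left by (intro sum.cong refl) (simp add: w configs_sq)
  ultimately show ?thesis using K by (simp add: free_corr_def ising_corr_def)
qed

lemma step_weight_bound: "0 \<le> x \<Longrightarrow> \<bar>step_weight V x us vs p q\<bar> \<le> x"
  by (simp add: step_weight_def abs_mult)

text \<open>The amplitude A of the source is the corner value at v next to vf. There the marked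
  spins cancel, so A is a partition function with disorder lines at uf and vf, and its quotient by
  the plain partition function is the dual plus correlation.\<close>

theorem free_corr_factorisation:
  fixes u v uf vf cv cu :: "vertex"
  assumes x: "0 < tanh \<beta>" "tanh \<beta> * (1 + sqrt 2) < 1" and \<beta>s: "exp (- 2 * \<beta>s) = tanh \<beta>"
    and uv: "u \<noteq> v" and R: "R = (a,b,c,d)" "a \<le> b" "c \<le> d" and u: "u \<in> rect R" and v: "v \<in> rect R"
    and uf: "fst uf = fst u \<or> fst uf = fst u - 1" "snd uf = snd u \<or> snd uf = snd u - 1"
    and vf: "fst vf = fst v \<or> fst vf = fst v - 1" "snd vf = snd v \<or> snd vf = snd v - 1"
    and cv: "cv = (2 * (fst v - fst vf) - 1, 2 * (snd v - snd vf) - 1)"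
    and cu: "cu = (2 * (fst uf - fst u) + 1, 2 * (snd uf - snd u) + 1)"
  shows "free_corr \<beta> R u v = side_sign v vf u (fst uf) *
    (\<Sum>d\<in>dirs. tw d cu * (\<Sum>n. walk_sum (step_weight (rect R) (tanh \<beta>) uf vf) v cv n u d)) *
    plus_corr \<beta>s (a-1,b,c-1,d) uf vf"
proof -
  define x where "x = tanh \<beta>"
  let ?V = "rect R"
  let ?W = "step_weight ?V x uf vf"
  have x0: "0 < x" "x * (1 + sqrt 2) < 1" using x by (simp_all add: x_def)
  have W: "\<bar>?W p q\<bar> \<le> x" for p q using x0 by (intro step_weight_bound) simp
  define A where "A = corner_sum ?V x uf v v vf"
  have psi: "psi_field ?V x uf v vf u d = A * (\<Sum>n. walk_sum ?W v cv n u d)" if d: "d \<in> dirs" for d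
  proof -
    have s: "(\<lambda>n. A * walk_sum ?W v cv n u d) sums psi_field ?V x uf v vf u d"
    proof (rule resolvent_expansion[where W = ?W and x = x and V = ?V])
      show "\<bar>?W p q\<bar> \<le> x" for p q by (rule W)
      show "psi_field ?V x uf v vf p d = ?W (p - d) p * ((\<Sum>d'\<in>dirs. transition d' d * psi_field ?V x uf v vf (p - d) d')
         + (if p - d = v then tw cv d * A else 0))" if "d \<in> dirs" for p d
        unfolding cv A_def by (rule psi_field_recursion[OF finite_rect v vf that])
      show "psi_field ?V x uf v vf p d = 0" if "p \<notin> ?V" for p d
        using that by (cases p) (simp add: psi_field_def Let_def)
    qed (use x0 d in auto)
    have "summable (\<lambda>n. walk_sum ?W v cv n u d)"
    proof (rule summable_comparison_test')
      show "norm (walk_sum ?W v cv n u d) \<le> (x * (1 + sqrt 2)) ^ n * (2 * x)" for n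
        unfolding real_norm_def by (rule walk_sum_bound[OF W d])
      show "summable (\<lambda>n. (x * (1 + sqrt 2)) ^ n * (2 * x))"
        using x0 by (intro summable_mult2 summable_geometric) auto
    qed
    then show ?thesis using sums_unique[OF s] suminf_mult by metis
  qed
  \<comment> \<open>With both ends at the face uf, the two disorder lines coincide and
    cancel.\<close>
  have cs: "corner_sum ?V x uf v u uf = spin_sum ?V (\<lambda>a b. x) u v"
    by (simp add: corner_sum_def mult.assoc)
  have kw: "plus_corr \<beta>s (a-1,b,c-1,d) uf vf = A / spin_sum ?V (\<lambda>p q. x) v v"
    unfolding A_def corner_sum_def R(1)
  proof (rule kramers_wannier)
    show "uf \<in> rect (a-1,b,c-1,d)" "vf \<in> rect (a-1,b,c-1,d)"
      using u v uf vf by (cases u; cases v; cases uf; cases vf; auto simp: R mem_rect)+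
  qed (use R v \<beta>s in \<open>auto simp: x_def\<close>)
  have "spin_sum ?V (\<lambda>a b. x) u v = side_sign v vf u (fst uf) * (\<Sum>d\<in>dirs. tw d cu * psi_field ?V x uf v vf u d)"
    using corner_sum_psi_field[OF finite_rect v vf u uv uf, of x uf] unfolding cs cu .
  also have "\<dots> = side_sign v vf u (fst uf) * (\<Sum>d\<in>dirs. tw d cu * (\<Sum>n. walk_sum ?W v cv n u d)) * A"
  proof -
    have "(\<Sum>d\<in>dirs. tw d cu * psi_field ?V x uf v vf u d) = (\<Sum>d\<in>dirs. tw d cu * (\<Sum>n. walk_sum ?W v cv n u d)) * A"
      unfolding sum_distrib_right by (intro sum.cong refl) (simp add: psi)
    then show ?thesis by (simp only: mult.assoc)
  qed
  finally show ?thesis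
    unfolding free_corr_spin_sum[OF v] kw x_def[symmetric] by simp
qed

lemma filterlim_outer_rect:
  "filterlim (\<lambda>(a,b,c,d). (a-1,b,c-1,d)) rect_filter rect_filter"
  unfolding filterlim_iff eventually_rect_filter
proof (intro allI impI)
  fix P assume "\<exists>N. \<forall>R\<in>big_rects N. P R"
  then obtain N where N: "\<forall>R\<in>big_rects N. P R" by blast
  have "(case R of (a,b,c,d) \<Rightarrow> (a-1,b,c-1,d)) \<in> big_rects N" if "R \<in> big_rects N" for R
    using that by (cases R) (auto simp: big_rects_def)
  then show "\<exists>N. \<forall>R\<in>big_rects N. P (case R of (a,b,c,d) \<Rightarrow> (a-1,b,c-1,d))" using N by blast
qed

lemma emb_dual_idx:
  assumes "dual_nbr v vs"
  shows "fst (dual_idx vs) = fst v \<or> fst (dual_idx vs) = fst v - 1"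
    and "snd (dual_idx vs) = snd v \<or> snd (dual_idx vs) = snd v - 1"
    and "vs = (2 * fst (dual_idx vs) + 1, 2 * snd (dual_idx vs) + 1)"
proof -
  obtain a b where v: "v = (a,b)" by (cases v)
  have "fst vs = 2 * a + 1 \<or> fst vs = 2 * a - 1" "snd vs = 2 * b + 1 \<or> snd vs = 2 * b - 1"
    using assms by (auto simp: dual_nbr_def v abs_if split: if_splits)
  then show "fst (dual_idx vs) = fst v \<or> fst (dual_idx vs) = fst v - 1"
    "snd (dual_idx vs) = snd v \<or> snd (dual_idx vs) = snd v - 1"
    "vs = (2 * fst (dual_idx vs) + 1, 2 * snd (dual_idx vs) + 1)"
    by (cases vs; auto simp: dual_idx_def v)+
qed


theorem mainTheorem14:
  fixes \<beta> \<beta>c \<beta>s :: real and u v us vs :: "int \<times> int" and \<gamma> :: "(int \<times> int) list"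
  assumes "tanh \<beta>c = sqrt 2 - 1"
    and "0 < \<beta>" and "\<beta> < \<beta>c"
    and "exp (- 2 * \<beta>s) = tanh \<beta>"
    and "u \<noteq> v"
    and "dual_nbr u us" and "dual_nbr v vs"
    and "dual_saw \<gamma> us vs"
  shows "summable (\<lambda>r. norm (f_r \<beta> u v \<gamma> (Suc r)))
    \<and> ((\<lambda>R. complex_of_real (free_corr \<beta> R u v)) \<longlongrightarrow>
         (\<Sum>r. f_r \<beta> u v \<gamma> (Suc r)) * complex_of_real (dual_plus_corr \<beta>s us vs)) rect_filter"
proof -
  define x where "x = tanh \<beta>"
  have x0: "0 < x" using assms(2) by (simp add: x_def)
  have "x < sqrt 2 - 1" unfolding x_def assms(1)[symmetric] using assms(3) by simp
  then have "x * (1 + sqrt 2) < (sqrt 2 - 1) * (1 + sqrt 2)" by (intro mult_strict_right_mono) (auto simp: add_pos_pos)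
  also have "(sqrt 2 - 1) * (1 + sqrt 2) = 1" by (simp add: algebra_simps)
  finally have x1: "x * (1 + sqrt 2) < 1" .
  \<comment> \<open>As tanh is less than 1, the dual inverse temperature is positive, and the
    Griffiths inequalities apply to it.\<close>
  have "exp (- 2 * \<beta>s) < exp 0" unfolding assms(4) using tanh_real_lt_1[of \<beta>] by simp
  then have \<beta>s: "\<beta>s \<ge> 0" unfolding exp_less_cancel_iff by simp
  define uf vf where "uf = dual_idx us" and "vf = dual_idx vs"
  note uf = emb_dual_idx[OF assms(6), folded uf_def] and vf = emb_dual_idx[OF assms(7), folded vf_def]
  define cv cu where "cv = emb v - vs" and "cu = us - emb u"
  have cv: "cv = (2 * (fst v - fst vf) - 1, 2 * (snd v - snd vf) - 1)"
    unfolding cv_def by (subst vf(3)) (simp add: emb_def)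
  have cu: "cu = (2 * (fst uf - fst u) + 1, 2 * (snd uf - snd u) + 1)"
    unfolding cu_def by (subst uf(3)) (simp add: emb_def)
  define \<kappa> where "\<kappa> = side_sign v vf u (fst uf)"
  define W where "W V = step_weight V x uf vf" for V
  have W: "\<bar>W V p q\<bar> \<le> x" for V p q unfolding W_def using x0 by (intro step_weight_bound) simp
  let ?w = "\<lambda>V n d. walk_sum (W V) v cv n u d"
  have f: "f_r \<beta> u v \<gamma> (Suc n) = complex_of_real (\<kappa> * (\<Sum>d\<in>dirs. tw d cu * ?w UNIV n d))" for n
    unfolding f_r_walk_sum[OF assms(5-8)] \<kappa>_def W_def uf_def vf_def x_def cv_def cu_def ..
  have geo: "summable (\<lambda>n. (x * (1 + sqrt 2)) ^ n * (2 * x))"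
    using x0 x1 by (intro summable_mult2 summable_geometric) auto
  have bound: "\<bar>?w V n d\<bar> \<le> (x * (1 + sqrt 2)) ^ n * (2 * x)" if "d \<in> dirs" for V n d
    by (rule walk_sum_bound[OF W that])
  have sw: "summable (\<lambda>n. norm (?w UNIV n d))" if "d \<in> dirs" for d
    by (rule summable_comparison_test'[OF geo]) (use bound[OF that] in simp)
  define S where "S V = (\<Sum>d\<in>dirs. tw d cu * (\<Sum>n. ?w V n d))" for V
  have summ: "summable (\<lambda>r. norm (f_r \<beta> u v \<gamma> (Suc r)))"
  proof (rule summable_comparison_test')
    show "summable (\<lambda>n. \<Sum>d\<in>dirs. norm (?w UNIV n d))" by (intro summable_sum sw)
    fix n
    have "\<bar>\<kappa>\<bar> = 1" by (simp add: \<kappa>_def side_sign_def)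
    then have "norm (f_r \<beta> u v \<gamma> (Suc n)) = \<bar>\<Sum>d\<in>dirs. tw d cu * ?w UNIV n d\<bar>"
      unfolding f norm_of_real by (simp add: abs_mult)
    also have "\<dots> \<le> (\<Sum>d\<in>dirs. \<bar>tw d cu * ?w UNIV n d\<bar>)" by (rule sum_abs)
    also have "\<dots> = (\<Sum>d\<in>dirs. norm (?w UNIV n d))" by (simp add: abs_mult)
    finally show "norm (norm (f_r \<beta> u v \<gamma> (Suc n))) \<le> (\<Sum>d\<in>dirs. norm (?w UNIV n d))" by simp
  qed
  have "(\<lambda>n. \<kappa> * (\<Sum>d\<in>dirs. tw d cu * ?w UNIV n d)) sums (\<kappa> * S UNIV)"
    unfolding S_def by (intro sums_mult sums_sum summable_sums summable_norm_cancel[OF sw])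
  then have "(\<lambda>n. complex_of_real (\<kappa> * (\<Sum>d\<in>dirs. tw d cu * ?w UNIV n d))) sums complex_of_real (\<kappa> * S UNIV)"
    by (rule sums_of_real)
  then have fs: "(\<Sum>r. f_r \<beta> u v \<gamma> (Suc r)) = complex_of_real (\<kappa> * S UNIV)"
    unfolding f by (rule sums_unique[symmetric])
  have Slim: "((\<lambda>R. S (rect R)) \<longlongrightarrow> S UNIV) rect_filter"
    unfolding S_def
  proof (intro tendsto_sum tendsto_mult tendsto_const)
    fix d assume d: "d \<in> dirs"
    show "((\<lambda>R. \<Sum>n. ?w (rect R) n d) \<longlongrightarrow> (\<Sum>n. ?w UNIV n d)) rect_filter"
    proof (rule walk_sum_series_tendsto[where WR = "\<lambda>R. W (rect R)" and x = x])
      fix N :: int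
      have "\<forall>R\<in>big_rects (nat \<bar>N\<bar>). \<forall>p q. \<bar>fst p\<bar> \<le> N \<and> \<bar>snd p\<bar> \<le> N \<and> \<bar>fst q\<bar> \<le> N \<and> \<bar>snd q\<bar> \<le> N \<longrightarrow>
          W (rect R) p q = W UNIV p q"
        by (auto simp: big_rects_def W_def step_weight_def mem_rect)
      then show "\<forall>\<^sub>F R in rect_filter. \<forall>p q. \<bar>fst p\<bar> \<le> N \<and> \<bar>snd p\<bar> \<le> N \<and> \<bar>fst q\<bar> \<le> N \<and> \<bar>snd q\<bar> \<le> N \<longrightarrow>
          W (rect R) p q = W UNIV p q"
        unfolding eventually_rect_filter by blast
    qed (use W x1 rect_filter_neq_bot d in auto)
  qed
  let ?o = "\<lambda>(a,b,c,d). (a-1,b,c-1,d) :: int \<times> int \<times> int \<times> int"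
  have plim: "((\<lambda>R. plus_corr \<beta>s (?o R) uf vf) \<longlongrightarrow> dual_plus_corr \<beta>s us vs) rect_filter"
    unfolding dual_plus_corr_def uf_def vf_def
    by (rule filterlim_compose[OF plus_corr_tendsto[OF \<beta>s] filterlim_outer_rect])
  \<comment> \<open>The factorisation is available once the rectangle contains u and v, hence only
    eventually.\<close>
  have ev: "\<forall>\<^sub>F R in rect_filter. \<kappa> * S (rect R) * plus_corr \<beta>s (?o R) uf vf = free_corr \<beta> R u v"
  proof -
    define N where "N = nat (\<bar>fst u\<bar> + \<bar>snd u\<bar> + \<bar>fst v\<bar> + \<bar>snd v\<bar>)"
    have "\<kappa> * S (rect R) * plus_corr \<beta>s (?o R) uf vf = free_corr \<beta> R u v" if R: "R \<in> big_rects N" for R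
    proof -
      obtain a b c d where R': "R = (a,b,c,d)" by (cases R)
      have mem: "u \<in> rect R" "v \<in> rect R" "a \<le> b" "c \<le> d"
      proof -
        have "a \<le> - int N" "int N \<le> b" "c \<le> - int N" "int N \<le> d" using R by (auto simp: R' big_rects_def)
        moreover have "int N = \<bar>fst u\<bar> + \<bar>snd u\<bar> + \<bar>fst v\<bar> + \<bar>snd v\<bar>" by (simp add: N_def)
        then have "- int N \<le> fst u" "fst u \<le> int N" "- int N \<le> snd u" "snd u \<le> int N"
          "- int N \<le> fst v" "fst v \<le> int N" "- int N \<le> snd v" "snd v \<le> int N" by linarith+
        moreover have "p \<in> rect R \<longleftrightarrow> a \<le> fst p \<and> fst p \<le> b \<and> c \<le> snd p \<and> snd p \<le> d" for p
          by (simp add: R' rect_def case_prod_beta)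
        ultimately show "u \<in> rect R" "v \<in> rect R" "a \<le> b" "c \<le> d" by auto
      qed
      show ?thesis
        using free_corr_factorisation[of \<beta> \<beta>s u v R a b c d uf vf cv cu] x0 x1 assms(4,5) R' mem uf(1,2) vf(1,2) cv cu
        by (simp add: \<kappa>_def S_def W_def x_def)
    qed
    then show ?thesis unfolding eventually_rect_filter by blast
  qed
  have "((\<lambda>R. \<kappa> * S (rect R) * plus_corr \<beta>s (?o R) uf vf) \<longlongrightarrow> \<kappa> * S UNIV * dual_plus_corr \<beta>s us vs) rect_filter"
    by (intro tendsto_mult tendsto_const Slim plim)
  then have "((\<lambda>R. free_corr \<beta> R u v) \<longlongrightarrow> \<kappa> * S UNIV * dual_plus_corr \<beta>s us vs) rect_filter"
    by (rule Lim_transform_eventually[OF _ ev])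
  then have "((\<lambda>R. complex_of_real (free_corr \<beta> R u v)) \<longlongrightarrow>
      (\<Sum>r. f_r \<beta> u v \<gamma> (Suc r)) * complex_of_real (dual_plus_corr \<beta>s us vs)) rect_filter"
    unfolding fs of_real_mult[symmetric] by (rule tendsto_of_real)
  with summ show ?thesis by blast
qed

end
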